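(* Let $\frac14<\kappa<\frac12$ and, for each step-size $\mu>0$, set $\delta=\mu^{\frac12-\kappa}$. Let $w_\delta^o$ be the unique minimizer over $\mathbb{R}^M$ of $\sum_{k=1}^N p_k\{J_k(w)+R_k^\delta(w)\}$, and let $\boldsymbol{w}_{k,i}$ be the iterates of the regularized diffusion strategy run with step-size $\mu$ and smoothing parameter $\delta$. Then for sufficiently small $\mu$ and every agent $k$, $$\limsup_{i\to\infty}\ \mathbb{E}\,\|w_\delta^o-\boldsymbol{w}_{k,i}\|^2=O(\mu),$$ i.e. there exist constants $\mu_0>0$ and $c>0$, independent of $\mu$, such that for all $0<\mu\le\mu_0$ and all $k$ this limit superior is at most $c\mu$.
   Context: $\|\cdot\|$ is the Euclidean norm. Random quantities are in boldface. Network. There are $N$ agents, and $A=[a_{\ell k}]$ is an $N\times N$ matrix with $a_{\ell k}\ge0$ and $\sum_\ell a_{\ell k}=1$ for every $k$ (left-stochastic). The network is strongly connected and at least one $a_{kk}>0$, so $A$ is primitive. $p$ is its Perron vector: $Ap=p$, $\mathbb{1}^{\mathsf T}p=1$, $p_k>0$. Costs. For each $k$, $J_k:\mathbb{R}^M\to\mathbb{R}$ is differentiable with $\|\nabla J_k(x)-\nabla J_k(y)\|\le\lambda_U\|x-y\|$ for all $x,y$. There is $\lambda_L>0$ with $(x-y)^{\mathsf T}\sum_k p_k(\nabla J_k(x)-\nabla J_k(y))\ge\lambda_L\|x-y\|^2$ for all $x,y$. For each $k$, $R_k:\mathbb{R}^M\to\mathbb{R}$ is closed convex (convex with closed sublevel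 sets), not necessarily differentiable. Smoothing. The conjugate is $R_k^\star(w)=\sup_{u}\{w^{\mathsf T}u-R_k(u)\}$, and $\mathrm{dom}\,R_k^\star$ is the set where it is finite. The function $d$ is a proximity function for each of the sets $C=\mathrm{dom}\,R_k^\star$: $d$ is continuous and strongly convex with constant one, $C\subseteq\mathrm{dom}\,d$, $\min_{w\in C}d(w)=0$, $\arg\min_{w\in C}d(w)=0$, and $d(w)\ge\frac12\|w\|^2$. For $\delta>0$, $$R_k^\delta(w)=\max_{u\in\mathrm{dom}\,R_k^\star}\{w^{\mathsf T}u-R_k^\star(u)-\delta\,d(u)\},$$ which is convex and differentiable. Algorithm (regularized diffusion strategy). From initial iterates $\boldsymbol{w}_{k,0}$ with finite second moments, for $i\ge1$ and each $k$: $$\boldsymbol{\phi}_{k,i}=\boldsymbol{w}_{k,i-1}-\mu\widehat{\nabla J}_k(\boldsymbol{w}_{k,i-1}),\quad \boldsymbol{\psi}_{k,i}=\boldsymbol{\phi}_{k,i}-\mu\nabla R_k^\delta(\boldsymbol{\phi}_{k,i}),\quad \boldsymbol{w}_{k,i}=\sum_{\ell=1}^N a_{\ell k}\boldsymbol{\psi}_{\ell,i},$$ where $\widehat{\nabla J}_k$ is a stochastic approximation of $\nabla J_k$. Gradient noise. Let $\boldsymbol{\mathcal F}_{i-1}$ be the filtration generated by $\{\boldsymbol{w}_{\ell,j}\}$ for all $\ell$ and $j\le i-1$, and let $\boldsymbol{s}_{k,i}=\widehat{\nabla J}_k(\boldsymbol{w}_{k,i-1})-\nabla J_k(\boldsymbol{w}_{k,i-1})$.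 There are constants $\beta^2,\sigma^2\ge0$ (independent of $\mu$) with $\mathbb{E}[\boldsymbol{s}_{k,i}\mid\boldsymbol{\mathcal F}_{i-1}]=0$ and $\mathbb{E}[\|\boldsymbol{s}_{k,i}\|^2\mid\boldsymbol{\mathcal F}_{i-1}]\le\beta^2\|\boldsymbol{w}_{k,i-1}\|^2+\sigma^2$. *)

theory Defs
  imports "HOL-Probability.Probability"
begin

section \<open>Network\<close>

definition left_stochastic :: "real^'n^'n \<Rightarrow> bool" where
  "left_stochastic A \<longleftrightarrow> (\<forall>l k. A $ l $ k \<ge> 0) \<and> (\<forall>k. (\<Sum>l\<in>UNIV. A $ l $ k) = 1)"

definition strongly_connected :: "real^'n^'n \<Rightarrow> bool" where
  "strongly_connected A \<longleftrightarrow> (\<forall>l k. (l, k) \<in> {(i, j). A $ i $ j > 0}\<^sup>*)"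

definition perron_vector :: "real^'n^'n \<Rightarrow> real^'n \<Rightarrow> bool" where
  "perron_vector A p \<longleftrightarrow> A *v p = p \<and> (\<Sum>k\<in>UNIV. p $ k) = 1 \<and> (\<forall>k. p $ k > 0)"


section \<open>Gradients, convexity and smoothing\<close>

definition grad :: "('a::real_inner \<Rightarrow> real) \<Rightarrow> 'a \<Rightarrow> 'a" where
  "grad f x = (THE g. GDERIV f x :> g)"

definition closed_convex_fun :: "('a::real_normed_vector \<Rightarrow> real) \<Rightarrow> bool" where
  "closed_convex_fun f \<longleftrightarrow> convex_on UNIV f \<and> (\<forall>c. closed {x. f x \<le> c})"

definition strongly_convex_on :: "real \<Rightarrow> 'a::real_normed_vector set \<Rightarrow> ('a \<Rightarrow> real) \<Rightarrow> bool" where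
  "strongly_convex_on m S f \<longleftrightarrow> convex S \<and>
     (\<forall>x\<in>S. \<forall>y\<in>S. \<forall>t\<in>{0..1}.
        f ((1 - t) *\<^sub>R x + t *\<^sub>R y)
          \<le> (1 - t) * f x + t * f y - m / 2 * t * (1 - t) * (norm (x - y))\<^sup>2)"

definition conjugate :: "('a::real_inner \<Rightarrow> real) \<Rightarrow> 'a \<Rightarrow> ereal" where
  "conjugate f w = (SUP u. ereal (w \<bullet> u - f u))"

definition eff_dom :: "('a \<Rightarrow> ereal) \<Rightarrow> 'a set" where
  "eff_dom f = {w. \<bar>f w\<bar> \<noteq> \<infinity>}"

definition proximity_function :: "'a::real_inner set \<Rightarrow> ('a \<Rightarrow> ereal) \<Rightarrow> bool" where
  "proximity_function C d \<longleftrightarrow>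
     continuous_on (eff_dom d) d \<and>
     strongly_convex_on 1 (eff_dom d) (\<lambda>w. real_of_ereal (d w)) \<and>
     C \<subseteq> eff_dom d \<and>
     {w. is_arg_min d (\<lambda>u. u \<in> C) w} = {0} \<and>
     d 0 = 0 \<and>
     (\<forall>w\<in>C. d w \<ge> ereal ((norm w)\<^sup>2 / 2))"

text \<open>On the index set all terms are finite, so the passage to the reals loses nothing. For closed
  convex \<open>R\<close>, \<open>\<delta> > 0\<close> and a proximity function \<open>d\<close> of \<open>eff_dom (conjugate R)\<close> the supremum is
  attained, i.e. it is a maximum.\<close>

definition smoothed :: "('a::real_inner \<Rightarrow> ereal) \<Rightarrow> real \<Rightarrow> ('a \<Rightarrow> real) \<Rightarrow> 'a \<Rightarrow> real" where
  "smoothed d \<delta> R w =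
     (SUP u \<in> eff_dom (conjugate R).
        w \<bullet> u - real_of_ereal (conjugate R u) - \<delta> * real_of_ereal (d u))"

definition aggregate_cost ::
  "real^'n \<Rightarrow> ('n \<Rightarrow> 'a::real_inner \<Rightarrow> real) \<Rightarrow> ('n \<Rightarrow> 'a \<Rightarrow> real) \<Rightarrow> ('a \<Rightarrow> ereal) \<Rightarrow> real \<Rightarrow> 'a \<Rightarrow> real"
where
  "aggregate_cost p J R d \<delta> w = (\<Sum>k\<in>UNIV. p $ k * (J k w + smoothed d \<delta> (R k) w))"

definition the_minimizer :: "('a \<Rightarrow> real) \<Rightarrow> 'a" where
  "the_minimizer f = (THE w. is_arg_min f (\<lambda>_. True) w)"


section \<open>Stochastic iterates\<close>

definition history ::
  "'w measure \<Rightarrow> ('n \<Rightarrow> nat \<Rightarrow> 'w \<Rightarrow> 'a::topological_space) \<Rightarrow> nat \<Rightarrow> 'w measure" where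
  "history M w i =
     sigma (space M) (\<Union>l. \<Union>j\<in>{..i}. {w l j -` B \<inter> space M | B. B \<in> sets borel})"

text \<open>One run of the algorithm. \<open>gh k i \<omega> x\<close> is the stochastic approximation of the gradient of
  the \<open>k\<close>-th cost at the point \<open>x\<close> that is available to agent \<open>k\<close> at time \<open>i\<close>.\<close>

definition regularized_diffusion ::
  "'w measure \<Rightarrow> real^'n^'n \<Rightarrow> ('n \<Rightarrow> 'a::euclidean_space \<Rightarrow> real) \<Rightarrow> ('a \<Rightarrow> ereal) \<Rightarrow>
   real \<Rightarrow> real \<Rightarrow> ('n \<Rightarrow> nat \<Rightarrow> 'w \<Rightarrow> 'a \<Rightarrow> 'a) \<Rightarrow> ('n \<Rightarrow> nat \<Rightarrow> 'w \<Rightarrow> 'a) \<Rightarrow> bool"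
where
  "regularized_diffusion M A R d \<mu> \<delta> gh w \<longleftrightarrow>
     (\<forall>k. w k 0 \<in> borel_measurable M \<and> integrable M (\<lambda>\<omega>. (norm (w k 0 \<omega>))\<^sup>2)) \<and>
     (\<exists>\<phi> \<psi>. \<forall>i\<ge>1. \<forall>k. \<forall>\<omega>\<in>space M.
        \<phi> k i \<omega> = w k (i - 1) \<omega> - \<mu> *\<^sub>R gh k i \<omega> (w k (i - 1) \<omega>) \<and>
        \<psi> k i \<omega> = \<phi> k i \<omega> - \<mu> *\<^sub>R grad (smoothed d \<delta> (R k)) (\<phi> k i \<omega>) \<and>
        w k i \<omega> = (\<Sum>l\<in>UNIV. A $ l $ k *\<^sub>R \<psi> l i \<omega>))"

definition gradient_noise ::
  "('n \<Rightarrow> 'a::euclidean_space \<Rightarrow> real) \<Rightarrow> ('n \<Rightarrow> nat \<Rightarrow> 'w \<Rightarrow> 'a \<Rightarrow> 'a) \<Rightarrow>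
   ('n \<Rightarrow> nat \<Rightarrow> 'w \<Rightarrow> 'a) \<Rightarrow> 'n \<Rightarrow> nat \<Rightarrow> 'w \<Rightarrow> 'a"
where
  "gradient_noise J gh w k i \<omega> = gh k i \<omega> (w k (i - 1) \<omega>) - grad (J k) (w k (i - 1) \<omega>)"

text \<open>The conditional mean of a vector is taken coordinatewise. The conditional second moment is
  the one of a nonnegative random variable, so it is meaningful before integrability is known;
  integrability of the noise then follows along the recursion from the finite second moments of the
  initial iterates. Measurability is required because \<^const>\<open>nn_cond_exp\<close> is \<open>0\<close> by convention on
  nonmeasurable functions.\<close>

definition gradient_noise_condition ::
  "'w measure \<Rightarrow> ('n \<Rightarrow> 'a::euclidean_space \<Rightarrow> real) \<Rightarrow> real \<Rightarrow> real \<Rightarrow>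
   ('n \<Rightarrow> nat \<Rightarrow> 'w \<Rightarrow> 'a \<Rightarrow> 'a) \<Rightarrow> ('n \<Rightarrow> nat \<Rightarrow> 'w \<Rightarrow> 'a) \<Rightarrow> bool"
where
  "gradient_noise_condition M J \<beta> \<sigma> gh w \<longleftrightarrow>
     (\<forall>i\<ge>1. \<forall>k.
        gradient_noise J gh w k i \<in> borel_measurable M \<and>
        (\<forall>b\<in>Basis. AE \<omega> in M.
           real_cond_exp M (history M w (i - 1)) (\<lambda>\<omega>'. gradient_noise J gh w k i \<omega>' \<bullet> b) \<omega> = 0) \<and>
        (AE \<omega> in M.
           nn_cond_exp M (history M w (i - 1)) (\<lambda>\<omega>'. ennreal ((norm (gradient_noise J gh w k i \<omega>'))\<^sup>2)) \<omega>
             \<le> ennreal (\<beta>\<^sup>2 * (norm (w k (i - 1) \<omega>))\<^sup>2 + \<sigma>\<^sup>2)))"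

end

theory Submission
  imports Defs
begin

text \<open>The gradient of a smoothed regularizer is the unique maximizer in its definition. Hence it is
  monotone and \<open>1 / \<delta>\<close>-Lipschitz, and, by comparing the smoothed function with \<open>R\<close> and with the
  value at \<open>u = 0\<close>, bounded on bounded sets uniformly in \<open>\<delta>\<close>; so the minimizers and the individual
  gradients there stay bounded as \<open>\<delta> \<rightarrow> 0\<close>.

  Put \<open>\<eta> = 1 / \<delta>\<close> and \<open>\<nu> = \<mu> \<eta>\<^sup>2 = \<mu> powr (2 \<kappa>)\<close>. Let \<open>X\<close> be the mean-square error of the Perron
  average of the iterates and \<open>Y\<close> the expectation of a quadratic Lyapunov function of their
  deviations from that average. The average performs a gradient step perturbed by the disagreement and
  by the effect of the noise inside the smoothed gradient, while mixing contracts the deviations, so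
  that, with \<open>\<rho> < 1\<close>,
  \<open>X' \<le> (1 - \<mu> \<lambda> / 2) X + c \<mu>\<^sup>2 (1 + X + Y) + c \<nu> Y\<close> and \<open>Y' \<le> \<rho> Y + c \<mu>\<^sup>2 + c \<mu> \<nu> (X + Y)\<close>.
  As \<open>\<nu> \<rightarrow> 0\<close> with \<open>\<mu>\<close>, this gives \<open>X' + Y' \<le> (1 - \<mu> \<lambda> / 4) (X + Y) + 2 c \<mu>\<^sup>2\<close>, hence a limit
  superior of order \<open>\<mu>\<close>.\<close>

section \<open>Smoothing by conjugation\<close>

text \<open>Two obstacles shape the estimates. The Lipschitz constant \<open>1 / \<delta>\<close> of
  the smoothed gradients is unbounded as the step-size decreases, and the gradient noise passes
  through these gradients, which destroys its zero conditional mean there. The noise is therefore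
  split: its outer copy enters additively and drops out in expectation, while its inner copy counts
  as an error of size \<open>\<mu> * \<eta>\<close> times the noise. Averaging costs this error a
  factor of order \<open>\<mu> / lam\<close> on its square, so it contributes order
  \<open>\<mu>\<^sup>2 * \<nu>\<close>, within the budget \<open>\<mu>\<^sup>2\<close>. The plain
  sum \<open>X + Y\<close> works because the two couplings fit different gaps: \<open>Y\<close>
  enters \<open>X\<close> with \<open>\<nu>\<close>, without a factor \<open>\<mu>\<close>, and is
  absorbed by the fixed gap \<open>1 - \<rho>\<close>; \<open>X\<close> enters \<open>Y\<close> with
  \<open>\<mu> * \<nu>\<close> and is absorbed by the gap of order \<open>\<mu> * lam\<close>. Here
  \<open>lam\<close> comes from the costs alone, so it is free of \<open>\<delta>\<close>. At the
  minimizer only the weighted sum of the gradients vanishes. The agents' own gradients there drive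
  the disagreement, which is why they need bounds uniform in \<open>\<delta>\<close>.\<close>

lemma conjugate_upper:
  assumes "u \<in> eff_dom (conjugate R)"
  shows "u \<bullet> v - R v \<le> real_of_ereal (conjugate R u)"
proof -
  have "ereal (u \<bullet> v - R v) \<le> conjugate R u"
    unfolding conjugate_def by (rule SUP_upper) simp
  moreover have "conjugate R u = ereal (real_of_ereal (conjugate R u))"
    using assms by (simp add: eff_dom_def ereal_real)
  ultimately show ?thesis by (metis ereal_less_eq(3))
qed

text \<open>The value at \<open>v = 0\<close> keeps the supremum away from minus infinity, so one
  real upper bound already puts \<open>u\<close> into the domain. Questions about the domain thereby
  become inequalities for each fixed \<open>v\<close>.\<close>

lemma conjugate_least:
  assumes "\<And>v. u \<bullet> v - R v \<le> a"
  shows "u \<in> eff_dom (conjugate R)" "real_of_ereal (conjugate R u) \<le> a"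
proof -
  have 1: "conjugate R u \<le> ereal a"
    unfolding conjugate_def by (rule SUP_least) (use assms in simp)
  have "ereal (u \<bullet> 0 - R 0) \<le> conjugate R u"
    unfolding conjugate_def by (rule SUP_upper) simp
  then have 2: "conjugate R u \<noteq> -\<infinity>" by auto
  have 3: "conjugate R u \<noteq> \<infinity>" using 1 by auto
  show "u \<in> eff_dom (conjugate R)" using 2 3 by (auto simp: eff_dom_def)
  show "real_of_ereal (conjugate R u) \<le> a"
    using 1 2 3 by (cases "conjugate R u") auto
qed

text \<open>The maximum defining the Legendre transform of a strongly convex function is attained because
  a maximizing sequence is Cauchy.\<close>

lemma strongly_convex_legendre_attained:
  fixes h :: "'a::{real_inner,complete_space} \<Rightarrow> real"
  assumes sc: "strongly_convex_on \<delta> C h" and "\<delta> > 0" and ne: "C \<noteq> {}"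
    and bdd: "bdd_above ((\<lambda>u. w \<bullet> u - h u) ` C)"
    and lsc: "\<And>u l a. \<lbrakk>\<And>n::nat. u n \<in> C; u \<longlonglongrightarrow> l; (\<lambda>n. h (u n)) \<longlonglongrightarrow> a\<rbrakk> \<Longrightarrow> l \<in> C \<and> h l \<le> a"
  obtains U where "U \<in> C"
    "\<And>v. v \<in> C \<Longrightarrow> w \<bullet> v - h v \<le> w \<bullet> U - h U - \<delta> / 2 * (norm (v - U))\<^sup>2"
proof -
  define f where "f u = w \<bullet> u - h u" for u
  define S where "S = (SUP u\<in>C. f u)"
  have le_S: "f u \<le> S" if "u \<in> C" for u
    unfolding S_def using that bdd by (auto intro!: cSUP_upper simp: f_def[abs_def])
  have conc: "(1 - t) * f x + t * f y + \<delta> / 2 * t * (1 - t) * (norm (x - y))\<^sup>2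
      \<le> f ((1 - t) *\<^sub>R x + t *\<^sub>R y)" "(1 - t) *\<^sub>R x + t *\<^sub>R y \<in> C"
    if "x \<in> C" "y \<in> C" "0 \<le> t" "t \<le> 1" for x y t
  proof -
    have "h ((1 - t) *\<^sub>R x + t *\<^sub>R y)
        \<le> (1 - t) * h x + t * h y - \<delta> / 2 * t * (1 - t) * (norm (x - y))\<^sup>2"
      using sc that unfolding strongly_convex_on_def by auto
    moreover have "w \<bullet> ((1 - t) *\<^sub>R x + t *\<^sub>R y) = (1 - t) * (w \<bullet> x) + t * (w \<bullet> y)"
      by (simp add: inner_add_right)
    ultimately show "(1 - t) * f x + t * f y + \<delta> / 2 * t * (1 - t) * (norm (x - y))\<^sup>2
        \<le> f ((1 - t) *\<^sub>R x + t *\<^sub>R y)"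
      unfolding f_def by (simp add: right_diff_distrib)
    show "(1 - t) *\<^sub>R x + t *\<^sub>R y \<in> C"
      using sc that unfolding strongly_convex_on_def convex_alt by auto
  qed
  have "\<exists>u\<in>C. S - 1 / (real n + 1) < f u" for n
  proof -
    have "S - 1 / (real n + 1) < S" by simp
    then show ?thesis
      using less_cSUP_iff[of C f "S - 1 / (real n + 1)"] ne bdd
      by (simp add: f_def[abs_def] S_def)
  qed
  then obtain u where u: "\<And>n. u n \<in> C" "\<And>n. S - 1 / (real n + 1) < f (u n)"
    by metis
  \<comment> \<open>Midpoint argument: both values are within \<open>1 / (real N + 1)\<close> of
    \<open>S\<close>, and the value at the midpoint, itself at most \<open>S\<close>, exceeds their
    mean by \<open>\<delta> / 8\<close> times the squared distance.\<close>
  have close: "(norm (u m - u n))\<^sup>2 \<le> 8 / \<delta> * (1 / (real N + 1))" if "N \<le> m" "N \<le> n" for m n N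
  proof -
    have aux: "q \<le> c" if "(x + y) / 2 + q \<le> s" "a \<le> c" "b \<le> c" "s - a < x" "s - b < y"
      for a b c q s x y :: real using that by argo
    have "(1 - 1/2) * f (u m) + 1/2 * f (u n) + \<delta> / 2 * (1/2) * (1 - 1/2) * (norm (u m - u n))\<^sup>2
        \<le> f ((1 - 1/2) *\<^sub>R u m + (1/2) *\<^sub>R u n)"
      by (rule conc(1)) (simp_all add: u)
    also have "\<dots> \<le> S"
      by (intro le_S conc(2)) (auto simp: u)
    finally have "(f (u m) + f (u n)) / 2 + \<delta> / 8 * (norm (u m - u n))\<^sup>2 \<le> S"
      by (simp add: field_simps)
    moreover have "1 / (real m + 1) \<le> 1 / (real N + 1)" "1 / (real n + 1) \<le> 1 / (real N + 1)"
      using that by (simp_all add: frac_le)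
    ultimately have "\<delta> / 8 * (norm (u m - u n))\<^sup>2 \<le> 1 / (real N + 1)"
      using u(2)[of m] u(2)[of n] by (rule aux)
    then have "8 / \<delta> * (\<delta> / 8 * (norm (u m - u n))\<^sup>2) \<le> 8 / \<delta> * (1 / (real N + 1))"
      using \<open>\<delta> > 0\<close> by (intro mult_left_mono) auto
    then show ?thesis using \<open>\<delta> > 0\<close> by simp
  qed
  have inv0: "(\<lambda>N. 1 / (real N + 1)) \<longlonglongrightarrow> 0"
    using LIMSEQ_inverse_real_of_nat by (simp add: inverse_eq_divide add.commute)
  have "Cauchy u"
  proof (rule CauchyI)
    fix e :: real assume "e > 0"
    have "(\<lambda>N. 8 / \<delta> * (1 / (real N + 1))) \<longlonglongrightarrow> 8 / \<delta> * 0"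
      by (intro tendsto_intros inv0)
    then have "eventually (\<lambda>N. 8 / \<delta> * (1 / (real N + 1)) < e\<^sup>2) sequentially"
      using \<open>e > 0\<close> by (intro order_tendstoD) auto
    then obtain N where N: "8 / \<delta> * (1 / (real N + 1)) < e\<^sup>2"
      by (auto simp: eventually_sequentially)
    have "norm (u m - u n) < e" if "N \<le> m" "N \<le> n" for m n
    proof (rule power2_less_imp_less)
      show "(norm (u m - u n))\<^sup>2 < e\<^sup>2" using close[OF that] N by (rule le_less_trans)
    qed (use \<open>e > 0\<close> in simp)
    then show "\<exists>N. \<forall>m\<ge>N. \<forall>n\<ge>N. norm (u m - u n) < e" by blast
  qed
  then obtain l where l: "u \<longlonglongrightarrow> l"
    by (auto simp: Cauchy_convergent_iff convergent_def)
  have "(\<lambda>n. S - 1 / (real n + 1)) \<longlonglongrightarrow> S - 0"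
    by (intro tendsto_intros inv0)
  then have lim: "(\<lambda>n. S - 1 / (real n + 1)) \<longlonglongrightarrow> S" by simp
  have "(\<lambda>n. f (u n)) \<longlonglongrightarrow> S"
  proof (rule tendsto_sandwich[OF _ _ lim tendsto_const])
    show "\<forall>\<^sub>F n in sequentially. S - 1 / (real n + 1) \<le> f (u n)"
      using u(2) by (intro always_eventually allI less_imp_le)
    show "\<forall>\<^sub>F n in sequentially. f (u n) \<le> S"
      by (intro always_eventually allI le_S u(1))
  qed
  then have "(\<lambda>n. w \<bullet> u n - f (u n)) \<longlonglongrightarrow> w \<bullet> l - S"
    by (intro tendsto_intros l)
  then have "(\<lambda>n. h (u n)) \<longlonglongrightarrow> w \<bullet> l - S"
    by (simp add: f_def)
  from lsc[OF u(1) l this] have lC: "l \<in> C" and "f l \<ge> S"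
    by (auto simp: f_def)
  then have fl: "f v \<le> f l" if "v \<in> C" for v
    using le_S[OF that] by linarith
  \<comment> \<open>Strong concavity on the segment from \<open>l\<close> to \<open>v\<close>,
    compared with the maximality of \<open>l\<close> and divided by \<open>t\<close>, gives this
    bound with an extra factor \<open>1 - t\<close>; letting \<open>t\<close> tend to
    \<open>0\<close> removes it.\<close>
  have "f v \<le> f l - \<delta> / 2 * (norm (v - l))\<^sup>2" if "v \<in> C" for v
  proof (rule tendsto_lowerbound[where F = "at_right (0::real)"])
    have "((\<lambda>t. f l - \<delta> / 2 * (1 - t) * (norm (v - l))\<^sup>2)
        \<longlongrightarrow> f l - \<delta> / 2 * (1 - 0) * (norm (v - l))\<^sup>2) (at_right 0)"
      by (intro tendsto_intros)
    then show "((\<lambda>t. f l - \<delta> / 2 * (1 - t) * (norm (v - l))\<^sup>2)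
        \<longlongrightarrow> f l - \<delta> / 2 * (norm (v - l))\<^sup>2) (at_right 0)" by simp
    have "f v \<le> f l - \<delta> / 2 * (1 - t) * (norm (v - l))\<^sup>2" if t: "0 < t" "t < 1" for t
    proof -
      have "(1 - t) * f l + t * f v + \<delta> / 2 * t * (1 - t) * (norm (l - v))\<^sup>2 \<le> f l"
        by (rule order_trans[OF conc(1) fl[OF conc(2)]]) (use lC \<open>v \<in> C\<close> t in auto)
      then have "t * (f v + \<delta> / 2 * (1 - t) * (norm (v - l))\<^sup>2) \<le> t * f l"
        by (simp add: algebra_simps norm_minus_commute)
      then have "f v + \<delta> / 2 * (1 - t) * (norm (v - l))\<^sup>2 \<le> f l"
        using t by (simp only: mult_le_cancel_left_pos)
      then show ?thesis by simp
    qed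
    then show "\<forall>\<^sub>F t in at_right 0. f v \<le> f l - \<delta> / 2 * (1 - t) * (norm (v - l))\<^sup>2"
      unfolding eventually_at_right_field by (intro exI[of _ 1]) simp
  qed simp
  with lC that[of l] show thesis by (auto simp: f_def)
qed

lemma GDERIV_grad_eq:
  fixes f :: "'a::real_inner \<Rightarrow> real"
  assumes "GDERIV f x :> g"
  shows "grad f x = g"
  unfolding grad_def
proof (rule the_equality)
  show "GDERIV f x :> g" by (rule assms)
  fix g' assume "GDERIV f x :> g'"
  then have "(\<lambda>h. h \<bullet> g') = (\<lambda>h. h \<bullet> g)"
    using assms has_derivative_unique unfolding gderiv_def by blast
  then have "(g' - g) \<bullet> g' = (g' - g) \<bullet> g" by metis
  then have "(g' - g) \<bullet> (g' - g) = 0" by (simp add: inner_diff_right)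
  then show "g' = g" by simp
qed

lemma GDERIV_grad:
  fixes f :: "'a::euclidean_space \<Rightarrow> real"
  assumes "f differentiable (at x)"
  shows "GDERIV f x :> grad f x"
proof -
  from assms obtain f' where f': "FDERIV f x :> f'"
    unfolding differentiable_def by blast
  then interpret bounded_linear f' by (rule has_derivative_bounded_linear)
  have "f' = (\<lambda>h. h \<bullet> (\<Sum>b\<in>Basis. f' b *\<^sub>R b))"
  proof
    fix h
    have "f' h = f' (\<Sum>b\<in>Basis. (h \<bullet> b) *\<^sub>R b)" by (simp add: euclidean_representation)
    also have "\<dots> = (\<Sum>b\<in>Basis. (h \<bullet> b) * f' b)" by (simp add: sum scale)
    finally show "f' h = h \<bullet> (\<Sum>b\<in>Basis. f' b *\<^sub>R b)"
      by (simp add: inner_sum_right mult.commute)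
  qed
  with f' have "GDERIV f x :> (\<Sum>b\<in>Basis. f' b *\<^sub>R b)"
    unfolding gderiv_def by simp
  then show ?thesis using GDERIV_grad_eq by metis
qed

lemma norm_diff_scaleR_sq:
  fixes a b :: "'a::real_inner"
  shows "(norm (a - t *\<^sub>R b))\<^sup>2 = (norm a)\<^sup>2 - 2 * t * (a \<bullet> b) + t\<^sup>2 * (norm b)\<^sup>2"
  unfolding power2_norm_eq_inner
  by (simp add: inner_diff_left inner_diff_right inner_commute power2_eq_square algebra_simps)

text \<open>Young's inequality by completing a square. It yields the quadratic upper bound for the
  Legendre transform, the boundedness of the maximized expression, and the weighted bound
  \<open>norm_add_sq_le\<close>.\<close>

lemma inner_minus_square_le:
  fixes a b :: "'a::real_inner" and \<delta> :: real
  assumes "\<delta> > 0"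
  shows "b \<bullet> a - \<delta> / 2 * (norm a)\<^sup>2 \<le> (norm b)\<^sup>2 / (2 * \<delta>)"
proof -
  have "0 \<le> (norm (b - \<delta> *\<^sub>R a))\<^sup>2" by simp
  also have "\<dots> = (norm b)\<^sup>2 - 2 * \<delta> * (b \<bullet> a) + \<delta>\<^sup>2 * (norm a)\<^sup>2"
    by (rule norm_diff_scaleR_sq)
  finally show ?thesis using assms by (simp add: field_simps power2_eq_square)
qed

text \<open>Envelope argument: comparing the maximizers at two points encloses the increment of the
  transform between a linear term and that term plus a quadratic one, which is differentiability.
  Adding the two growth inequalities at \<open>w\<close> and \<open>w'\<close> gives the
  cocoercivity.\<close>

lemma legendre_GDERIV:
  fixes h :: "'a::real_inner \<Rightarrow> real"
  assumes "\<delta> > 0" and UC: "\<And>w. U w \<in> C"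
    and U: "\<And>w v. v \<in> C \<Longrightarrow> w \<bullet> v - h v \<le> w \<bullet> U w - h (U w) - \<delta> / 2 * (norm (v - U w))\<^sup>2"
  shows "GDERIV (\<lambda>w. SUP u\<in>C. w \<bullet> u - h u) w :> U w" (is "GDERIV ?S w :> _")
    and "\<delta> * (norm (U w - U w'))\<^sup>2 \<le> (w - w') \<bullet> (U w - U w')"
proof -
  have U0: "w \<bullet> v - h v \<le> w \<bullet> U w - h (U w)" if "v \<in> C" for v w
  proof -
    have "0 \<le> \<delta> / 2 * (norm (v - U w))\<^sup>2" using \<open>\<delta> > 0\<close> by simp
    then show ?thesis using U[OF that, of w] by linarith
  qed
  have S: "?S w = w \<bullet> U w - h (U w)" for w
  proof (rule cSup_eq_maximum)
    show "w \<bullet> U w - h (U w) \<in> (\<lambda>u. w \<bullet> u - h u) ` C" using UC by blast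
    fix y assume "y \<in> (\<lambda>u. w \<bullet> u - h u) ` C"
    then obtain v where "v \<in> C" "y = w \<bullet> v - h v" by blast
    then show "y \<le> w \<bullet> U w - h (U w)"
      using U0[of v w] by simp
  qed
  show "\<delta> * (norm (U w - U w'))\<^sup>2 \<le> (w - w') \<bullet> (U w - U w')"
    using U[OF UC, of w w'] U[OF UC, of w' w]
    by (simp add: inner_diff_left inner_diff_right norm_minus_commute)
  have lower: "(w' - w) \<bullet> U w \<le> ?S w' - ?S w" for w'
    unfolding S using U0[OF UC, of w' w] by (simp add: inner_diff_left)
  \<comment> \<open>Replacing \<open>U w'\<close> by \<open>U w\<close> in the linear term costs the
    cross term \<open>?b \<bullet> ?a\<close>; the quadratic growth at the maximizer
    \<open>U w\<close> pays for it.\<close>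
  have upper: "?S w' - ?S w \<le> (w' - w) \<bullet> U w + (norm (w' - w))\<^sup>2 / (2 * \<delta>)" for w'
  proof -
    let ?a = "U w' - U w" and ?b = "w' - w"
    have "?b \<bullet> ?a - \<delta> / 2 * (norm ?a)\<^sup>2 \<le> (norm ?b)\<^sup>2 / (2 * \<delta>)"
      by (rule inner_minus_square_le[OF \<open>\<delta> > 0\<close>])
    then show ?thesis unfolding S using U[OF UC, of w w']
      by (simp add: inner_diff_left inner_diff_right)
  qed
  show "GDERIV ?S w :> U w"
    unfolding gderiv_def has_derivative_at_within
  proof (intro conjI)
    show "bounded_linear (\<lambda>h. h \<bullet> U w)" by (rule bounded_linear_inner_left)
    have "((\<lambda>y. norm (y - w) / (2 * \<delta>)) \<longlongrightarrow> norm (w - w) / (2 * \<delta>)) (at w)"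
      by (intro tendsto_intros) (use \<open>\<delta> > 0\<close> in auto)
    then have lim: "((\<lambda>y. norm (y - w) / (2 * \<delta>)) \<longlongrightarrow> 0) (at w)" by simp
    show "((\<lambda>y. (?S y - ?S w - (y - w) \<bullet> U w) /\<^sub>R norm (y - w)) \<longlongrightarrow> 0) (at w)"
    proof (rule tendsto_sandwich[OF _ _ tendsto_const lim])
      show "\<forall>\<^sub>F y in at w. 0 \<le> (?S y - ?S w - (y - w) \<bullet> U w) /\<^sub>R norm (y - w)"
        using lower by (auto intro!: always_eventually)
      have "(?S y - ?S w - (y - w) \<bullet> U w) /\<^sub>R norm (y - w) \<le> norm (y - w) / (2 * \<delta>)"
        if "y \<noteq> w" for y
      proof -
        have "(?S y - ?S w - (y - w) \<bullet> U w) /\<^sub>R norm (y - w)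
            \<le> ((norm (y - w))\<^sup>2 / (2 * \<delta>)) /\<^sub>R norm (y - w)"
          using upper[of y] by (intro scaleR_left_mono) auto
        then show ?thesis using that by (simp add: power2_eq_square field_simps)
      qed
      then show "\<forall>\<^sub>F y in at w. (?S y - ?S w - (y - w) \<bullet> U w) /\<^sub>R norm (y - w)
          \<le> norm (y - w) / (2 * \<delta>)"
        by (auto simp: eventually_at_filter intro!: always_eventually)
    qed
  qed
qed

lemma proximity_functionD:
  assumes "proximity_function C d"
  shows "0 \<in> C" "real_of_ereal (d 0) = 0"
    and "\<And>u. u \<in> C \<Longrightarrow> (norm u)\<^sup>2 / 2 \<le> real_of_ereal (d u)"
    and "\<And>u l. \<lbrakk>\<And>n::nat. u n \<in> C; u \<longlonglongrightarrow> l; l \<in> C\<rbrakk>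
      \<Longrightarrow> (\<lambda>n. real_of_ereal (d (u n))) \<longlonglongrightarrow> real_of_ereal (d l)"
    and "\<And>x y t. \<lbrakk>x \<in> C; y \<in> C; 0 \<le> t; t \<le> 1\<rbrakk> \<Longrightarrow>
      real_of_ereal (d ((1 - t) *\<^sub>R x + t *\<^sub>R y))
        \<le> (1 - t) * real_of_ereal (d x) + t * real_of_ereal (d y) - 1 / 2 * t * (1 - t) * (norm (x - y))\<^sup>2"
proof -
  note a = assms[unfolded proximity_function_def]
  have cont: "continuous_on (eff_dom d) d"
    and sc: "strongly_convex_on 1 (eff_dom d) (\<lambda>w. real_of_ereal (d w))"
    and sub: "C \<subseteq> eff_dom d"
    and am: "{w. is_arg_min d (\<lambda>u. u \<in> C) w} = {0}"
    and d0: "d 0 = 0"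
    and ge: "\<forall>w\<in>C. d w \<ge> ereal ((norm w)\<^sup>2 / 2)"
    using a by - (elim conjE, assumption)+
  have "0 \<in> {w. is_arg_min d (\<lambda>u. u \<in> C) w}" unfolding am by (rule singletonI)
  then show "0 \<in> C" unfolding mem_Collect_eq is_arg_min_def by (rule conjunct1)
  from d0 show "real_of_ereal (d 0) = 0" by simp
  have fin: "\<bar>d u\<bar> \<noteq> \<infinity>" if "u \<in> C" for u using sub that by (auto simp: eff_dom_def)
  show "(norm u)\<^sup>2 / 2 \<le> real_of_ereal (d u)" if "u \<in> C" for u
    using ge[rule_format, OF that] fin[OF that] by (cases "d u") auto
  show "(\<lambda>n. real_of_ereal (d (u n))) \<longlonglongrightarrow> real_of_ereal (d l)"
    if "\<And>n::nat. u n \<in> C" "u \<longlonglongrightarrow> l" "l \<in> C" for u l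
  proof (rule lim_real_of_ereal)
    have "(\<lambda>n. d (u n)) \<longlonglongrightarrow> d l"
    proof (rule continuous_on_tendsto_compose[OF cont that(2)])
      show "l \<in> eff_dom d" by (rule subsetD[OF sub that(3)])
      show "\<forall>\<^sub>F n in sequentially. u n \<in> eff_dom d"
        by (intro always_eventually allI subsetD[OF sub] that(1))
    qed
    then show "(\<lambda>n. d (u n)) \<longlonglongrightarrow> ereal (real_of_ereal (d l))"
      using fin[OF that(3)] by (simp add: ereal_real)
  qed
  show "real_of_ereal (d ((1 - t) *\<^sub>R x + t *\<^sub>R y))
        \<le> (1 - t) * real_of_ereal (d x) + t * real_of_ereal (d y) - 1 / 2 * t * (1 - t) * (norm (x - y))\<^sup>2"
    if "x \<in> C" "y \<in> C" "0 \<le> t" "t \<le> 1" for x y t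
  proof -
    have "x \<in> eff_dom d" "y \<in> eff_dom d" "t \<in> {0..1}" using sub that by auto
    then show ?thesis by (intro sc[unfolded strongly_convex_on_def, THEN conjunct2, rule_format])
  qed
qed

text \<open>The conjugate is convex as a supremum of affine functions, so \<open>h \<delta>\<close>
  inherits strong convexity from \<open>\<delta>\<close> times \<open>d\<close>. Boundedness follows
  from the quadratic lower bound on \<open>d\<close> together with the lower bound
  \<open>- R 0\<close> on the conjugate.\<close>

lemma smoothed_maximizer:
  fixes R :: "'a::{real_inner,complete_space} \<Rightarrow> real" and d :: "'a \<Rightarrow> ereal"
  defines "C \<equiv> eff_dom (conjugate R)"
  defines "h \<equiv> \<lambda>\<delta> u. real_of_ereal (conjugate R u) + \<delta> * real_of_ereal (d u)"
  assumes prox: "proximity_function C d" and "\<delta> > 0"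
  obtains U where "\<And>w. U w \<in> C"
    "\<And>w v. v \<in> C \<Longrightarrow> w \<bullet> v - h \<delta> v \<le> w \<bullet> U w - h \<delta> (U w) - \<delta> / 2 * (norm (v - U w))\<^sup>2"
proof -
  define g where "g u = real_of_ereal (conjugate R u)" for u
  have g_upper: "u \<bullet> v - R v \<le> g u" if "u \<in> C" for u v
    using conjugate_upper that by (auto simp: C_def g_def)
  have g_least: "u \<in> C" "g u \<le> a" if "\<And>v. u \<bullet> v - R v \<le> a" for u a
    using conjugate_least[of u R a] that by (auto simp: C_def g_def)
  note d = proximity_functionD[OF prox]
  have conv: "(1 - t) *\<^sub>R x + t *\<^sub>R y \<in> C \<and> g ((1 - t) *\<^sub>R x + t *\<^sub>R y) \<le> (1 - t) * g x + t * g y"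
    if "x \<in> C" "y \<in> C" "0 \<le> t" "t \<le> 1" for x y t
  proof -
    have "((1 - t) *\<^sub>R x + t *\<^sub>R y) \<bullet> v - R v \<le> (1 - t) * g x + t * g y" for v
    proof -
      have "((1 - t) *\<^sub>R x + t *\<^sub>R y) \<bullet> v - R v = (1 - t) * (x \<bullet> v - R v) + t * (y \<bullet> v - R v)"
        by (simp add: inner_add_left algebra_simps)
      also have "\<dots> \<le> (1 - t) * g x + t * g y"
        using that g_upper by (intro add_mono mult_left_mono) auto
      finally show ?thesis .
    qed
    then show ?thesis using g_least by blast
  qed
  have sc: "strongly_convex_on \<delta> C (h \<delta>)"
    unfolding strongly_convex_on_def
  proof (intro conjI ballI)
    show "convex C" unfolding convex_alt using conv by auto
    fix x y and t :: real assume a: "x \<in> C" "y \<in> C" "t \<in> {0..1}"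
    let ?z = "(1 - t) *\<^sub>R x + t *\<^sub>R y"
    have "g ?z \<le> (1 - t) * g x + t * g y" using conv a by auto
    moreover have "\<delta> * real_of_ereal (d ?z) \<le> \<delta> * ((1 - t) * real_of_ereal (d x) + t * real_of_ereal (d y) - 1 / 2 * t * (1 - t) * (norm (x - y))\<^sup>2)"
      using d(5)[of x y t] a \<open>\<delta> > 0\<close> by (intro mult_left_mono) auto
    ultimately show "h \<delta> ?z \<le> (1 - t) * h \<delta> x + t * h \<delta> y - \<delta> / 2 * t * (1 - t) * (norm (x - y))\<^sup>2"
      unfolding h_def g_def by (simp add: algebra_simps)
  qed
  have bdd: "bdd_above ((\<lambda>u. w \<bullet> u - h \<delta> u) ` C)" for w
  proof (rule bdd_aboveI2)
    fix u assume u: "u \<in> C"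
    have "\<delta> * ((norm u)\<^sup>2 / 2) \<le> \<delta> * real_of_ereal (d u)"
      using d(3)[OF u] \<open>\<delta> > 0\<close> by (intro mult_left_mono) auto
    moreover have "- R 0 \<le> g u" using g_upper[OF u, of 0] by simp
    moreover have "w \<bullet> u - \<delta> / 2 * (norm u)\<^sup>2 \<le> (norm w)\<^sup>2 / (2 * \<delta>)"
      by (rule inner_minus_square_le[OF \<open>\<delta> > 0\<close>])
    ultimately show "w \<bullet> u - h \<delta> u \<le> (norm w)\<^sup>2 / (2 * \<delta>) + R 0"
      unfolding h_def g_def by linarith
  qed
  have lsc: "l \<in> C \<and> h \<delta> l \<le> a"
    if u: "\<And>n::nat. u n \<in> C" and l: "u \<longlonglongrightarrow> l" and a: "(\<lambda>n. h \<delta> (u n)) \<longlonglongrightarrow> a" for u l a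
  proof -
    \<comment> \<open>Two passes are needed, since continuity of \<open>d\<close> at
      \<open>l\<close> is available only for \<open>l \<in> C\<close>. This first pass discards the
      nonnegative \<open>d\<close> term and yields \<open>l \<in> C\<close>; the second subtracts
      the limit of that term and yields the sharp bound.\<close>
    have "l \<bullet> v - R v \<le> a" for v
    proof (rule LIMSEQ_le[OF _ a])
      show "(\<lambda>n. u n \<bullet> v - R v) \<longlonglongrightarrow> l \<bullet> v - R v" by (intro tendsto_intros l)
      have "u n \<bullet> v - R v \<le> h \<delta> (u n)" for n
      proof -
        have "0 \<le> \<delta> * real_of_ereal (d (u n))"
          using d(3)[OF u[of n]] \<open>\<delta> > 0\<close>
          by (intro mult_nonneg_nonneg order_trans[OF _ d(3)[OF u[of n]]]) auto
        then show ?thesis using g_upper[OF u, of n v] unfolding h_def g_def by linarith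
      qed
      then show "\<exists>N. \<forall>n\<ge>N. u n \<bullet> v - R v \<le> h \<delta> (u n)" by blast
    qed
    then have lC: "l \<in> C" by (rule g_least)
    have "(\<lambda>n. h \<delta> (u n) - \<delta> * real_of_ereal (d (u n))) \<longlonglongrightarrow> a - \<delta> * real_of_ereal (d l)"
      by (intro tendsto_intros a d(4) u l lC)
    then have g: "(\<lambda>n. g (u n)) \<longlonglongrightarrow> a - \<delta> * real_of_ereal (d l)"
      by (simp add: h_def g_def)
    have "l \<bullet> v - R v \<le> a - \<delta> * real_of_ereal (d l)" for v
    proof (rule LIMSEQ_le[OF _ g])
      show "(\<lambda>n. u n \<bullet> v - R v) \<longlonglongrightarrow> l \<bullet> v - R v" by (intro tendsto_intros l)
    qed (use g_upper[OF u] in blast)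
    from g_least(2)[OF this] lC show ?thesis by (simp add: h_def g_def)
  qed
  have "C \<noteq> {}" using d(1) by blast
  have "\<exists>U. U \<in> C \<and> (\<forall>v\<in>C. w \<bullet> v - h \<delta> v \<le> w \<bullet> U - h \<delta> U - \<delta> / 2 * (norm (v - U))\<^sup>2)" for w
    by (rule strongly_convex_legendre_attained[where w = w, OF sc \<open>\<delta> > 0\<close> \<open>C \<noteq> {}\<close> bdd lsc]) auto
  then obtain U where "\<forall>w. U w \<in> C \<and> (\<forall>v\<in>C. w \<bullet> v - h \<delta> v \<le> w \<bullet> U w - h \<delta> (U w) - \<delta> / 2 * (norm (v - U w))\<^sup>2)"
    using choice[of "\<lambda>w U. U \<in> C \<and> (\<forall>v\<in>C. w \<bullet> v - h \<delta> v \<le> w \<bullet> U - h \<delta> U - \<delta> / 2 * (norm (v - U))\<^sup>2)"]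
    by blast
  then show thesis by (intro that) blast+
qed

lemma smoothed_gradient:
  fixes R :: "'a::{real_inner,complete_space} \<Rightarrow> real" and d :: "'a \<Rightarrow> ereal"
  assumes prox: "proximity_function (eff_dom (conjugate R)) d" and "\<delta> > 0"
  shows "GDERIV (smoothed d \<delta> R) x :> grad (smoothed d \<delta> R) x" (is ?gderiv)
    and "\<delta> * (norm (grad (smoothed d \<delta> R) x - grad (smoothed d \<delta> R) y))\<^sup>2
      \<le> (x - y) \<bullet> (grad (smoothed d \<delta> R) x - grad (smoothed d \<delta> R) y)" (is ?mono)
    and "\<And>K. (\<And>v. norm v \<le> norm x + 1 \<Longrightarrow> R v \<le> K) \<Longrightarrow>
      norm (grad (smoothed d \<delta> R) x) \<le> K + real_of_ereal (conjugate R 0)"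
proof -
  define C where "C = eff_dom (conjugate R)"
  define h where "h u = real_of_ereal (conjugate R u) + \<delta> * real_of_ereal (d u)" for u
  from smoothed_maximizer[OF assms, folded C_def h_def] obtain U
    where UC: "\<And>w. U w \<in> C"
    and U: "\<And>w v. v \<in> C \<Longrightarrow> w \<bullet> v - h v \<le> w \<bullet> U w - h (U w) - \<delta> / 2 * (norm (v - U w))\<^sup>2"
    by blast
  have eq: "smoothed d \<delta> R = (\<lambda>w. SUP u\<in>C. w \<bullet> u - h u)"
    by (simp add: fun_eq_iff smoothed_def C_def h_def diff_diff_eq)
  note L = legendre_GDERIV[of \<delta> U C h, OF \<open>\<delta> > 0\<close> UC U, folded eq]
  have grad: "grad (smoothed d \<delta> R) w = U w" for w
    by (rule GDERIV_grad_eq) (rule L(1))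
  show ?gderiv unfolding grad by (rule L(1))
  show ?mono unfolding grad by (rule L(2))
  show "norm (grad (smoothed d \<delta> R) x) \<le> K + real_of_ereal (conjugate R 0)"
    if K: "\<And>v. norm v \<le> norm x + 1 \<Longrightarrow> R v \<le> K" for K
  proof -
    note d = proximity_functionD[OF prox, folded C_def]
    have nonneg: "real_of_ereal (d u) \<ge> 0" if "u \<in> C" for u
      by (rule order_trans[OF _ d(3)[OF that]]) simp
    let ?e = "sgn (U x)"
    have "norm (U x) = U x \<bullet> ?e"
      by (cases "U x = 0") (auto simp: sgn_div_norm power2_norm_eq_inner[symmetric] power2_eq_square)
    moreover have "x \<bullet> 0 - h 0 \<le> x \<bullet> U x - h (U x)"
    proof -
      have "0 \<le> \<delta> / 2 * (norm (0 - U x))\<^sup>2" using \<open>\<delta> > 0\<close> by simp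
      then show ?thesis using U[OF d(1), of x] by linarith
    qed
    moreover have "U x \<bullet> (x + ?e) - R (x + ?e) \<le> real_of_ereal (conjugate R (U x))"
      using conjugate_upper UC by (auto simp: C_def)
    moreover have "0 \<le> \<delta> * real_of_ereal (d (U x))"
      using \<open>\<delta> > 0\<close> nonneg[OF UC] by simp
    moreover have "norm (x + ?e) \<le> norm x + 1"
      by (rule norm_triangle_le) (auto simp: norm_sgn)
    then have "R (x + ?e) \<le> K" by (rule K)
    ultimately show ?thesis
      unfolding grad using d(2) by (simp add: h_def inner_add_right inner_commute)
  qed
qed

text \<open>A finite convex function on a Euclidean space is continuous, hence bounded above on the
  ball of radius \<open>r + 1\<close>; the resulting gradient bound contains no
  \<open>\<delta>\<close>.\<close>

lemma smoothed_gradient_bounded: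
  fixes R :: "'a::euclidean_space \<Rightarrow> real" and d :: "'a \<Rightarrow> ereal"
  assumes "convex_on UNIV R" and "proximity_function (eff_dom (conjugate R)) d"
  obtains B where "\<And>\<delta> x. \<lbrakk>\<delta> > 0; norm x \<le> r\<rbrakk> \<Longrightarrow> norm (grad (smoothed d \<delta> R) x) \<le> B"
proof -
  have "continuous_on UNIV R" by (rule convex_on_continuous) (use assms in auto)
  then have "compact (R ` cball 0 (r + 1))"
    by (intro compact_continuous_image) (auto intro: continuous_on_subset)
  then have "bdd_above (R ` cball 0 (r + 1))"
    by (intro bounded_imp_bdd_above compact_imp_bounded)
  then obtain K where K: "\<forall>v\<in>cball 0 (r + 1). R v \<le> K"
    by (auto simp: bdd_above_def)
  have "norm (grad (smoothed d \<delta> R) x) \<le> K + real_of_ereal (conjugate R 0)"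
    if "\<delta> > 0" "norm x \<le> r" for \<delta> x
    using that K by (intro smoothed_gradient(3)[OF assms(2)]) auto
  then show thesis by (rule that)
qed

section \<open>Zeros of strongly monotone gradients\<close>

text \<open>Expansion of the square, shared by the fixed-point argument for the minimizer and by the
  noise-free step of the average.\<close>

lemma gradient_step_contraction:
  fixes G :: "'a::real_inner \<Rightarrow> 'a"
  assumes mono: "\<And>x y. lam * (norm (x - y))\<^sup>2 \<le> (x - y) \<bullet> (G x - G y)"
    and lip: "\<And>x y. norm (G x - G y) \<le> L * norm (x - y)"
    and "0 \<le> t"
  shows "(norm ((x - t *\<^sub>R G x) - (y - t *\<^sub>R G y)))\<^sup>2
    \<le> (1 - 2 * t * lam + t\<^sup>2 * L\<^sup>2) * (norm (x - y))\<^sup>2"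
proof -
  have "(x - t *\<^sub>R G x) - (y - t *\<^sub>R G y) = (x - y) - t *\<^sub>R (G x - G y)"
    by (simp add: scaleR_diff_right)
  then have "(norm ((x - t *\<^sub>R G x) - (y - t *\<^sub>R G y)))\<^sup>2
      = (norm (x - y))\<^sup>2 - 2 * t * ((x - y) \<bullet> (G x - G y)) + t\<^sup>2 * (norm (G x - G y))\<^sup>2"
    by (simp only: norm_diff_scaleR_sq)
  also have "\<dots> \<le> (norm (x - y))\<^sup>2 - 2 * t * (lam * (norm (x - y))\<^sup>2) + t\<^sup>2 * (L * norm (x - y))\<^sup>2"
    using mono[of x y] lip[of x y] \<open>0 \<le> t\<close>
    by (intro add_mono diff_mono mult_left_mono power_mono) auto
  also have "\<dots> = (1 - 2 * t * lam + t\<^sup>2 * L\<^sup>2) * (norm (x - y))\<^sup>2"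
    by (simp add: power_mult_distrib algebra_simps)
  finally show ?thesis .
qed

lemma strongly_monotone_zero_exists:
  fixes G :: "'a::{real_inner,complete_space} \<Rightarrow> 'a"
  assumes mono: "\<And>x y. lam * (norm (x - y))\<^sup>2 \<le> (x - y) \<bullet> (G x - G y)" and "lam > 0"
    and lip: "\<And>x y. norm (G x - G y) \<le> L * norm (x - y)"
  shows "\<exists>x. G x = 0"
proof -
  define L' where "L' = max L lam"
  have L': "lam \<le> L'" "L' > 0" using \<open>lam > 0\<close> by (auto simp: L'_def)
  have lip': "norm (G x - G y) \<le> L' * norm (x - y)" for x y
    using lip[of x y] by (rule order_trans) (auto simp: L'_def intro!: mult_right_mono)
  \<comment> \<open>This \<open>t\<close> minimizes the factor
    \<open>1 - 2 * t * lam + t\<^sup>2 * L'\<^sup>2\<close>, with minimal value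
    \<open>1 - (lam / L')\<^sup>2\<close>. Enlarging \<open>L\<close> to \<open>L'\<close> ensures
    that this value is not negative and that \<open>t\<close> is well defined and positive.\<close>
  define t where "t = lam / L'\<^sup>2"
  have t: "t > 0" using L' \<open>lam > 0\<close> by (simp add: t_def)
  define q where "q = 1 - 2 * t * lam + t\<^sup>2 * L'\<^sup>2"
  have q: "q = 1 - (lam / L')\<^sup>2"
    using L' by (simp add: q_def t_def power2_eq_square field_simps)
  have "(lam / L')\<^sup>2 \<le> 1" using L' \<open>lam > 0\<close> by (simp add: power_le_one)
  moreover have "(lam / L')\<^sup>2 > 0" using L' \<open>lam > 0\<close> by simp
  ultimately have q01: "0 \<le> q" "q < 1" by (simp_all add: q)
  have "\<exists>!x. x - t *\<^sub>R G x = x"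
  proof (rule banach_fix_type)
    show "0 \<le> sqrt q" "sqrt q < 1" using q01 by auto
    show "\<forall>x y. dist (x - t *\<^sub>R G x) (y - t *\<^sub>R G y) \<le> sqrt q * dist x y"
    proof (intro allI)
      fix x y
      have "(norm ((x - t *\<^sub>R G x) - (y - t *\<^sub>R G y)))\<^sup>2 \<le> q * (norm (x - y))\<^sup>2"
        unfolding q_def by (rule gradient_step_contraction[OF mono lip']) (use t in simp)
      then have "sqrt ((norm ((x - t *\<^sub>R G x) - (y - t *\<^sub>R G y)))\<^sup>2) \<le> sqrt (q * (norm (x - y))\<^sup>2)"
        by (rule real_sqrt_le_mono)
      then show "dist (x - t *\<^sub>R G x) (y - t *\<^sub>R G y) \<le> sqrt q * dist x y"
        by (simp add: dist_norm real_sqrt_mult)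
    qed
  qed
  then obtain x where "x - t *\<^sub>R G x = x" by blast
  then show ?thesis using t by auto
qed

text \<open>Along every ray from the zero \<open>z\<close> strong monotonicity makes the derivative
  of \<open>F\<close> positive, so by the mean value theorem \<open>z\<close> is the strict
  minimizer, which is what the definite description in \<open>the_minimizer\<close> needs.\<close>

lemma the_minimizer_eqI:
  fixes F :: "'a::real_inner \<Rightarrow> real"
  assumes F: "\<And>x. GDERIV F x :> G x"
    and mono: "\<And>x y. lam * (norm (x - y))\<^sup>2 \<le> (x - y) \<bullet> (G x - G y)" and "lam > 0"
    and "G z = 0"
  shows "the_minimizer F = z"
proof -
  have less: "F z < F y" if "y \<noteq> z" for y
  proof -
    have "((\<lambda>t. F (z + t *\<^sub>R (y - z))) has_real_derivative (y - z) \<bullet> G (z + t *\<^sub>R (y - z))) (at t)" for t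
    proof -
      have "((\<lambda>t. z + t *\<^sub>R (y - z)) has_derivative (\<lambda>h. h *\<^sub>R (y - z))) (at t)"
        by (auto intro!: derivative_eq_intros)
      from has_derivative_compose[OF this F[unfolded gderiv_def]]
      show ?thesis unfolding has_field_derivative_def
        by (rule has_derivative_eq_rhs) (simp add: fun_eq_iff mult.commute)
    qed
    from MVT2[of 0 1 "\<lambda>t. F (z + t *\<^sub>R (y - z))", OF zero_less_one this]
    obtain s where s: "0 < s" "s < 1" and eq: "F y - F z = (y - z) \<bullet> G (z + s *\<^sub>R (y - z))"
      by auto
    have "0 < lam * (norm (s *\<^sub>R (y - z)))\<^sup>2" using s that \<open>lam > 0\<close> by simp
    also have "\<dots> \<le> (s *\<^sub>R (y - z)) \<bullet> G (z + s *\<^sub>R (y - z))"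
      using mono[of "z + s *\<^sub>R (y - z)" z] \<open>G z = 0\<close> by simp
    finally have "0 < s * ((y - z) \<bullet> G (z + s *\<^sub>R (y - z)))" by simp
    then have "0 < (y - z) \<bullet> G (z + s *\<^sub>R (y - z))" using s(1) by (rule zero_less_mult_pos)
    then show ?thesis using eq by linarith
  qed
  show ?thesis unfolding the_minimizer_def
  proof (rule the_equality)
    show "is_arg_min F (\<lambda>_. True) z"
      unfolding is_arg_min_def using less by (auto dest: less_asym)
    fix y assume "is_arg_min F (\<lambda>_. True) y"
    then show "y = z" unfolding is_arg_min_def using less by blast
  qed
qed

text \<open>Cauchy-Schwarz applied to the cocoercivity, followed by cancelling one factor.\<close>

lemma smoothed_gradient_lipschitz:
  fixes R :: "'a::{real_inner,complete_space} \<Rightarrow> real"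
  assumes "proximity_function (eff_dom (conjugate R)) d" and "\<delta> > 0"
  shows "norm (grad (smoothed d \<delta> R) x - grad (smoothed d \<delta> R) y) \<le> 1 / \<delta> * norm (x - y)"
proof -
  have cancel: "a \<le> 1 / \<delta> * b" if "\<delta> * a\<^sup>2 \<le> b * a" "0 \<le> a" "0 \<le> b" for a b :: real
  proof (cases "a = 0")
    case False
    then have "\<delta> * a * a \<le> b * a" "a > 0" using that by (simp_all add: power2_eq_square mult.assoc)
    then have "\<delta> * a \<le> b" by (simp only: mult_le_cancel_right_pos)
    then show ?thesis using \<open>\<delta> > 0\<close> by (simp add: field_simps)
  qed (use \<open>\<delta> > 0\<close> that in simp)
  show ?thesis
    using order_trans[OF smoothed_gradient(2)[OF assms, of x y] norm_cauchy_schwarz]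
    by (rule cancel) simp_all
qed

lemma GDERIV_sum:
  assumes "\<And>k. k \<in> S \<Longrightarrow> GDERIV (f k) x :> g k"
  shows "GDERIV (\<lambda>x. \<Sum>k\<in>S. c k * f k x) x :> (\<Sum>k\<in>S. c k *\<^sub>R g k)"
proof -
  have "((\<lambda>x. \<Sum>k\<in>S. c k * f k x) has_derivative (\<lambda>h. \<Sum>k\<in>S. c k * (h \<bullet> g k))) (at x)"
    by (intro has_derivative_sum has_derivative_mult_right) (use assms in \<open>auto simp: gderiv_def\<close>)
  then show ?thesis by (simp add: gderiv_def inner_sum_right)
qed

text \<open>\<open>G \<delta>\<close> is the gradient of the aggregate cost. The regularizers only
  add a monotone part, so the modulus \<open>lamL\<close> survives for every
  \<open>\<delta>\<close>. The Lipschitz constant does depend on \<open>\<delta>\<close>, but serves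
  only to obtain a zero by Banach's theorem.\<close>

lemma aggregate_minimizer:
  fixes p :: "real^'n" and J R :: "'n \<Rightarrow> 'a::euclidean_space \<Rightarrow> real"
    and d :: "'a \<Rightarrow> ereal"
  defines "G \<equiv> \<lambda>\<delta> x. \<Sum>k\<in>UNIV. p $ k *\<^sub>R (grad (J k) x + grad (smoothed d \<delta> (R k)) x)"
  assumes p: "\<And>k. p $ k > 0"
    and J: "\<And>k x. J k differentiable (at x)"
    and lip: "\<And>k x y. norm (grad (J k) x - grad (J k) y) \<le> lamU * norm (x - y)"
    and mono: "\<And>x y. (x - y) \<bullet> (\<Sum>k\<in>UNIV. p $ k *\<^sub>R (grad (J k) x - grad (J k) y)) \<ge> lamL * (norm (x - y))\<^sup>2"
    and "lamL > 0"
    and prox: "\<And>k. proximity_function (eff_dom (conjugate (R k))) d" and "\<delta> > 0"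
  shows "lamL * (norm (x - y))\<^sup>2 \<le> (x - y) \<bullet> (G \<delta> x - G \<delta> y)" (is "?mono x y")
    and "G \<delta> (the_minimizer (aggregate_cost p J R d \<delta>)) = 0" (is "G \<delta> ?z = 0")
    and "norm (the_minimizer (aggregate_cost p J R d \<delta>)) \<le> norm (G \<delta> 0) / lamL"
proof -
  let ?u = "\<lambda>k. grad (smoothed d \<delta> (R k))"
  have u_mono: "0 \<le> (x - y) \<bullet> (?u k x - ?u k y)" for x y k
    by (rule order_trans[OF _ smoothed_gradient(2)[OF prox \<open>\<delta> > 0\<close>]]) (use \<open>\<delta> > 0\<close> in simp)
  have G_diff: "G \<delta> x - G \<delta> y
      = (\<Sum>k\<in>UNIV. p $ k *\<^sub>R (grad (J k) x - grad (J k) y)) + (\<Sum>k\<in>UNIV. p $ k *\<^sub>R (?u k x - ?u k y))" for x y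
    by (simp add: G_def sum_subtractf[symmetric] sum.distrib[symmetric] algebra_simps)
  have G_mono: "?mono x y" for x y
  proof -
    have "0 \<le> (x - y) \<bullet> (\<Sum>k\<in>UNIV. p $ k *\<^sub>R (?u k x - ?u k y))"
      unfolding inner_sum_right inner_scaleR_right
      by (intro sum_nonneg mult_nonneg_nonneg u_mono less_imp_le p)
    then show ?thesis unfolding G_diff inner_add_right using mono[where x = x and y = y] by linarith
  qed
  show "?mono x y" by (rule G_mono)
  have G_lip: "norm (G \<delta> x - G \<delta> y) \<le> (\<Sum>k\<in>UNIV. p $ k * (lamU + 1 / \<delta>)) * norm (x - y)" for x y
  proof -
    have "norm (G \<delta> x - G \<delta> y) \<le> (\<Sum>k\<in>UNIV. norm (p $ k *\<^sub>R (grad (J k) x - grad (J k) y + (?u k x - ?u k y))))"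
      unfolding G_diff sum.distrib[symmetric] scaleR_add_right[symmetric] by (rule norm_sum)
    also have "\<dots> \<le> (\<Sum>k\<in>UNIV. p $ k * (lamU * norm (x - y) + 1 / \<delta> * norm (x - y)))"
    proof (rule sum_mono)
      fix k
      have "norm (grad (J k) x - grad (J k) y + (?u k x - ?u k y)) \<le> lamU * norm (x - y) + 1 / \<delta> * norm (x - y)"
        by (rule norm_triangle_mono[OF lip smoothed_gradient_lipschitz[OF prox \<open>\<delta> > 0\<close>]])
      then show "norm (p $ k *\<^sub>R (grad (J k) x - grad (J k) y + (?u k x - ?u k y)))
          \<le> p $ k * (lamU * norm (x - y) + 1 / \<delta> * norm (x - y))"
        using p[of k] by simp
    qed
    also have "\<dots> = (\<Sum>k\<in>UNIV. p $ k * (lamU + 1 / \<delta>)) * norm (x - y)"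
      unfolding sum_distrib_right by (simp add: algebra_simps)
    finally show ?thesis .
  qed
  obtain z where z: "G \<delta> z = 0"
    using strongly_monotone_zero_exists[OF G_mono \<open>lamL > 0\<close> G_lip] by blast
  have "GDERIV (aggregate_cost p J R d \<delta>) x :> G \<delta> x" for x
    unfolding aggregate_cost_def[abs_def] G_def
    by (intro GDERIV_sum GDERIV_add GDERIV_grad J smoothed_gradient(1) prox \<open>\<delta> > 0\<close>)
  then have eq: "?z = z"
    using G_mono \<open>lamL > 0\<close> z by (rule the_minimizer_eqI)
  show "G \<delta> ?z = 0" using z eq by simp
  \<comment> \<open>Testing monotonicity between \<open>z\<close> and the origin reduces the size of
    the minimizer to the gradient at the fixed point \<open>0\<close>, where bounds uniform in
    \<open>\<delta>\<close> are available.\<close>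
  have "lamL * (norm z)\<^sup>2 \<le> z \<bullet> (- G \<delta> 0)" using G_mono[of z 0] z by simp
  also have "\<dots> \<le> norm z * norm (G \<delta> 0)" using norm_cauchy_schwarz[of z "- G \<delta> 0"] by simp
  finally have "norm z * (lamL * norm z) \<le> norm z * norm (G \<delta> 0)"
    by (simp add: power2_eq_square mult_ac)
  then have "lamL * norm z \<le> norm (G \<delta> 0)"
    by (cases "z = 0") simp_all
  then show "norm ?z \<le> norm (G \<delta> 0) / lamL"
    using \<open>lamL > 0\<close> by (simp add: eq field_simps)
qed

section \<open>Mixing by a primitive matrix\<close>

definition mix :: "real^'n^'n \<Rightarrow> ('n \<Rightarrow> 'a::real_vector) \<Rightarrow> 'n \<Rightarrow> 'a" where
  "mix A f k = (\<Sum>l\<in>UNIV. A $ l $ k *\<^sub>R f l)"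

text \<open>The Perron weights make mixing nonexpansive although \<open>A\<close> need not be doubly
  stochastic: the relation \<open>A *v p = p\<close> takes the place of unit row sums.\<close>

definition wnorm2 :: "real^'n \<Rightarrow> ('n \<Rightarrow> 'a::real_normed_vector) \<Rightarrow> real" where
  "wnorm2 p f = (\<Sum>k\<in>UNIV. p $ k * (norm (f k))\<^sup>2)"

primrec matpow :: "real^'n^'n \<Rightarrow> nat \<Rightarrow> real^'n^'n" where
  "matpow A 0 = mat 1"
| "matpow A (Suc n) = A ** matpow A n"

text \<open>Mixing acts through columns, that is by the transpose, so composition reverses the
  factors. With the recursion of \<open>matpow\<close>, mixing first by \<open>A\<close> and then by
  its \<open>j\<close>-th power is mixing by \<open>matpow A (Suc j)\<close>.\<close>

lemma mix_mix: "mix B (mix A f) = mix (A ** B) f"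
proof
  fix k
  have "mix B (mix A f) k = (\<Sum>m\<in>UNIV. \<Sum>l\<in>UNIV. (A $ l $ m * B $ m $ k) *\<^sub>R f l)"
    by (simp add: mix_def scaleR_sum_right mult.commute)
  also have "\<dots> = (\<Sum>l\<in>UNIV. \<Sum>m\<in>UNIV. (A $ l $ m * B $ m $ k) *\<^sub>R f l)"
    by (rule sum.swap)
  also have "\<dots> = mix (A ** B) f k"
    by (simp add: mix_def matrix_matrix_mult_def scaleR_sum_left)
  finally show "mix B (mix A f) k = mix (A ** B) f k" .
qed

lemma mix_one: "mix (mat 1) f = f"
proof
  fix k
  have "mix (mat 1) f k = (\<Sum>l\<in>UNIV. if l = k then f l else 0)"
    unfolding mix_def by (rule sum.cong) (auto simp: mat_def)
  then show "mix (mat 1) f k = f k" by simp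
qed

lemma mix_add: "mix A (\<lambda>k. f k + g k) = (\<lambda>k. mix A f k + mix A g k)"
  by (simp add: fun_eq_iff mix_def scaleR_add_right sum.distrib)

lemma left_stochastic_mult:
  assumes "left_stochastic A" "left_stochastic B"
  shows "left_stochastic (A ** B)"
  unfolding left_stochastic_def
proof (intro conjI allI)
  fix l k
  show "(A ** B) $ l $ k \<ge> 0"
    using assms by (auto simp: matrix_matrix_mult_def left_stochastic_def intro!: sum_nonneg)
  have "(\<Sum>l\<in>UNIV. (A ** B) $ l $ k) = (\<Sum>l\<in>UNIV. \<Sum>m\<in>UNIV. A $ l $ m * B $ m $ k)"
    by (simp add: matrix_matrix_mult_def)
  also have "\<dots> = (\<Sum>m\<in>UNIV. \<Sum>l\<in>UNIV. A $ l $ m * B $ m $ k)" by (rule sum.swap)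
  also have "\<dots> = (\<Sum>m\<in>UNIV. (\<Sum>l\<in>UNIV. A $ l $ m) * B $ m $ k)" by (simp add: sum_distrib_right)
  also have "\<dots> = 1" using assms by (simp add: left_stochastic_def)
  finally show "(\<Sum>l\<in>UNIV. (A ** B) $ l $ k) = 1" .
qed

lemma left_stochastic_matpow:
  fixes A :: "real^'n^'n"
  assumes "left_stochastic A"
  shows "left_stochastic (matpow A n)"
proof (induction n)
  case 0
  have "(\<Sum>l\<in>UNIV. (mat 1 :: real^'n^'n) $ l $ k) = 1" for k :: 'n
    by (simp add: mat_def)
  then show ?case by (auto simp: left_stochastic_def) (simp add: mat_def)
qed (simp add: left_stochastic_mult assms)

lemma matpow_fixed:
  assumes "A *v p = p"
  shows "matpow A n *v p = p"
  by (induction n) (simp_all add: assms matrix_vector_mul_assoc[symmetric])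

lemma norm_weighted_sum_sq_le:
  fixes f :: "'i \<Rightarrow> 'a::real_normed_vector"
  assumes "\<And>i. i \<in> S \<Longrightarrow> 0 \<le> a i"
  shows "(norm (\<Sum>i\<in>S. a i *\<^sub>R f i))\<^sup>2 \<le> (\<Sum>i\<in>S. a i) * (\<Sum>i\<in>S. a i * (norm (f i))\<^sup>2)"
proof -
  have "norm (\<Sum>i\<in>S. a i *\<^sub>R f i) \<le> (\<Sum>i\<in>S. norm (a i *\<^sub>R f i))" by (rule norm_sum)
  also have "\<dots> = (\<Sum>i\<in>S. sqrt (a i) * (sqrt (a i) * norm (f i)))"
    using assms by (intro sum.cong) (auto simp: mult.assoc[symmetric])
  finally have "(norm (\<Sum>i\<in>S. a i *\<^sub>R f i))\<^sup>2 \<le> (\<Sum>i\<in>S. sqrt (a i) * (sqrt (a i) * norm (f i)))\<^sup>2"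
    by (intro power_mono) auto
  also have "\<dots> \<le> (\<Sum>i\<in>S. (sqrt (a i))\<^sup>2) * (\<Sum>i\<in>S. (sqrt (a i) * norm (f i))\<^sup>2)"
    by (rule Cauchy_Schwarz_ineq_sum)
  also have "\<dots> = (\<Sum>i\<in>S. a i) * (\<Sum>i\<in>S. a i * (norm (f i))\<^sup>2)"
    using assms by (simp add: power_mult_distrib)
  finally show ?thesis .
qed

text \<open>One factor \<open>s\<close> comes from the column sums in Cauchy-Schwarz, the other from
  \<open>B *v p = s *\<^sub>R p\<close> after exchanging the sums. The case \<open>s = 1\<close> is
  nonexpansiveness; a smaller \<open>s\<close> arises after removing a rank-one part.\<close>

lemma wnorm2_mix_le:
  assumes nn: "\<And>l k. 0 \<le> B $ l $ k" and col: "\<And>k. (\<Sum>l\<in>UNIV. B $ l $ k) = s"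
    and fix_p: "B *v p = s *\<^sub>R p" and p: "\<And>k. 0 \<le> p $ k"
  shows "wnorm2 p (mix B f) \<le> s\<^sup>2 * wnorm2 p f"
proof -
  have "0 \<le> s" using col[of undefined] nn by (metis sum_nonneg)
  have "wnorm2 p (mix B f) \<le> (\<Sum>k\<in>UNIV. p $ k * (s * (\<Sum>l\<in>UNIV. B $ l $ k * (norm (f l))\<^sup>2)))"
    unfolding wnorm2_def mix_def
    by (intro sum_mono mult_left_mono p)
      (use norm_weighted_sum_sq_le[of UNIV "\<lambda>l. B $ l $ k" f for k] nn in \<open>simp add: col\<close>)
  also have "\<dots> = s * (\<Sum>k\<in>UNIV. \<Sum>l\<in>UNIV. B $ l $ k * p $ k * (norm (f l))\<^sup>2)"
    by (simp add: sum_distrib_left mult_ac)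
  also have "\<dots> = s * (\<Sum>l\<in>UNIV. \<Sum>k\<in>UNIV. B $ l $ k * p $ k * (norm (f l))\<^sup>2)"
    by (subst sum.swap) (rule refl)
  also have "\<dots> = s * (\<Sum>l\<in>UNIV. (B *v p) $ l * (norm (f l))\<^sup>2)"
    by (simp add: matrix_vector_mult_def sum_distrib_right)
  also have "\<dots> = s\<^sup>2 * wnorm2 p f"
    by (simp add: fix_p wnorm2_def sum_distrib_left power2_eq_square mult_ac)
  finally show ?thesis .
qed

text \<open>A walk of length \<open>n\<close> along positive entries contributes a positive product
  to a sum of nonnegative ones.\<close>

lemma matpow_pos:
  assumes "\<And>l k. 0 \<le> A $ l $ k" "(l, k) \<in> {(i, j). A $ i $ j > 0} ^^ n"
  shows "0 < matpow A n $ l $ k"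
  using assms(2)
proof (induction n arbitrary: l)
  case 0
  then show ?case by (simp add: mat_def)
next
  case (Suc n)
  obtain m where m: "A $ l $ m > 0" "(m, k) \<in> {(i, j). A $ i $ j > 0} ^^ n"
    using relpow_Suc_D2[OF Suc.prems] by auto
  have nn: "0 \<le> matpow A n $ i $ j" for i j
    by (induction n arbitrary: i) (auto simp: mat_def matrix_matrix_mult_def assms(1) intro!: sum_nonneg)
  have "0 < A $ l $ m * matpow A n $ m $ k" using m Suc.IH by simp
  also have "\<dots> \<le> (\<Sum>m\<in>UNIV. A $ l $ m * matpow A n $ m $ k)"
    by (rule member_le_sum) (auto simp: assms(1) nn)
  finally show ?case by (simp add: matrix_matrix_mult_def)
qed

lemma primitive_matpow:
  assumes "left_stochastic A" "strongly_connected A" "A $ c $ c > 0"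
  obtains n where "n \<ge> 1" "\<And>l k. 0 < matpow A n $ l $ k"
proof -
  let ?E = "{(i, j). A $ i $ j > 0}"
  have "\<exists>m. (l, k) \<in> ?E ^^ m" for l k
    using assms(2) unfolding strongly_connected_def by (metis rtrancl_imp_relpow)
  then obtain m where m: "\<And>l k. (l, k) \<in> ?E ^^ m l k" by metis
  have loop: "(c, c) \<in> ?E ^^ j" for j
    by (induction j) (auto intro: relcompI simp: assms(3))
  \<comment> \<open>Every pair is joined through \<open>c\<close>, and the self-loop there pads all
    walks to one common length. The two sums dominate each \<open>m l c + m c k\<close>.\<close>
  define n where "n = 1 + (\<Sum>l\<in>UNIV. m l c) + (\<Sum>k\<in>UNIV. m c k)"
  have "0 < matpow A n $ l $ k" for l k
  proof (rule matpow_pos)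
    show "0 \<le> A $ l $ k" for l k using assms(1) by (simp add: left_stochastic_def)
    have "m l c \<le> (\<Sum>l\<in>UNIV. m l c)" by (rule member_le_sum) auto
    moreover have "m c k \<le> (\<Sum>k\<in>UNIV. m c k)" by (rule member_le_sum) auto
    ultimately have "n = m l c + ((n - m l c - m c k) + m c k)" by (simp add: n_def)
    moreover have "(l, k) \<in> ?E ^^ m l c O (?E ^^ (n - m l c - m c k) O ?E ^^ m c k)"
      by (intro relcompI[OF m] relcompI[OF loop] m)
    ultimately show "(l, k) \<in> ?E ^^ n" by (metis relpow_add)
  qed
  then show thesis using that[of n] by (simp add: n_def)
qed

lemma sum_perron_mix:
  assumes "A *v p = p"
  shows "(\<Sum>k\<in>UNIV. p $ k *\<^sub>R mix A f k) = (\<Sum>k\<in>UNIV. p $ k *\<^sub>R f k)"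
proof -
  have "(\<Sum>k\<in>UNIV. p $ k *\<^sub>R mix A f k) = (\<Sum>k\<in>UNIV. \<Sum>l\<in>UNIV. (A $ l $ k * p $ k) *\<^sub>R f l)"
    by (simp add: mix_def scaleR_sum_right mult.commute)
  also have "\<dots> = (\<Sum>l\<in>UNIV. \<Sum>k\<in>UNIV. (A $ l $ k * p $ k) *\<^sub>R f l)" by (rule sum.swap)
  also have "\<dots> = (\<Sum>l\<in>UNIV. (A *v p) $ l *\<^sub>R f l)"
    by (simp add: matrix_vector_mult_def scaleR_sum_left)
  finally show ?thesis by (simp add: assms)
qed

text \<open>Doeblin's argument: on vectors of mean zero, subtracting \<open>c * p $ l\<close> from
  row \<open>l\<close> of the power leaves the mixing unchanged, while column sums and the
  eigenvalue at \<open>p\<close> both drop to \<open>1 - c\<close>. Since the weights are at most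
  \<open>1\<close>, the entries stay nonnegative.\<close>

lemma wnorm2_matpow_contraction:
  fixes p :: "real^'n"
  assumes "left_stochastic A" "perron_vector A p" "0 \<le> c" "\<And>l k. c \<le> matpow A n $ l $ k"
    and "(\<Sum>k\<in>UNIV. p $ k *\<^sub>R f k) = 0"
  shows "wnorm2 p (mix (matpow A n) f) \<le> (1 - c)\<^sup>2 * wnorm2 p f"
proof -
  have Ap: "A *v p = p" and p1: "(\<Sum>k\<in>UNIV. p $ k) = 1" and p0: "\<And>k. p $ k > 0"
    using assms(2) by (auto simp: perron_vector_def)
  have ple: "p $ k \<le> 1" for k
    unfolding p1[symmetric] by (rule member_le_sum) (auto simp: less_imp_le[OF p0])
  let ?K = "matpow A n"
  define B :: "real^'n^'n" where "B = (\<chi> l k. ?K $ l $ k - c * p $ l)"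
  have K: "left_stochastic ?K" by (rule left_stochastic_matpow[OF assms(1)])
  have "mix B f = mix ?K f"
  proof
    fix k
    have "mix B f k = mix ?K f k - c *\<^sub>R (\<Sum>l\<in>UNIV. p $ l *\<^sub>R f l)"
      by (simp add: mix_def B_def scaleR_diff_left sum_subtractf scaleR_sum_right)
    then show "mix B f k = mix ?K f k" by (simp add: assms(5))
  qed
  moreover have "wnorm2 p (mix B f) \<le> (1 - c)\<^sup>2 * wnorm2 p f"
  proof (rule wnorm2_mix_le)
    fix l k
    have "c * p $ l \<le> c * 1" by (intro mult_left_mono ple assms)
    then show "0 \<le> B $ l $ k" using assms(4)[of l k] by (simp add: B_def)
    show "(\<Sum>l\<in>UNIV. B $ l $ k) = 1 - c"
      using K by (simp add: B_def sum_subtractf sum_distrib_left[symmetric] p1 left_stochastic_def)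
    have "B *v p = ?K *v p - c *\<^sub>R p"
      by (simp add: vec_eq_iff B_def matrix_vector_mult_def left_diff_distrib sum_subtractf
          sum_distrib_left[symmetric] p1 mult.assoc)
    then show "B *v p = (1 - c) *\<^sub>R p"
      by (simp add: matpow_fixed[OF Ap] scaleR_diff_left)
    show "0 \<le> p $ k" using p0[of k] by simp
  qed
  ultimately show ?thesis by simp
qed

lemma norm_add_sq_le:
  fixes a b :: "'a::real_inner"
  assumes "t > 0"
  shows "(norm (a + b))\<^sup>2 \<le> (1 + t) * (norm a)\<^sup>2 + (1 + 1 / t) * (norm b)\<^sup>2"
proof -
  have "2 * (b \<bullet> a) \<le> t * (norm a)\<^sup>2 + (1 / t) * (norm b)\<^sup>2"
    using inner_minus_square_le[OF assms, of b a] by (simp add: field_simps)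
  moreover have "(norm (a + b))\<^sup>2 = (norm a)\<^sup>2 + 2 * (b \<bullet> a) + (norm b)\<^sup>2"
    unfolding power2_norm_eq_inner by (simp add: inner_add_left inner_add_right inner_commute)
  moreover have "(1 + t) * (norm a)\<^sup>2 = (norm a)\<^sup>2 + t * (norm a)\<^sup>2" by (simp add: distrib_right)
  moreover have "(1 + 1 / t) * (norm b)\<^sup>2 = (norm b)\<^sup>2 + (1 / t) * (norm b)\<^sup>2" by (simp add: distrib_right)
  ultimately show ?thesis by linarith
qed

lemma wnorm2_add_le:
  fixes f g :: "'n::finite \<Rightarrow> 'a::real_inner"
  assumes "t > 0" "\<And>k. 0 \<le> p $ k"
  shows "wnorm2 p (\<lambda>k. f k + g k) \<le> (1 + t) * wnorm2 p f + (1 + 1 / t) * wnorm2 p g"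
proof -
  have "wnorm2 p (\<lambda>k. f k + g k)
      \<le> (\<Sum>k\<in>UNIV. p $ k * ((1 + t) * (norm (f k))\<^sup>2 + (1 + 1 / t) * (norm (g k))\<^sup>2))"
    unfolding wnorm2_def by (intro sum_mono mult_left_mono norm_add_sq_le assms)
  also have "\<dots> = (1 + t) * wnorm2 p f + (1 + 1 / t) * wnorm2 p g"
    unfolding wnorm2_def sum_distrib_left sum.distrib[symmetric]
    by (intro sum.cong refl) (simp only: distrib_left mult.left_commute)
  finally show ?thesis .
qed

text \<open>A single step of \<^term>\<open>mix A\<close> need not contract \<^const>\<open>wnorm2\<close> on vectors of mean zero, only the
  \<open>n\<close>-th power does. Summing over one period with geometric weights makes every step a contraction.\<close>

definition lyapunov :: "real^'n^'n \<Rightarrow> real^'n \<Rightarrow> real \<Rightarrow> nat \<Rightarrow> ('n \<Rightarrow> 'a::real_normed_vector) \<Rightarrow> real" where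
  "lyapunov A p \<theta> n f = (\<Sum>j<n. wnorm2 p (mix (matpow A j) f) / \<theta> ^ j)"

text \<open>Mixing alone contracts the functional by \<open>\<theta>\<close> on mean-zero vectors.
  Young's inequality then admits the perturbation \<open>g\<close> at the price of the slightly
  larger rate \<open>\<rho>\<close> and the constant \<open>C\<close>.\<close>

lemma lyapunov_drift:
  fixes A :: "real^'n^'n"
  assumes "left_stochastic A" "strongly_connected A" "\<exists>k. A $ k $ k > 0" and perron: "perron_vector A p"
  obtains \<theta> \<rho> n C where "0 < \<rho>" "\<rho> < 1" "C \<ge> 1"
    "\<And>f :: 'n \<Rightarrow> 'a::real_inner. wnorm2 p f \<le> lyapunov A p \<theta> n f"
    "\<And>f g :: 'n \<Rightarrow> 'a. \<lbrakk>(\<Sum>k\<in>UNIV. p $ k *\<^sub>R f k) = 0; (\<Sum>k\<in>UNIV. p $ k *\<^sub>R g k) = 0\<rbrakk> \<Longrightarrow>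
      lyapunov A p \<theta> n (mix A (\<lambda>k. f k + g k)) \<le> \<rho> * lyapunov A p \<theta> n f + C * wnorm2 p g"
proof -
  have Ap: "A *v p = p" and p1: "(\<Sum>k\<in>UNIV. p $ k) = 1" and p0: "\<And>k. p $ k > 0"
    using perron by (auto simp: perron_vector_def)
  have p0': "0 \<le> p $ k" for k using p0[of k] by simp
  obtain c0 where "A $ c0 $ c0 > 0" using assms(3) by blast
  from primitive_matpow[OF assms(1,2) this]
  obtain n where n: "n \<ge> 1" "\<And>l k. 0 < matpow A n $ l $ k" by blast
  define c where "c = min (1/2) (Min (range (\<lambda>(l, k). matpow A n $ l $ k)))"
  have c_le: "c \<le> matpow A n $ l $ k" for l k
    unfolding c_def by (rule min.coboundedI2) (auto intro!: Min_le)
  have c: "0 < c" "c \<le> 1/2" using n(2) by (auto simp: c_def)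
  \<comment> \<open>Bernoulli gives \<open>\<theta> ^ n \<ge> 1 - c\<close>, and this dominates the
    factor \<open>(1 - c)\<^sup>2\<close> of a full period. Capping \<open>c\<close> at
    \<open>1/2\<close> keeps \<open>\<theta>\<close> positive.\<close>
  define \<theta> where "\<theta> = 1 - c / real n"
  have cn: "0 < c / real n" "c / real n \<le> 1/2"
    using c n(1) by (auto simp: field_simps)
  have "c / real n < 1" using cn(2) by (rule le_less_trans) simp
  with cn have \<theta>: "0 < \<theta>" "\<theta> < 1" by (simp_all add: \<theta>_def)
  have "1 + real n * (- (c / real n)) \<le> (1 + - (c / real n)) ^ n"
    by (rule Bernoulli_inequality) (use cn in linarith)
  then have "1 - c \<le> \<theta> ^ n" using n(1) by (simp add: \<theta>_def)
  moreover have "(1 - c)\<^sup>2 \<le> 1 - c" using c unfolding power2_eq_square by (intro mult_left_le) auto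
  ultimately have c\<theta>: "(1 - c)\<^sup>2 \<le> \<theta> ^ n" by linarith
  have w_nonneg: "0 \<le> wnorm2 p f" for f :: "'n \<Rightarrow> 'a"
    unfolding wnorm2_def by (intro sum_nonneg mult_nonneg_nonneg p0') auto
  have w_le: "wnorm2 p (mix (matpow A j) f) \<le> wnorm2 p f" for j and f :: "'n \<Rightarrow> 'a"
    using wnorm2_mix_le[of "matpow A j" 1 p f] left_stochastic_matpow[OF assms(1), of j]
      matpow_fixed[OF Ap, of j] p0' by (simp add: left_stochastic_def)
  define V where "V = (lyapunov A p \<theta> n :: ('n \<Rightarrow> 'a) \<Rightarrow> real)"
  define C0 where "C0 = (\<Sum>j<n. 1 / \<theta> ^ j)"
  have lower: "wnorm2 p f \<le> V f" for f
  proof -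
    have "wnorm2 p (mix (matpow A 0) f) / \<theta> ^ 0 \<le> V f"
      unfolding V_def lyapunov_def
      by (rule member_le_sum) (use n(1) \<theta> w_nonneg in auto)
    then show ?thesis by (simp add: mix_one)
  qed
  have upper: "V f \<le> C0 * wnorm2 p f" for f
    unfolding V_def lyapunov_def C0_def sum_distrib_right
  proof (rule sum_mono)
    fix j
    show "wnorm2 p (mix (matpow A j) f) / \<theta> ^ j \<le> 1 / \<theta> ^ j * wnorm2 p f"
      using divide_right_mono[OF w_le[of j f], of "\<theta> ^ j"] \<theta> by simp
  qed
  have contr: "V (mix A f) \<le> \<theta> * V f" if f: "(\<Sum>k\<in>UNIV. p $ k *\<^sub>R f k) = 0" for f
  proof -
    define a where "a j = wnorm2 p (mix (matpow A j) f) / \<theta> ^ j" for j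
    have "V (mix A f) = (\<Sum>j<n. \<theta> * a (Suc j))"
      unfolding V_def lyapunov_def a_def mix_mix using \<theta> by (intro sum.cong) auto
    also have "\<dots> = \<theta> * (\<Sum>j<n. a (Suc j))" by (simp add: sum_distrib_left)
    \<comment> \<open>One mixing step shifts the index in the sum. The weights turn the contraction
      over a whole period into \<open>a n \<le> a 0\<close>, so the boundary terms can only
      help.\<close>
    also have "(\<Sum>j<n. a (Suc j)) = (\<Sum>j<n. a j) + a n - a 0"
      using sum.lessThan_Suc_shift[of a n] by simp
    also have "a n \<le> a 0"
    proof -
      have "wnorm2 p (mix (matpow A n) f) \<le> (1 - c)\<^sup>2 * wnorm2 p f"
        by (rule wnorm2_matpow_contraction[OF assms(1) perron _ c_le f]) (use c in simp)
      also have "\<dots> \<le> \<theta> ^ n * wnorm2 p f" by (intro mult_right_mono c\<theta> w_nonneg)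
      finally show ?thesis using \<theta> by (simp add: a_def mix_one field_simps)
    qed
    finally show ?thesis using \<theta> by (simp add: V_def lyapunov_def a_def)
  qed
  \<comment> \<open>Chosen so that \<open>\<theta> * (1 + t)\<close> is the midpoint of
    \<open>\<theta>\<close> and \<open>1\<close>.\<close>
  define t where "t = (1 - \<theta>) / (2 * \<theta>)"
  have t: "t > 0" using \<theta> by (simp add: t_def)
  have V_add: "V (\<lambda>k. f k + g k) \<le> (1 + t) * V f + (1 + 1 / t) * V g" for f g
  proof -
    have "V (\<lambda>k. f k + g k) \<le> (\<Sum>j<n. ((1 + t) * wnorm2 p (mix (matpow A j) f)
        + (1 + 1 / t) * wnorm2 p (mix (matpow A j) g)) / \<theta> ^ j)"
      unfolding V_def lyapunov_def mix_add
      by (intro sum_mono divide_right_mono wnorm2_add_le t p0') (use \<theta> in auto)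
    then show ?thesis
      by (simp add: V_def lyapunov_def sum_distrib_left sum.distrib add_divide_distrib)
  qed
  define \<rho> where "\<rho> = (1 + \<theta>) / 2"
  have \<rho>: "\<theta> * (1 + t) = \<rho>" using \<theta> by (simp add: \<rho>_def t_def field_simps)
  define C where "C = max 1 (\<theta> * (1 + 1 / t) * C0)"
  show thesis
  proof (rule that[of \<rho> C \<theta> n, folded V_def])
    show "0 < \<rho>" "\<rho> < 1" using \<theta> by (auto simp: \<rho>_def)
    show "C \<ge> 1" by (simp add: C_def)
    show "wnorm2 p f \<le> V f" for f by (rule lower)
    fix f g :: "'n \<Rightarrow> 'a"
    assume fg: "(\<Sum>k\<in>UNIV. p $ k *\<^sub>R f k) = 0" "(\<Sum>k\<in>UNIV. p $ k *\<^sub>R g k) = 0"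
    have "V (mix A (\<lambda>k. f k + g k)) \<le> \<theta> * V (\<lambda>k. f k + g k)"
      by (rule contr) (simp add: scaleR_add_right sum.distrib fg)
    also have "\<dots> \<le> \<theta> * ((1 + t) * V f + (1 + 1 / t) * (C0 * wnorm2 p g))"
    proof (rule mult_left_mono)
      have "(1 + 1 / t) * V g \<le> (1 + 1 / t) * (C0 * wnorm2 p g)"
        by (rule mult_left_mono[OF upper]) (use t in simp)
      with V_add[of f g] show "V (\<lambda>k. f k + g k) \<le> (1 + t) * V f + (1 + 1 / t) * (C0 * wnorm2 p g)"
        by linarith
    qed (use \<theta> in simp)
    also have "\<dots> = \<rho> * V f + (\<theta> * (1 + 1 / t) * C0) * wnorm2 p g"
      unfolding \<rho>[symmetric] by (rule trans[OF distrib_left]) (simp only: mult.assoc)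
    also have "\<dots> \<le> \<rho> * V f + C * wnorm2 p g"
      by (intro add_left_mono mult_right_mono w_nonneg) (simp add: C_def)
    finally show "V (mix A (\<lambda>k. f k + g k)) \<le> \<rho> * V f + C * wnorm2 p g" .
  qed
qed

section \<open>Pathwise estimates for one step\<close>

lemma square_sum4_le:
  fixes a b c d :: real
  shows "(a + b + c + d)\<^sup>2 \<le> 4 * (a\<^sup>2 + b\<^sup>2 + c\<^sup>2 + d\<^sup>2)"
proof -
  have "4 * (a\<^sup>2 + b\<^sup>2 + c\<^sup>2 + d\<^sup>2) - (a + b + c + d)\<^sup>2
      = (a - b)\<^sup>2 + (a - c)\<^sup>2 + (a - d)\<^sup>2 + (b - c)\<^sup>2 + (b - d)\<^sup>2 + (c - d)\<^sup>2"
    by (simp add: power2_eq_square algebra_simps)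
  moreover have "0 \<le> (a - b)\<^sup>2 + (a - c)\<^sup>2 + (a - d)\<^sup>2 + (b - c)\<^sup>2 + (b - d)\<^sup>2 + (c - d)\<^sup>2"
    by simp
  ultimately show ?thesis by linarith
qed

lemma square_sum3_le:
  fixes a b c :: real
  shows "(a + b + c)\<^sup>2 \<le> 3 * (a\<^sup>2 + b\<^sup>2 + c\<^sup>2)"
proof -
  have "3 * (a\<^sup>2 + b\<^sup>2 + c\<^sup>2) - (a + b + c)\<^sup>2 = (a - b)\<^sup>2 + (a - c)\<^sup>2 + (b - c)\<^sup>2"
    by (simp add: power2_eq_square algebra_simps)
  moreover have "0 \<le> (a - b)\<^sup>2 + (a - c)\<^sup>2 + (b - c)\<^sup>2" by simp
  ultimately show ?thesis by linarith
qed

definition wavg :: "real^'n \<Rightarrow> ('n \<Rightarrow> 'a::real_vector) \<Rightarrow> 'a" where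
  "wavg p f = (\<Sum>k\<in>UNIV. p $ k *\<^sub>R f k)"

lemma wavg_diff: "wavg p (\<lambda>k. f k - g k) = wavg p f - wavg p g"
  by (simp add: wavg_def scaleR_diff_right sum_subtractf)

lemma wavg_scaleR: "wavg p (\<lambda>k. c *\<^sub>R f k) = c *\<^sub>R wavg p f"
  by (simp add: wavg_def scaleR_sum_right mult.commute)

locale weights =
  fixes p :: "real^'n"
  assumes p_pos: "0 < p $ k" and p_sum: "(\<Sum>k\<in>UNIV. p $ k) = 1"
begin

lemma p_nonneg: "0 \<le> p $ k"
  using p_pos[of k] by simp

lemma wavg_const: "wavg p (\<lambda>_. x) = x"
  by (simp add: wavg_def scaleR_sum_left[symmetric] p_sum)

lemma wavg_centered: "wavg p (\<lambda>k. f k - wavg p f) = 0"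
  by (simp add: wavg_diff wavg_const)

lemma wnorm2_nonneg: "0 \<le> wnorm2 p f"
  unfolding wnorm2_def by (intro sum_nonneg mult_nonneg_nonneg p_nonneg zero_le_power2)

lemma norm_wavg_sq_le: "(norm (wavg p f))\<^sup>2 \<le> wnorm2 p f"
  using norm_weighted_sum_sq_le[of UNIV "\<lambda>k. p $ k" f] p_nonneg
  by (simp add: wavg_def wnorm2_def p_sum)

text \<open>Variance identity: centering lowers the weighted second moment by exactly the squared
  norm of the average.\<close>

lemma wnorm2_centered_le:
  fixes f :: "'n \<Rightarrow> 'a::real_inner"
  shows "wnorm2 p (\<lambda>k. f k - wavg p f) \<le> wnorm2 p f"
proof -
  let ?m = "wavg p f"
  have "wnorm2 p (\<lambda>k. f k - ?m) = (\<Sum>k\<in>UNIV. p $ k * (norm (f k))\<^sup>2 - 2 * ((p $ k *\<^sub>R f k) \<bullet> ?m) + p $ k * (norm ?m)\<^sup>2)"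
    unfolding wnorm2_def
  proof (rule sum.cong[OF refl])
    fix k
    show "p $ k * (norm (f k - ?m))\<^sup>2 = p $ k * (norm (f k))\<^sup>2 - 2 * ((p $ k *\<^sub>R f k) \<bullet> ?m) + p $ k * (norm ?m)\<^sup>2"
      using norm_diff_scaleR_sq[of "f k" 1 ?m] by (simp add: right_diff_distrib distrib_left)
  qed
  also have "\<dots> = wnorm2 p f - 2 * (\<Sum>k\<in>UNIV. (p $ k *\<^sub>R f k) \<bullet> ?m) + (\<Sum>k\<in>UNIV. p $ k) * (norm ?m)\<^sup>2"
    unfolding sum.distrib sum_subtractf wnorm2_def sum_distrib_left sum_distrib_right ..
  also have "(\<Sum>k\<in>UNIV. (p $ k *\<^sub>R f k) \<bullet> ?m) = ?m \<bullet> ?m"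
    unfolding inner_sum_left[symmetric] wavg_def ..
  also have "wnorm2 p f - 2 * (?m \<bullet> ?m) + (\<Sum>k\<in>UNIV. p $ k) * (norm ?m)\<^sup>2
      = wnorm2 p f - 2 * (?m \<bullet> ?m) + (norm ?m)\<^sup>2"
    by (simp add: p_sum)
  also have "\<dots> = wnorm2 p f - (norm ?m)\<^sup>2" by (simp add: power2_norm_eq_inner)
  finally show ?thesis by simp
qed

lemma wnorm2_shift_le:
  fixes f :: "'n \<Rightarrow> 'a::real_inner"
  shows "wnorm2 p (\<lambda>k. f k - z) \<le> 2 * wnorm2 p (\<lambda>k. f k - x) + 2 * (norm (x - z))\<^sup>2"
proof -
  have "wnorm2 p (\<lambda>k. (f k - x) + (x - z))
      \<le> (1 + 1) * wnorm2 p (\<lambda>k. f k - x) + (1 + 1 / 1) * wnorm2 p (\<lambda>k. x - z)"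
    by (rule wnorm2_add_le) (auto simp: p_nonneg)
  then show ?thesis by (simp add: wnorm2_def sum_distrib_right[symmetric] p_sum)
qed

end

text \<open>Mixing commutes with centering: unit column sums fix constant vectors, and the Perron
  relation preserves the average.\<close>

lemma center_mix:
  assumes "left_stochastic A" "A *v p = p"
  shows "mix A f k - wavg p (mix A f) = mix A (\<lambda>l. f l - wavg p f) k"
proof -
  have "wavg p (mix A f) = wavg p f"
    unfolding wavg_def by (rule sum_perron_mix[OF assms(2)])
  moreover have "(\<Sum>l\<in>UNIV. A $ l $ k *\<^sub>R wavg p f) = wavg p f"
    using assms(1) by (simp add: left_stochastic_def scaleR_sum_left[symmetric])
  ultimately show ?thesis
    by (simp add: mix_def scaleR_diff_right sum_subtractf)
qed

text \<open>The constant \<open>K\<close> dominates everything that does not depend on the step-size, so that only \<open>\<mu>\<close> and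
  \<open>\<eta> = 1 / \<delta>\<close> have to be tracked; \<open>gJ\<close> and \<open>u\<close> stand for the gradients of the costs and of the smoothed
  regularizers, and \<open>z\<close> for the minimizer.\<close>

locale diffusion_step = weights p for p :: "real^'n" +
  fixes gJ u :: "'n \<Rightarrow> 'a::euclidean_space \<Rightarrow> 'a" and z :: 'a and \<mu> \<eta> K lam :: real
  assumes K: "1 \<le> K" and lam: "0 < lam" and mu: "0 < \<mu>" and eta: "1 \<le> \<eta>"
    and gJ_lip: "norm (gJ k x - gJ k y) \<le> K * norm (x - y)"
    and u_lip: "norm (u k x - u k y) \<le> \<eta> * norm (x - y)"
    and strong_mono: "lam * (norm (x - y))\<^sup>2
      \<le> (x - y) \<bullet> (wavg p (\<lambda>k. gJ k x + u k x) - wavg p (\<lambda>k. gJ k y + u k y))"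
    and zero: "wavg p (\<lambda>k. gJ k z + u k z) = 0"
    and z_bound: "norm z \<le> K" and gJ_z: "norm (gJ k z) \<le> K" and u_z: "norm (u k z) \<le> K"
    and nu_le_1: "\<mu> * \<eta>\<^sup>2 \<le> 1" and nu_le_lam: "4 * K\<^sup>2 * (\<mu> * \<eta>\<^sup>2) \<le> lam" and mu_lam: "\<mu> * lam \<le> 2"
begin

lemma K_eta: "K + \<eta> \<le> 2 * K * \<eta>"
proof -
  have "K * 1 \<le> K * \<eta>" "1 * \<eta> \<le> K * \<eta>" using K eta by (intro mult_mono; simp)+
  then show ?thesis by simp
qed

lemma mean_gradient_lipschitz:
  "norm (wavg p (\<lambda>k. gJ k x + u k x) - wavg p (\<lambda>k. gJ k y + u k y)) \<le> (K + \<eta>) * norm (x - y)"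
proof -
  have "wavg p (\<lambda>k. gJ k x + u k x) - wavg p (\<lambda>k. gJ k y + u k y)
      = (\<Sum>k\<in>UNIV. p $ k *\<^sub>R (gJ k x - gJ k y + (u k x - u k y)))"
    unfolding wavg_diff[symmetric] by (simp add: wavg_def algebra_simps)
  also have "norm \<dots> \<le> (\<Sum>k\<in>UNIV. p $ k * ((K + \<eta>) * norm (x - y)))"
  proof (rule order_trans[OF norm_sum sum_mono])
    fix k
    have "norm (gJ k x - gJ k y + (u k x - u k y)) \<le> (K + \<eta>) * norm (x - y)"
      using norm_triangle_mono[OF gJ_lip u_lip] by (simp add: distrib_right)
    then show "norm (p $ k *\<^sub>R (gJ k x - gJ k y + (u k x - u k y))) \<le> p $ k * ((K + \<eta>) * norm (x - y))"
      using p_nonneg[of k] by (simp add: mult_left_mono)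
  qed
  also have "\<dots> = (K + \<eta>) * norm (x - y)" by (simp add: sum_distrib_right[symmetric] p_sum)
  finally show ?thesis .
qed

lemma mu_eta_le_1: "\<mu> * \<eta> \<le> 1"
proof -
  have "\<mu> * \<eta> \<le> \<mu> * \<eta>\<^sup>2"
    using mu eta by (intro mult_left_mono) (simp_all add: power2_eq_square)
  with nu_le_1 show ?thesis by linarith
qed

lemma norm_gJ_le: "norm (gJ k y) \<le> K + K * norm (y - z)"
  using norm_triangle_mono[OF gJ_z[of k] gJ_lip[of k y z]] by simp

lemma norm_increment_le: "norm (\<mu> *\<^sub>R (gJ k y + s)) \<le> \<mu> * (K + K * norm (y - z) + norm s)"
proof -
  have "norm (gJ k y + s) \<le> K + K * norm (y - z) + norm s"
    by (rule norm_triangle_mono[OF norm_gJ_le order_refl])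
  then show ?thesis using mu by simp
qed

lemma norm_u_increment_le:
  "norm (u k (y - \<mu> *\<^sub>R (gJ k y + s)) - u k x)
    \<le> \<eta> * (norm (y - x) + \<mu> * (K + K * norm (y - z) + norm s))"
proof -
  have "norm (u k (y - \<mu> *\<^sub>R (gJ k y + s)) - u k x) \<le> \<eta> * norm ((y - \<mu> *\<^sub>R (gJ k y + s)) - x)"
    by (rule u_lip)
  also have "(y - \<mu> *\<^sub>R (gJ k y + s)) - x = (y - x) - \<mu> *\<^sub>R (gJ k y + s)" by simp
  also have "\<eta> * norm \<dots> \<le> \<eta> * (norm (y - x) + \<mu> * (K + K * norm (y - z) + norm s))"
    using eta by (intro mult_left_mono order_trans[OF norm_triangle_ineq4] add_left_mono norm_increment_le) simp
  finally show ?thesis .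
qed

text \<open>The two substeps of an agent merged into one direction, so that the update before mixing
  is \<open>y - \<mu> *\<^sub>R dir k y s\<close>. The noise \<open>s\<close> occurs both additively
  and inside \<open>u\<close>.\<close>

definition dir :: "'n \<Rightarrow> 'a \<Rightarrow> 'a \<Rightarrow> 'a" where
  "dir k y s = gJ k y + s + u k (y - \<mu> *\<^sub>R (gJ k y + s))"

text \<open>Once the outer noise is subtracted, only gradient differences remain, and the inner
  noise carries the factor \<open>\<mu> * \<eta>\<close>. The constant \<open>16\<close> is
  \<open>4 * 2\<^sup>2\<close>, from splitting into four terms and from
  \<open>K + \<eta> \<le> 2 * K * \<eta>\<close>.\<close>

lemma dir_error:
  "(norm (dir k y s - s - (gJ k x + u k x)))\<^sup>2
    \<le> 16 * K\<^sup>2 * \<eta>\<^sup>2 * (norm (y - x))\<^sup>2 + 4 * \<mu>\<^sup>2 * \<eta>\<^sup>2 * K\<^sup>2 * (1 + (norm (y - z))\<^sup>2 + (norm s)\<^sup>2)"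
proof -
  define a b c where "a = norm (y - x)" and "b = norm (y - z)" and "c = norm s"
  have nn: "0 \<le> a" "0 \<le> b" "0 \<le> c" by (auto simp: a_def b_def c_def)
  have "dir k y s - s - (gJ k x + u k x) = (gJ k y - gJ k x) + (u k (y - \<mu> *\<^sub>R (gJ k y + s)) - u k x)"
    by (simp add: dir_def)
  then have "norm (dir k y s - s - (gJ k x + u k x)) \<le> K * a + \<eta> * (a + \<mu> * (K + K * b + c))"
    unfolding a_def b_def c_def
    by (metis norm_triangle_mono[OF gJ_lip norm_u_increment_le])
  also have "\<dots> = (K + \<eta>) * a + \<eta> * \<mu> * K + \<eta> * \<mu> * K * b + \<eta> * \<mu> * c"
    by (simp add: algebra_simps)
  also have "\<dots> \<le> 2 * K * \<eta> * a + \<eta> * \<mu> * K + \<eta> * \<mu> * K * b + \<eta> * \<mu> * K * c"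
  proof -
    have "(K + \<eta>) * a \<le> 2 * K * \<eta> * a" using nn by (intro mult_right_mono K_eta)
    moreover have "\<eta> * \<mu> * 1 * c \<le> \<eta> * \<mu> * K * c"
      using nn K eta mu by (intro mult_right_mono mult_left_mono) auto
    ultimately show ?thesis by simp
  qed
  finally have "(norm (dir k y s - s - (gJ k x + u k x)))\<^sup>2
      \<le> (2 * K * \<eta> * a + \<eta> * \<mu> * K + \<eta> * \<mu> * K * b + \<eta> * \<mu> * K * c)\<^sup>2"
    by (rule power_mono) simp
  also have "\<dots> \<le> 4 * ((2 * K * \<eta> * a)\<^sup>2 + (\<eta> * \<mu> * K)\<^sup>2 + (\<eta> * \<mu> * K * b)\<^sup>2 + (\<eta> * \<mu> * K * c)\<^sup>2)"
    by (rule square_sum4_le)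
  also have "\<dots> = 16 * K\<^sup>2 * \<eta>\<^sup>2 * a\<^sup>2 + 4 * \<mu>\<^sup>2 * \<eta>\<^sup>2 * K\<^sup>2 * (1 + b\<^sup>2 + c\<^sup>2)"
    by (simp add: power_mult_distrib algebra_simps)
  finally show ?thesis unfolding a_def b_def c_def .
qed

text \<open>Comparison with the gradients at \<open>z\<close>, which are bounded by
  \<open>K\<close>; \<open>\<mu> * \<eta> \<le> 1\<close> absorbs the inner increment. Three terms
  with coefficients of size \<open>3 * K\<close> give \<open>27 = 3 * 3\<^sup>2\<close>.\<close>

lemma norm_dir_sq_le: "(norm (dir k y s))\<^sup>2 \<le> 27 * K\<^sup>2 * (1 + \<eta>\<^sup>2 * (norm (y - z))\<^sup>2 + (norm s)\<^sup>2)"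
proof -
  define b c where "b = norm (y - z)" and "c = norm s"
  have nn: "0 \<le> b" "0 \<le> c" by (auto simp: b_def c_def)
  have 1: "norm (gJ k y + s) \<le> K + K * b + c"
    unfolding b_def c_def by (rule norm_triangle_mono[OF norm_gJ_le order_refl])
  have "norm (u k z + (u k (y - \<mu> *\<^sub>R (gJ k y + s)) - u k z)) \<le> K + \<eta> * (b + \<mu> * (K + K * b + c))"
    unfolding b_def c_def by (rule norm_triangle_mono[OF u_z norm_u_increment_le])
  then have "norm (dir k y s) \<le> (K + K * b + c) + (K + \<eta> * (b + \<mu> * (K + K * b + c)))"
    unfolding dir_def by (intro norm_triangle_mono 1) simp
  also have "\<dots> = (K + K * b + c) + (K + \<eta> * b + (\<mu> * \<eta>) * (K + K * b + c))"
    by (simp add: algebra_simps)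
  also have "\<dots> \<le> (K + K * b + c) + (K + \<eta> * b + 1 * (K + K * b + c))"
    using nn K by (intro add_left_mono mult_right_mono mu_eta_le_1) simp
  also have "\<dots> = 3 * K + (2 * K + \<eta>) * b + 2 * c" by (simp add: algebra_simps)
  also have "\<dots> \<le> 3 * K + 3 * K * \<eta> * b + 3 * K * c"
  proof -
    have "K * 1 \<le> K * \<eta>" using K eta by (intro mult_left_mono) simp_all
    with K_eta have "2 * K + \<eta> \<le> 3 * K * \<eta>" by simp
    then have "(2 * K + \<eta>) * b \<le> 3 * K * \<eta> * b" using nn by (intro mult_right_mono)
    moreover have "2 * c \<le> 3 * K * c" using nn K by (intro mult_right_mono) auto
    ultimately show ?thesis by simp
  qed
  finally have "(norm (dir k y s))\<^sup>2 \<le> (3 * K + 3 * K * \<eta> * b + 3 * K * c)\<^sup>2"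
    by (rule power_mono) simp
  also have "\<dots> \<le> 3 * ((3 * K)\<^sup>2 + (3 * K * \<eta> * b)\<^sup>2 + (3 * K * c)\<^sup>2)"
    by (rule square_sum3_le)
  also have "\<dots> = 27 * K\<^sup>2 * (1 + \<eta>\<^sup>2 * b\<^sup>2 + c\<^sup>2)"
    by (simp add: power_mult_distrib algebra_simps)
  finally show ?thesis unfolding b_def c_def .
qed

definition mean_step :: "'a \<Rightarrow> 'a" where
  "mean_step x = x - \<mu> *\<^sub>R wavg p (\<lambda>k. gJ k x + u k x)"

text \<open>By \<open>zero\<close>, the minimizer \<open>z\<close> is a fixed point of the step. The
  condition \<open>4 * K\<^sup>2 * (\<mu> * \<eta>\<^sup>2) \<le> lam\<close> lets the quadratic
  term consume at most half of the linear gain \<open>2 * \<mu> * lam\<close>.\<close>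

lemma mean_step_contraction: "(norm (mean_step x - z))\<^sup>2 \<le> (1 - \<mu> * lam) * (norm (x - z))\<^sup>2"
proof -
  define G where "G x = wavg p (\<lambda>k. gJ k x + u k x)" for x
  have "(norm ((x - \<mu> *\<^sub>R G x) - (z - \<mu> *\<^sub>R G z)))\<^sup>2
      \<le> (1 - 2 * \<mu> * lam + \<mu>\<^sup>2 * (K + \<eta>)\<^sup>2) * (norm (x - z))\<^sup>2"
    by (rule gradient_step_contraction[OF strong_mono[folded G_def] mean_gradient_lipschitz[folded G_def]]) (use mu in simp)
  also have "\<dots> \<le> (1 - \<mu> * lam) * (norm (x - z))\<^sup>2"
  proof (rule mult_right_mono)
    have "(K + \<eta>)\<^sup>2 \<le> (2 * K * \<eta>)\<^sup>2" using K_eta K eta by (intro power_mono) simp_all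
    then have "\<mu> * (\<mu> * (K + \<eta>)\<^sup>2) \<le> \<mu> * (\<mu> * (2 * K * \<eta>)\<^sup>2)" using mu by (intro mult_left_mono) auto
    also have "\<mu> * (2 * K * \<eta>)\<^sup>2 = 4 * K\<^sup>2 * (\<mu> * \<eta>\<^sup>2)" by (simp add: power_mult_distrib)
    also have "\<mu> * \<dots> \<le> \<mu> * lam" using nu_le_lam mu by (intro mult_left_mono) auto
    finally have "\<mu>\<^sup>2 * (K + \<eta>)\<^sup>2 \<le> \<mu> * lam" by (simp add: power2_eq_square mult.assoc)
    then show "1 - 2 * \<mu> * lam + \<mu>\<^sup>2 * (K + \<eta>)\<^sup>2 \<le> 1 - \<mu> * lam" by linarith
  qed simp
  finally show ?thesis using zero by (simp add: mean_step_def G_def)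
qed

lemma wnorm2_dir_error_le:
  fixes v s :: "'n \<Rightarrow> 'a"
  defines "x \<equiv> wavg p v"
  defines "D \<equiv> wnorm2 p (\<lambda>k. v k - x)" and "E \<equiv> (norm (x - z))\<^sup>2" and "S \<equiv> wnorm2 p s"
  shows "wnorm2 p (\<lambda>k. dir k (v k) (s k) - s k - (gJ k x + u k x))
    \<le> 16 * K\<^sup>2 * \<eta>\<^sup>2 * D + 4 * \<mu>\<^sup>2 * \<eta>\<^sup>2 * K\<^sup>2 * (1 + 2 * D + 2 * E + S)"
proof -
  have "wnorm2 p (\<lambda>k. dir k (v k) (s k) - s k - (gJ k x + u k x))
      \<le> (\<Sum>k\<in>UNIV. p $ k * (16 * K\<^sup>2 * \<eta>\<^sup>2 * (norm (v k - x))\<^sup>2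
          + 4 * \<mu>\<^sup>2 * \<eta>\<^sup>2 * K\<^sup>2 * (1 + (norm (v k - z))\<^sup>2 + (norm (s k))\<^sup>2)))"
    unfolding wnorm2_def by (intro sum_mono mult_left_mono dir_error p_nonneg)
  also have "\<dots> = 16 * K\<^sup>2 * \<eta>\<^sup>2 * D
      + 4 * \<mu>\<^sup>2 * \<eta>\<^sup>2 * K\<^sup>2 * ((\<Sum>k\<in>UNIV. p $ k) + wnorm2 p (\<lambda>k. v k - z) + S)"
    unfolding D_def S_def wnorm2_def sum_distrib_left sum.distrib[symmetric]
    by (intro sum.cong refl) (simp add: algebra_simps)
  also have "\<dots> \<le> 16 * K\<^sup>2 * \<eta>\<^sup>2 * D + 4 * \<mu>\<^sup>2 * \<eta>\<^sup>2 * K\<^sup>2 * (1 + (2 * D + 2 * E) + S)"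
    using wnorm2_shift_le[of v z x] unfolding D_def E_def p_sum
    by (intro add_left_mono mult_left_mono add_right_mono) auto
  finally show ?thesis by (simp add: add.assoc)
qed

lemma wnorm2_dir_le:
  fixes v s :: "'n \<Rightarrow> 'a"
  defines "x \<equiv> wavg p v"
  defines "D \<equiv> wnorm2 p (\<lambda>k. v k - x)" and "E \<equiv> (norm (x - z))\<^sup>2" and "S \<equiv> wnorm2 p s"
  shows "wnorm2 p (\<lambda>k. dir k (v k) (s k)) \<le> 27 * K\<^sup>2 * (1 + \<eta>\<^sup>2 * (2 * D + 2 * E) + S)"
proof -
  have "wnorm2 p (\<lambda>k. dir k (v k) (s k))
      \<le> (\<Sum>k\<in>UNIV. p $ k * (27 * K\<^sup>2 * (1 + \<eta>\<^sup>2 * (norm (v k - z))\<^sup>2 + (norm (s k))\<^sup>2)))"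
    unfolding wnorm2_def by (intro sum_mono mult_left_mono norm_dir_sq_le p_nonneg)
  also have "\<dots> = 27 * K\<^sup>2 * ((\<Sum>k\<in>UNIV. p $ k) + \<eta>\<^sup>2 * wnorm2 p (\<lambda>k. v k - z) + S)"
    unfolding S_def wnorm2_def sum_distrib_left sum.distrib[symmetric]
    by (intro sum.cong refl) (simp add: algebra_simps)
  also have "\<dots> \<le> 27 * K\<^sup>2 * (1 + \<eta>\<^sup>2 * (2 * D + 2 * E) + S)"
    using wnorm2_shift_le[of v z x] unfolding D_def E_def p_sum
    by (intro mult_left_mono add_left_mono add_right_mono) auto
  finally show ?thesis .
qed

text \<open>The new average is \<open>mean_step x\<close>, minus \<open>\<mu>\<close> times the
  averaged outer noise, minus \<open>\<mu>\<close> times the averaged gradient error. Young's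
  inequality is applied only to that last part; the inner product with the noise stays exact because
  its expectation will vanish.\<close>

lemma centroid_drift:
  fixes v s :: "'n \<Rightarrow> 'a"
  defines "x \<equiv> wavg p v"
  defines "D \<equiv> wnorm2 p (\<lambda>k. v k - x)" and "E \<equiv> (norm (x - z))\<^sup>2" and "S \<equiv> wnorm2 p s"
  shows "(norm (x - \<mu> *\<^sub>R wavg p (\<lambda>k. dir k (v k) (s k)) - z))\<^sup>2
    \<le> (1 - \<mu> * lam / 2) * E - 2 * \<mu> * (1 + \<mu> * lam / 2) * ((mean_step x - z) \<bullet> wavg p s) + 2 * \<mu>\<^sup>2 * S
      + 4 * \<mu> / lam * (16 * K\<^sup>2 * \<eta>\<^sup>2 * D + 4 * \<mu>\<^sup>2 * \<eta>\<^sup>2 * K\<^sup>2 * (1 + 2 * D + 2 * E + S))"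
    (is "_ \<le> _ + 4 * \<mu> / lam * ?Q")
proof -
  \<comment> \<open>Half of the contraction pays for the error:
    \<open>(1 + t) * (1 - 2 * t) \<le> 1 - t\<close>, while
    \<open>(1 + 1 / t) * \<mu>\<^sup>2 \<le> 4 * \<mu> / lam\<close> because
    \<open>t \<le> 1\<close>.\<close>
  define t where "t = \<mu> * lam / 2"
  have ml: "\<mu> * lam = 2 * t" by (simp add: t_def)
  have t: "0 < t" "t \<le> 1" using mu lam mu_lam by (auto simp: t_def)
  define c where "c = wavg p (\<lambda>k. dir k (v k) (s k) - s k - (gJ k x + u k x))"
  define a where "a = mean_step x - z"
  have c_le: "(norm c)\<^sup>2 \<le> ?Q"
    unfolding c_def D_def E_def S_def x_def
    by (rule order_trans[OF norm_wavg_sq_le wnorm2_dir_error_le])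
  have "x - \<mu> *\<^sub>R wavg p (\<lambda>k. dir k (v k) (s k)) - z = (a - \<mu> *\<^sub>R wavg p s) + (- \<mu>) *\<^sub>R c"
    unfolding a_def c_def mean_step_def wavg_diff by (simp add: algebra_simps)
  then have "(norm (x - \<mu> *\<^sub>R wavg p (\<lambda>k. dir k (v k) (s k)) - z))\<^sup>2
      \<le> (1 + t) * (norm (a - \<mu> *\<^sub>R wavg p s))\<^sup>2 + (1 + 1 / t) * (norm ((- \<mu>) *\<^sub>R c))\<^sup>2"
    using norm_add_sq_le[OF t(1), of "a - \<mu> *\<^sub>R wavg p s" "(- \<mu>) *\<^sub>R c"] by simp
  also have "(1 + 1 / t) * (norm ((- \<mu>) *\<^sub>R c))\<^sup>2 \<le> 4 * \<mu> / lam * ?Q"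
  proof -
    have "(1 + 1 / t) * (norm ((- \<mu>) *\<^sub>R c))\<^sup>2 = (1 + 1 / t) * \<mu>\<^sup>2 * (norm c)\<^sup>2"
      by (simp add: power_mult_distrib)
    also have "(1 + 1 / t) * \<mu>\<^sup>2 \<le> (2 / t) * \<mu>\<^sup>2"
      using t by (intro mult_right_mono) (simp_all add: field_simps)
    also have "(2 / t) * \<mu>\<^sup>2 = 4 * \<mu> / lam" using mu lam by (simp add: t_def power2_eq_square field_simps)
    also have "4 * \<mu> / lam * (norm c)\<^sup>2 \<le> 4 * \<mu> / lam * ?Q"
      using mu lam by (intro mult_left_mono c_le) simp
    finally show ?thesis by (simp add: mult_right_mono)
  qed
  also have "(1 + t) * (norm (a - \<mu> *\<^sub>R wavg p s))\<^sup>2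
      \<le> (1 - \<mu> * lam / 2) * E - 2 * \<mu> * (1 + \<mu> * lam / 2) * (a \<bullet> wavg p s) + 2 * \<mu>\<^sup>2 * S"
  proof -
    have "(1 + t) * (norm (a - \<mu> *\<^sub>R wavg p s))\<^sup>2
        = (1 + t) * (norm a)\<^sup>2 - 2 * \<mu> * (1 + t) * (a \<bullet> wavg p s) + (1 + t) * (\<mu>\<^sup>2 * (norm (wavg p s))\<^sup>2)"
      unfolding norm_diff_scaleR_sq by (simp add: algebra_simps)
    moreover have "(1 + t) * (norm a)\<^sup>2 \<le> (1 - \<mu> * lam / 2) * E"
    proof -
      have "(1 + t) * (norm a)\<^sup>2 \<le> (1 + t) * ((1 - \<mu> * lam) * E)"
        unfolding a_def E_def using t by (intro mult_left_mono mean_step_contraction) simp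
      also have "\<dots> = (1 - \<mu> * lam / 2 - 2 * t\<^sup>2) * E"
        unfolding ml by (simp add: power2_eq_square algebra_simps)
      also have "\<dots> \<le> (1 - \<mu> * lam / 2) * E"
        unfolding E_def by (intro mult_right_mono) auto
      finally show ?thesis .
    qed
    moreover have "(1 + t) * (\<mu>\<^sup>2 * (norm (wavg p s))\<^sup>2) \<le> 2 * (\<mu>\<^sup>2 * S)"
      unfolding S_def using t by (intro mult_mono mult_left_mono norm_wavg_sq_le) auto
    ultimately show ?thesis unfolding t_def by linarith
  qed
  finally show ?thesis unfolding a_def by simp
qed

end

section \<open>Square integrable iterates\<close>

definition square_integrable :: "'w measure \<Rightarrow> ('w \<Rightarrow> 'a::euclidean_space) \<Rightarrow> bool" where
  "square_integrable M f \<longleftrightarrow> f \<in> borel_measurable M \<and> integrable M (\<lambda>\<omega>. (norm (f \<omega>))\<^sup>2)"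

lemma square_integrableD:
  assumes "square_integrable M f"
  shows "f \<in> borel_measurable M" "integrable M (\<lambda>\<omega>. (norm (f \<omega>))\<^sup>2)"
  using assms by (simp_all add: square_integrable_def)

lemma square_integrable_cong:
  assumes "\<And>\<omega>. \<omega> \<in> space M \<Longrightarrow> f \<omega> = g \<omega>"
  shows "square_integrable M f \<longleftrightarrow> square_integrable M g"
  unfolding square_integrable_def
  using measurable_cong[of M f g borel] Bochner_Integration.integrable_cong[OF refl, of M "\<lambda>\<omega>. (norm (f \<omega>))\<^sup>2" "\<lambda>\<omega>. (norm (g \<omega>))\<^sup>2"] assms
  by auto

lemma square_integrable_bound:
  assumes "g \<in> borel_measurable M" "integrable M h" "\<And>\<omega>. \<omega> \<in> space M \<Longrightarrow> (norm (g \<omega>))\<^sup>2 \<le> h \<omega>"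
  shows "square_integrable M g"
  unfolding square_integrable_def
proof
  show "g \<in> borel_measurable M" by (rule assms)
  show "integrable M (\<lambda>\<omega>. (norm (g \<omega>))\<^sup>2)"
  proof (rule Bochner_Integration.integrable_bound[OF assms(2)])
    show "(\<lambda>\<omega>. (norm (g \<omega>))\<^sup>2) \<in> borel_measurable M" using assms(1) by measurable
    show "AE \<omega> in M. norm ((norm (g \<omega>))\<^sup>2) \<le> norm (h \<omega>)"
    proof (rule AE_I2)
      fix \<omega> assume "\<omega> \<in> space M"
      then have "(norm (g \<omega>))\<^sup>2 \<le> h \<omega>" by (rule assms)
      then show "norm ((norm (g \<omega>))\<^sup>2) \<le> norm (h \<omega>)" by simp
    qed
  qed
qed

lemma square_integrable_add:
  assumes "square_integrable M f" "square_integrable M g"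
  shows "square_integrable M (\<lambda>\<omega>. f \<omega> + g \<omega>)"
proof (rule square_integrable_bound)
  show "(\<lambda>\<omega>. f \<omega> + g \<omega>) \<in> borel_measurable M"
    using assms square_integrableD by (intro borel_measurable_add) auto
  show "integrable M (\<lambda>\<omega>. 2 * (norm (f \<omega>))\<^sup>2 + 2 * (norm (g \<omega>))\<^sup>2)"
    using assms by (simp add: square_integrable_def)
  show "(norm (f \<omega> + g \<omega>))\<^sup>2 \<le> 2 * (norm (f \<omega>))\<^sup>2 + 2 * (norm (g \<omega>))\<^sup>2" for \<omega>
    using norm_add_sq_le[of 1 "f \<omega>" "g \<omega>"] by simp
qed

lemma square_integrable_scaleR:
  assumes "square_integrable M f"
  shows "square_integrable M (\<lambda>\<omega>. c *\<^sub>R f \<omega>)"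
  using square_integrableD[OF assms]
  by (simp add: square_integrable_def power_mult_distrib borel_measurable_scaleR)

lemma square_integrable_diff:
  assumes "square_integrable M f" "square_integrable M g"
  shows "square_integrable M (\<lambda>\<omega>. f \<omega> - g \<omega>)"
  using square_integrable_add[OF assms(1) square_integrable_scaleR[OF assms(2), of "-1"]] by simp

lemma square_integrable_sum:
  assumes "\<And>k. k \<in> S \<Longrightarrow> square_integrable M (f k)"
  shows "square_integrable M (\<lambda>\<omega>. \<Sum>k\<in>S. f k \<omega>)"
  using assms
proof (induction S rule: infinite_finite_induct)
  case (insert x S)
  then show ?case by (simp add: square_integrable_add)
qed (simp_all add: square_integrable_def)

lemma (in finite_measure) square_integrable_const: "square_integrable M (\<lambda>_. x)"
  by (simp add: square_integrable_def)

lemma square_integrable_inner: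
  assumes "square_integrable M f" "square_integrable M g"
  shows "integrable M (\<lambda>\<omega>. f \<omega> \<bullet> g \<omega>)"
proof (rule Bochner_Integration.integrable_bound)
  show "integrable M (\<lambda>\<omega>. (norm (f \<omega>))\<^sup>2 + (norm (g \<omega>))\<^sup>2)"
    using assms by (simp add: square_integrable_def)
  show "(\<lambda>\<omega>. f \<omega> \<bullet> g \<omega>) \<in> borel_measurable M"
    using assms square_integrableD by (intro borel_measurable_inner) auto
  show "AE \<omega> in M. norm (f \<omega> \<bullet> g \<omega>) \<le> norm ((norm (f \<omega>))\<^sup>2 + (norm (g \<omega>))\<^sup>2)"
  proof (rule AE_I2)
    fix \<omega>
    have "\<bar>f \<omega> \<bullet> g \<omega>\<bar> \<le> norm (f \<omega>) * norm (g \<omega>)" by (rule Cauchy_Schwarz_ineq2)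
    moreover have "0 \<le> (norm (f \<omega>) - norm (g \<omega>))\<^sup>2" "0 \<le> (norm (f \<omega>))\<^sup>2" "0 \<le> (norm (g \<omega>))\<^sup>2"
      by simp_all
    ultimately show "norm (f \<omega> \<bullet> g \<omega>) \<le> norm ((norm (f \<omega>))\<^sup>2 + (norm (g \<omega>))\<^sup>2)"
      unfolding power2_diff by simp
  qed
qed

lemma square_integrable_wavg:
  assumes "\<And>k. square_integrable M (f k)"
  shows "square_integrable M (\<lambda>\<omega>. wavg p (\<lambda>k. f k \<omega>))"
  unfolding wavg_def by (intro square_integrable_sum square_integrable_scaleR assms)

lemma square_integrable_mix:
  assumes "\<And>k. square_integrable M (f k)"
  shows "square_integrable M (\<lambda>\<omega>. mix A (\<lambda>k. f k \<omega>) k)"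
  unfolding mix_def by (intro square_integrable_sum square_integrable_scaleR assms)

lemma integrable_wnorm2:
  assumes "\<And>k. square_integrable M (f k)"
  shows "integrable M (\<lambda>\<omega>. wnorm2 p (\<lambda>k. f k \<omega>))"
  unfolding wnorm2_def
  by (intro Bochner_Integration.integrable_sum integrable_mult_right square_integrableD(2) assms)

lemma integrable_lyapunov:
  assumes "\<And>k. square_integrable M (f k)"
  shows "integrable M (\<lambda>\<omega>. lyapunov A p \<theta> n (\<lambda>k. f k \<omega>))"
  unfolding lyapunov_def
  by (intro Bochner_Integration.integrable_sum integrable_divide integrable_wnorm2 square_integrable_mix assms)

text \<open>Common passage from pathwise estimates to moments. Four random terms suffice for every
  use; shorter estimates fill the free slots with coefficient \<open>0\<close>.\<close>

lemma (in prob_space) expectation_le_linear: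
  fixes f g1 g2 g3 g4 :: "'a \<Rightarrow> real"
  assumes "integrable M f" "integrable M g1" "integrable M g2" "integrable M g3" "integrable M g4"
    and "\<And>\<omega>. \<omega> \<in> space M \<Longrightarrow> f \<omega> \<le> a1 * g1 \<omega> + a2 * g2 \<omega> + a3 * g3 \<omega> + a4 * g4 \<omega> + b"
  shows "expectation f \<le> a1 * expectation g1 + a2 * expectation g2 + a3 * expectation g3
    + a4 * expectation g4 + b"
proof -
  have "expectation f \<le> expectation (\<lambda>\<omega>. a1 * g1 \<omega> + a2 * g2 \<omega> + a3 * g3 \<omega> + a4 * g4 \<omega> + b)"
    by (rule integral_mono) (use assms in auto)
  also have "\<dots> = a1 * expectation g1 + a2 * expectation g2 + a3 * expectation g3 + a4 * expectation g4 + b"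
    using assms(2-5) by (simp add: prob_space)
  finally show ?thesis .
qed

section \<open>The sigma-algebra of the past and the moments of the noise\<close>

lemma sets_history:
  "sets (history M w i)
    = sigma_sets (space M) (\<Union>l. \<Union>j\<in>{..i}. {w l j -` B \<inter> space M | B. B \<in> sets borel})"
  unfolding history_def by (rule sets_measure_of) auto

lemma space_history: "space (history M w i) = space M"
  unfolding history_def by (rule space_measure_of) auto

lemma history_measurable:
  assumes "j \<le> i"
  shows "w l j \<in> measurable (history M w i) borel"
proof (rule measurableI)
  fix B assume "B \<in> sets (borel :: 'b measure)"
  then have "w l j -` B \<inter> space M \<in> {w l j -` B \<inter> space M | B. B \<in> sets borel}"
    by (intro CollectI exI[of _ B] conjI refl)
  then have "w l j -` B \<inter> space M \<in> (\<Union>l. \<Union>j\<in>{..i}. {w l j -` B \<inter> space M | B. B \<in> sets borel})"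
    using assms by (intro UN_I[of l] UN_I[of j] UNIV_I) simp_all
  then show "w l j -` B \<inter> space (history M w i) \<in> sets (history M w i)"
    unfolding sets_history space_history by (rule sigma_sets.Basic)
qed simp

lemma subalgebra_history:
  assumes "\<And>l j. j \<le> i \<Longrightarrow> w l j \<in> borel_measurable M"
  shows "subalgebra M (history M w i)"
proof -
  have "sets (history M w i) \<subseteq> sets M"
    unfolding sets_history
  proof (rule sets.sigma_sets_subset, rule subsetI)
    fix a assume "a \<in> (\<Union>l. \<Union>j\<in>{..i}. {w l j -` B \<inter> space M | B. B \<in> sets borel})"
    then obtain l j B where "j \<le> i" "a = w l j -` B \<inter> space M" "B \<in> sets borel"
      by (elim UN_E CollectE exE conjE) simp
    then show "a \<in> sets M" using measurable_sets[OF assms] by simp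
  qed
  then show ?thesis by (simp add: subalgebra_def space_history)
qed

lemma lipschitz_borel_measurable:
  fixes f :: "'a::euclidean_space \<Rightarrow> 'b::euclidean_space"
  assumes "\<And>x y. norm (f x - f y) \<le> L * norm (x - y)"
  shows "f \<in> borel_measurable borel"
proof (rule borel_measurable_continuous_onI)
  have "(max L 0)-lipschitz_on UNIV f"
  proof (rule lipschitz_onI)
    show "dist (f x) (f y) \<le> max L 0 * dist x y" for x y
      unfolding dist_norm by (rule order_trans[OF assms]) (simp add: mult_right_mono)
  qed simp
  then show "continuous_on UNIV f" by (rule lipschitz_on_continuous_on)
qed

text \<open>Here \<open>s k i\<close> is the noise of the update from time \<open>i\<close> to
  \<open>Suc i\<close>, so it is conditioned on the history up to \<open>i\<close>. The single
  constant \<open>K\<close> dominates both constants of the variance bound.\<close>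

locale diffusion_process = diffusion_step p gJ u z \<mu> \<eta> K lam + prob_space M
  for p :: "real^'n" and gJ u :: "'n \<Rightarrow> 'a::euclidean_space \<Rightarrow> 'a" and z \<mu> \<eta> K lam
    and M :: "'w measure" +
  fixes A :: "real^'n^'n" and \<theta> \<rho> C :: real and n :: nat
    and s w :: "'n \<Rightarrow> nat \<Rightarrow> 'w \<Rightarrow> 'a"
  assumes stochastic: "left_stochastic A" and A_p: "A *v p = p"
    and C: "1 \<le> C"
    and lyapunov_lower: "\<And>f :: 'n \<Rightarrow> 'a. wnorm2 p f \<le> lyapunov A p \<theta> n f"
    and lyapunov_mix: "\<And>f g :: 'n \<Rightarrow> 'a. \<lbrakk>wavg p f = 0; wavg p g = 0\<rbrakk> \<Longrightarrow>
      lyapunov A p \<theta> n (mix A (\<lambda>k. f k + g k)) \<le> \<rho> * lyapunov A p \<theta> n f + C * wnorm2 p g"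
    and step: "\<And>k i \<omega>. \<omega> \<in> space M \<Longrightarrow>
      w k (Suc i) \<omega> = mix A (\<lambda>l. w l i \<omega> - \<mu> *\<^sub>R dir l (w l i \<omega>) (s l i \<omega>)) k"
    and w_0: "\<And>k. square_integrable M (w k 0)"
    and s_meas: "\<And>k i. s k i \<in> borel_measurable M"
    and s_mean: "\<And>k i b. b \<in> Basis \<Longrightarrow>
      AE \<omega> in M. real_cond_exp M (history M w i) (\<lambda>\<omega>. s k i \<omega> \<bullet> b) \<omega> = 0"
    and s_var: "\<And>k i. AE \<omega> in M. nn_cond_exp M (history M w i) (\<lambda>\<omega>. ennreal ((norm (s k i \<omega>))\<^sup>2)) \<omega>
      \<le> ennreal (K * (norm (w k i \<omega>))\<^sup>2 + K)"
begin

lemma gJ_measurable: "gJ k \<in> borel_measurable borel"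
  by (rule lipschitz_borel_measurable[OF gJ_lip])

lemma u_measurable: "u k \<in> borel_measurable borel"
  by (rule lipschitz_borel_measurable[OF u_lip])

text \<open>Integrating the nonnegative conditional expectation yields finiteness before any
  integrability of the noise is known. The two hypotheses are explicit because the induction for
  \<open>w_square_integrable\<close> has to supply them.\<close>

lemma noise_moment:
  assumes hist: "subalgebra M (history M w i)" and w: "square_integrable M (w k i)"
  shows "square_integrable M (s k i)"
    and "expectation (\<lambda>\<omega>. (norm (s k i \<omega>))\<^sup>2) \<le> K * expectation (\<lambda>\<omega>. (norm (w k i \<omega>))\<^sup>2) + K"
proof -
  interpret F: finite_measure_subalgebra M "history M w i"
    by unfold_locales (rule hist)
  note [measurable] = s_meas
  have int: "integrable M (\<lambda>\<omega>. K * (norm (w k i \<omega>))\<^sup>2 + K)"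
    using square_integrableD(2)[OF w] by simp
  have "(\<integral>\<^sup>+\<omega>. ennreal ((norm (s k i \<omega>))\<^sup>2) \<partial>M)
      = (\<integral>\<^sup>+\<omega>. nn_cond_exp M (history M w i) (\<lambda>\<omega>. ennreal ((norm (s k i \<omega>))\<^sup>2)) \<omega> \<partial>M)"
    using F.nn_cond_exp_intg[of "\<lambda>_. 1" "\<lambda>\<omega>. ennreal ((norm (s k i \<omega>))\<^sup>2)"] by simp
  also have "\<dots> \<le> (\<integral>\<^sup>+\<omega>. ennreal (K * (norm (w k i \<omega>))\<^sup>2 + K) \<partial>M)"
    by (rule nn_integral_mono_AE[OF s_var])
  also have "\<dots> = ennreal (expectation (\<lambda>\<omega>. K * (norm (w k i \<omega>))\<^sup>2 + K))"
    by (rule nn_integral_eq_integral[OF int]) (use K in auto)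
  finally have le: "(\<integral>\<^sup>+\<omega>. ennreal ((norm (s k i \<omega>))\<^sup>2) \<partial>M)
      \<le> ennreal (expectation (\<lambda>\<omega>. K * (norm (w k i \<omega>))\<^sup>2 + K))" .
  then have "(\<integral>\<^sup>+\<omega>. ennreal ((norm (s k i \<omega>))\<^sup>2) \<partial>M) < \<infinity>"
    using le_less_trans ennreal_less_top by (metis infinity_ennreal_def)
  then have s_int: "integrable M (\<lambda>\<omega>. (norm (s k i \<omega>))\<^sup>2)"
    by (intro integrableI_nonneg) auto
  with s_meas show "square_integrable M (s k i)" by (simp add: square_integrable_def)
  have "ennreal (expectation (\<lambda>\<omega>. (norm (s k i \<omega>))\<^sup>2))
      \<le> ennreal (expectation (\<lambda>\<omega>. K * (norm (w k i \<omega>))\<^sup>2 + K))"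
    using le nn_integral_eq_integral[OF s_int] by simp
  moreover have "0 \<le> expectation (\<lambda>\<omega>. K * (norm (w k i \<omega>))\<^sup>2 + K)"
    using K by (intro integral_nonneg_AE) auto
  ultimately have "expectation (\<lambda>\<omega>. (norm (s k i \<omega>))\<^sup>2) \<le> expectation (\<lambda>\<omega>. K * (norm (w k i \<omega>))\<^sup>2 + K)"
    by (simp add: ennreal_le_iff)
  also have "\<dots> = K * expectation (\<lambda>\<omega>. (norm (w k i \<omega>))\<^sup>2) + K"
    using square_integrableD(2)[OF w] by (simp add: prob_space)
  finally show "expectation (\<lambda>\<omega>. (norm (s k i \<omega>))\<^sup>2) \<le> K * expectation (\<lambda>\<omega>. (norm (w k i \<omega>))\<^sup>2) + K" .
qed

lemma dir_square_integrable:
  assumes w: "square_integrable M (w k i)" and s: "square_integrable M (s k i)"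
  shows "square_integrable M (\<lambda>\<omega>. dir k (w k i \<omega>) (s k i \<omega>))"
proof (rule square_integrable_bound)
  have wm: "w k i \<in> borel_measurable M" by (rule square_integrableD(1)[OF w])
  have gm: "(\<lambda>\<omega>. gJ k (w k i \<omega>)) \<in> borel_measurable M"
    by (rule measurable_compose[OF wm gJ_measurable])
  have "(\<lambda>\<omega>. u k (w k i \<omega> - \<mu> *\<^sub>R (gJ k (w k i \<omega>) + s k i \<omega>))) \<in> borel_measurable M"
    by (rule measurable_compose[OF _ u_measurable])
      (intro borel_measurable_diff borel_measurable_scaleR borel_measurable_add wm gm s_meas borel_measurable_const)
  then show "(\<lambda>\<omega>. dir k (w k i \<omega>) (s k i \<omega>)) \<in> borel_measurable M"
    unfolding dir_def by (intro borel_measurable_add gm s_meas)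
  show "integrable M (\<lambda>\<omega>. 27 * K\<^sup>2 * (1 + \<eta>\<^sup>2 * (norm (w k i \<omega> - z))\<^sup>2 + (norm (s k i \<omega>))\<^sup>2))"
    using square_integrableD(2)[OF s]
      square_integrableD(2)[OF square_integrable_diff[OF w square_integrable_const[of z]]]
    by simp
qed (rule norm_dir_sq_le)

text \<open>Strong induction over time, simultaneously for all agents: the noise bound at time
  \<open>j\<close> needs the history up to \<open>j\<close> to be a subalgebra, hence measurability
  of all earlier iterates.\<close>

lemma w_square_integrable: "square_integrable M (w k i)"
proof (induction i arbitrary: k rule: less_induct)
  case (less i)
  show ?case
  proof (cases i)
    case 0
    then show ?thesis using w_0 by simp
  next
    case (Suc j)
    have wj: "square_integrable M (w l j)" for l by (rule less) (simp add: Suc)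
    have "subalgebra M (history M w j)"
      by (rule subalgebra_history) (rule square_integrableD(1), rule less, simp add: Suc)
    from noise_moment(1)[OF this wj] dir_square_integrable[OF wj]
    have "square_integrable M (\<lambda>\<omega>. dir l (w l j \<omega>) (s l j \<omega>))" for l by blast
    then have "square_integrable M (\<lambda>\<omega>. mix A (\<lambda>l. w l j \<omega> - \<mu> *\<^sub>R dir l (w l j \<omega>) (s l j \<omega>)) k)"
      by (intro square_integrable_mix square_integrable_diff square_integrable_scaleR wj)
    then show ?thesis
      unfolding Suc by (subst square_integrable_cong[OF step])
  qed
qed

lemma history_subalgebra: "subalgebra M (history M w i)"
  by (rule subalgebra_history) (rule square_integrableD(1)[OF w_square_integrable])

lemma s_square_integrable: "square_integrable M (s k i)"
  by (rule noise_moment(1)[OF history_subalgebra w_square_integrable])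

lemma s_second_moment: "expectation (\<lambda>\<omega>. (norm (s k i \<omega>))\<^sup>2) \<le> K * expectation (\<lambda>\<omega>. (norm (w k i \<omega>))\<^sup>2) + K"
  by (rule noise_moment(2)[OF history_subalgebra w_square_integrable])

text \<open>The zero conditional mean is given per coordinate, so the inner product is expanded in
  the basis and each factor known from the past is pulled out of the conditional
  expectation.\<close>

lemma noise_orthogonal:
  assumes f_hist: "f \<in> measurable (history M w i) borel" and f: "square_integrable M f"
  shows "expectation (\<lambda>\<omega>. f \<omega> \<bullet> s k i \<omega>) = 0"
proof -
  interpret F: finite_measure_subalgebra M "history M w i"
    by unfold_locales (rule history_subalgebra)
  note [measurable] = s_meas
  \<comment> \<open>Coordinates are represented as vectors along \<open>b\<close>, so that
    \<open>square_integrable_inner\<close> yields integrability of the products of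
    coordinates.\<close>
  have comp: "square_integrable M (\<lambda>\<omega>. (g \<omega> \<bullet> b) *\<^sub>R b)" if "square_integrable M g" "b \<in> Basis"
    for g :: "'w \<Rightarrow> 'a" and b
  proof (rule square_integrable_bound[OF _ square_integrableD(2)[OF that(1)]])
    show "(\<lambda>\<omega>. (g \<omega> \<bullet> b) *\<^sub>R b) \<in> borel_measurable M"
      using square_integrableD(1)[OF that(1)] by measurable
    fix \<omega>
    have "\<bar>g \<omega> \<bullet> b\<bar> \<le> norm (g \<omega>)" using that(2) by (rule Basis_le_norm)
    then show "(norm ((g \<omega> \<bullet> b) *\<^sub>R b))\<^sup>2 \<le> (norm (g \<omega>))\<^sup>2"
      using that(2) by (intro power_mono) simp_all
  qed
  have int: "integrable M (\<lambda>\<omega>. (f \<omega> \<bullet> b) * (s k i \<omega> \<bullet> b))" if "b \<in> Basis" for b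
    using square_integrable_inner[OF comp[OF f that] comp[OF s_square_integrable that]] that
    by (simp add: mult.commute)
  have zero: "expectation (\<lambda>\<omega>. (f \<omega> \<bullet> b) * (s k i \<omega> \<bullet> b)) = 0" if b: "b \<in> Basis" for b
  proof -
    have "expectation (\<lambda>\<omega>. (f \<omega> \<bullet> b) * (s k i \<omega> \<bullet> b))
        = expectation (\<lambda>\<omega>. (f \<omega> \<bullet> b) * real_cond_exp M (history M w i) (\<lambda>\<omega>. s k i \<omega> \<bullet> b) \<omega>)"
      by (rule F.real_cond_exp_intg(2)[OF int[OF b], symmetric])
        (intro borel_measurable_inner f_hist s_meas borel_measurable_const)+
    also have "\<dots> = expectation (\<lambda>\<omega>. 0)"
    proof (rule integral_cong_AE)
      show "AE \<omega> in M. (f \<omega> \<bullet> b) * real_cond_exp M (history M w i) (\<lambda>\<omega>. s k i \<omega> \<bullet> b) \<omega> = 0"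
        using s_mean[OF b, of i k] by eventually_elim simp
      show "(\<lambda>\<omega>. (f \<omega> \<bullet> b) * real_cond_exp M (history M w i) (\<lambda>\<omega>. s k i \<omega> \<bullet> b) \<omega>) \<in> borel_measurable M"
        by (intro borel_measurable_times borel_measurable_inner square_integrableD(1)[OF f]
            borel_measurable_const borel_measurable_cond_exp2)
    qed simp
    finally show ?thesis by simp
  qed
  have "expectation (\<lambda>\<omega>. f \<omega> \<bullet> s k i \<omega>) = expectation (\<lambda>\<omega>. \<Sum>b\<in>Basis. (f \<omega> \<bullet> b) * (s k i \<omega> \<bullet> b))"
    by (subst euclidean_inner) (rule refl)
  also have "\<dots> = (\<Sum>b\<in>Basis. expectation (\<lambda>\<omega>. (f \<omega> \<bullet> b) * (s k i \<omega> \<bullet> b)))"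
    by (rule Bochner_Integration.integral_sum) (rule int)
  also have "\<dots> = 0" by (simp add: zero)
  finally show ?thesis .
qed

end

section \<open>Mean-square error recursion\<close>

text \<open>The summands of \<open>c\<close> record their sources: \<open>8 * K ^ 3\<close> the
  outer noise, \<open>160 = 96 + 64\<close> the inner error and the disagreement in the average, and
  \<open>162 = 27 * 6\<close> the increments in the Lyapunov part.\<close>

lemma drift_combine:
  fixes X Y D S X' Y' \<mu> \<eta> K lam \<rho> C :: real
  defines "c \<equiv> 8 * K ^ 3 + 160 * K ^ 5 / lam + 162 * C * K ^ 5"
  assumes nn: "0 \<le> X" "0 \<le> Y" "D \<le> Y"
    and S: "S \<le> 4 * K ^ 3 * (1 + X + Y)"
    and par: "1 \<le> K" "1 \<le> C" "0 < lam" "0 < \<mu>" "1 \<le> \<eta>" "\<mu> * \<eta>\<^sup>2 \<le> 1"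
    and small: "8 * c * (\<mu> * \<eta>\<^sup>2) \<le> lam" "3 * c * (\<mu> * \<eta>\<^sup>2) + lam / 4 * (\<mu> * \<eta>\<^sup>2) \<le> 1 - \<rho>"
    and X': "X' \<le> (1 - \<mu> * lam / 2) * X + 2 * \<mu>\<^sup>2 * S
      + 4 * \<mu> / lam * (16 * K\<^sup>2 * \<eta>\<^sup>2 * D + 4 * \<mu>\<^sup>2 * \<eta>\<^sup>2 * K\<^sup>2 * (1 + 2 * D + 2 * X + S))"
    and Y': "Y' \<le> \<rho> * Y + C * (\<mu>\<^sup>2 * (27 * K\<^sup>2 * (1 + \<eta>\<^sup>2 * (2 * D + 2 * X) + S)))"
  shows "X' + Y' \<le> (1 - \<mu> * lam / 4) * (X + Y) + 2 * c * \<mu>\<^sup>2"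
proof -
  define \<nu> where "\<nu> = \<mu> * \<eta>\<^sup>2"
  define T where "T = 1 + X + Y"
  have T: "1 \<le> T" using nn by (simp add: T_def)
  have \<nu>: "0 < \<nu>" "\<nu> \<le> 1" using par by (auto simp: \<nu>_def)
  have "\<mu> * 1 \<le> \<mu> * \<eta>\<^sup>2" using par by (intro mult_left_mono) simp_all
  then have \<mu>\<nu>: "\<mu> \<le> \<nu>" by (simp add: \<nu>_def)
  have K3: "1 \<le> K ^ 3" and K25: "K\<^sup>2 \<le> K ^ 5" and K2: "0 \<le> K\<^sup>2" and K5: "0 \<le> K ^ 5"
    using par(1) by (auto intro: power_increasing)
  have S': "S \<le> 4 * K ^ 3 * T" using S by (simp add: T_def add.assoc)
  have t1: "2 * \<mu>\<^sup>2 * S \<le> 8 * K ^ 3 * (\<mu>\<^sup>2 * T)"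
  proof -
    have "2 * \<mu>\<^sup>2 * S \<le> 2 * \<mu>\<^sup>2 * (4 * K ^ 3 * T)" using S' by (intro mult_left_mono) simp_all
    then show ?thesis by (simp add: mult_ac)
  qed
  have t2: "4 * \<mu> / lam * (16 * K\<^sup>2 * \<eta>\<^sup>2 * D) \<le> 64 * K ^ 5 / lam * (\<nu> * Y)"
  proof -
    have "4 * \<mu> / lam * (16 * K\<^sup>2 * \<eta>\<^sup>2 * D) = 64 * K\<^sup>2 / lam * (\<nu> * D)"
      by (simp add: \<nu>_def)
    also have "\<dots> \<le> 64 * K\<^sup>2 / lam * (\<nu> * Y)"
      using nn \<nu> par K2 by (intro mult_left_mono) simp_all
    also have "\<dots> \<le> 64 * K ^ 5 / lam * (\<nu> * Y)"
      using nn \<nu> par K25 by (intro mult_right_mono divide_right_mono) simp_all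
    finally show ?thesis .
  qed
  have t3: "4 * \<mu> / lam * (4 * \<mu>\<^sup>2 * \<eta>\<^sup>2 * K\<^sup>2 * (1 + 2 * D + 2 * X + S)) \<le> 96 * K ^ 5 / lam * (\<mu>\<^sup>2 * T)"
  proof -
    have "1 + 2 * D + 2 * X \<le> 2 * T" using nn by (simp add: T_def)
    also have "2 * T \<le> 2 * (K ^ 3 * T)" using K3 T by simp
    finally have "1 + 2 * D + 2 * X + S \<le> 6 * (K ^ 3 * T)" using S' by simp
    then have "16 * K\<^sup>2 / lam * \<mu>\<^sup>2 * \<nu> * (1 + 2 * D + 2 * X + S) \<le> 16 * K\<^sup>2 / lam * \<mu>\<^sup>2 * \<nu> * (6 * (K ^ 3 * T))"
      using par \<nu> by (intro mult_left_mono) simp_all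
    also have "\<dots> = 96 * K ^ 5 / lam * (\<mu>\<^sup>2 * T) * \<nu>"
      by (simp add: power2_eq_square eval_nat_numeral)
    also have "\<dots> \<le> 96 * K ^ 5 / lam * (\<mu>\<^sup>2 * T) * 1"
      using par \<nu> T K5 by (intro mult_left_mono) simp_all
    finally show ?thesis by (simp add: \<nu>_def power2_eq_square mult_ac)
  qed
  have X'': "X' \<le> (1 - \<mu> * lam / 2) * X + (8 * K ^ 3 + 96 * K ^ 5 / lam) * (\<mu>\<^sup>2 * T) + 64 * K ^ 5 / lam * (\<nu> * Y)"
    using X' t1 t2 t3 unfolding distrib_left distrib_right by linarith
  have nonneg: "0 \<le> K ^ 3" "0 \<le> K ^ 5 / lam" "0 \<le> C * K ^ 5"
    using K3 K5 par by simp_all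
  have c_ge: "8 * K ^ 3 + 96 * K ^ 5 / lam \<le> c" "64 * K ^ 5 / lam \<le> c" "162 * C * K ^ 5 \<le> c" "0 \<le> c"
    using nonneg unfolding c_def times_divide_eq_right[symmetric] mult.assoc by - linarith+
  have "(8 * K ^ 3 + 96 * K ^ 5 / lam) * (\<mu>\<^sup>2 * T) \<le> c * (\<mu>\<^sup>2 * T)"
    using T by (intro mult_right_mono c_ge) simp
  moreover have "64 * K ^ 5 / lam * (\<nu> * Y) \<le> c * (\<nu> * Y)"
    using nn \<nu> by (intro mult_right_mono c_ge) simp
  ultimately have Xc: "X' \<le> (1 - \<mu> * lam / 2) * X + c * (\<mu>\<^sup>2 * T) + c * (\<nu> * Y)"
    using X'' by linarith
  have \<mu>2: "\<mu>\<^sup>2 \<le> \<mu> * \<nu>" using par \<mu>\<nu> by (simp add: power2_eq_square)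
  have Yc: "Y' \<le> \<rho> * Y + c * \<mu>\<^sup>2 + c * (\<mu> * \<nu> * (X + Y))"
  proof -
    have "\<mu>\<^sup>2 * (1 + \<eta>\<^sup>2 * (2 * D + 2 * X) + S) = \<mu>\<^sup>2 + 2 * (\<mu> * \<nu> * (D + X)) + \<mu>\<^sup>2 * S"
      by (simp add: \<nu>_def power2_eq_square algebra_simps)
    also have "\<dots> \<le> \<mu>\<^sup>2 + 2 * (\<mu> * \<nu> * (X + Y)) + (4 * K ^ 3 * \<mu>\<^sup>2 + 4 * K ^ 3 * (\<mu> * \<nu> * (X + Y)))"
    proof (intro add_mono order_refl)
      show "2 * (\<mu> * \<nu> * (D + X)) \<le> 2 * (\<mu> * \<nu> * (X + Y))"
        using par \<nu> nn by (intro mult_left_mono) simp_all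
      have "\<mu>\<^sup>2 * S \<le> \<mu>\<^sup>2 * (4 * K ^ 3 * T)" using S' by (intro mult_left_mono) simp_all
      also have "\<dots> = 4 * K ^ 3 * \<mu>\<^sup>2 + 4 * K ^ 3 * (\<mu>\<^sup>2 * (X + Y))"
        by (simp add: T_def algebra_simps)
      also have "\<dots> \<le> 4 * K ^ 3 * \<mu>\<^sup>2 + 4 * K ^ 3 * (\<mu> * \<nu> * (X + Y))"
        using par(1) nn by (intro add_left_mono mult_left_mono mult_right_mono \<mu>2) simp_all
      finally show "\<mu>\<^sup>2 * S \<le> 4 * K ^ 3 * \<mu>\<^sup>2 + 4 * K ^ 3 * (\<mu> * \<nu> * (X + Y))" .
    qed
    also have "\<dots> \<le> 6 * K ^ 3 * (\<mu>\<^sup>2 + \<mu> * \<nu> * (X + Y))"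
    proof -
      have "1 * \<mu>\<^sup>2 \<le> K ^ 3 * \<mu>\<^sup>2" "1 * (\<mu> * \<nu> * (X + Y)) \<le> K ^ 3 * (\<mu> * \<nu> * (X + Y))"
        using K3 par \<nu> nn by (intro mult_right_mono; simp)+
      moreover have "0 \<le> \<mu>\<^sup>2" by simp
      ultimately show ?thesis unfolding distrib_left by linarith
    qed
    finally have "C * (27 * K\<^sup>2) * (\<mu>\<^sup>2 * (1 + \<eta>\<^sup>2 * (2 * D + 2 * X) + S))
        \<le> C * (27 * K\<^sup>2) * (6 * K ^ 3 * (\<mu>\<^sup>2 + \<mu> * \<nu> * (X + Y)))"
      using par by (intro mult_left_mono) simp_all
    also have "\<dots> = 162 * C * K ^ 5 * (\<mu>\<^sup>2 + \<mu> * \<nu> * (X + Y))"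
      by (simp add: power2_eq_square eval_nat_numeral)
    also have "\<dots> \<le> c * (\<mu>\<^sup>2 + \<mu> * \<nu> * (X + Y))"
      using par nn \<nu> by (intro mult_right_mono c_ge) simp
    finally have "C * (\<mu>\<^sup>2 * (27 * K\<^sup>2 * (1 + \<eta>\<^sup>2 * (2 * D + 2 * X) + S))) \<le> c * (\<mu>\<^sup>2 + \<mu> * \<nu> * (X + Y))"
      by (simp add: mult_ac)
    then show ?thesis using Y' by (simp add: distrib_left)
  qed
  have small': "8 * c * \<nu> \<le> lam" "3 * c * \<nu> + lam / 4 * \<nu> \<le> 1 - \<rho>"
    using small by (simp_all only: \<nu>_def)
  have cm: "c * \<mu>\<^sup>2 \<le> c * (\<mu> * \<nu>)" by (rule mult_left_mono[OF \<mu>2 c_ge(4)])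
  \<comment> \<open>The first smallness condition keeps the feedback on \<open>X\<close> within half
    of its gap \<open>\<mu> * lam / 2\<close>. The second keeps the feedback on \<open>Y\<close>, at
    most \<open>3 * c * \<nu>\<close>, within \<open>1 - \<rho>\<close> and still leaves room for
    the common rate.\<close>
  have "\<mu> * (8 * c * \<nu>) \<le> \<mu> * lam" using small'(1) par by (intro mult_left_mono) simp_all
  then have cX: "c * \<mu>\<^sup>2 + c * (\<mu> * \<nu>) \<le> \<mu> * lam / 4" using cm by (simp add: mult_ac)
  have "\<mu> * \<nu> \<le> 1 * \<nu>" using \<mu>\<nu> \<nu> by (intro mult_right_mono) simp_all
  then have "c * (\<mu> * \<nu>) \<le> c * \<nu>" using c_ge(4) by (intro mult_left_mono) simp_all
  moreover have "\<mu> * lam / 4 \<le> lam / 4 * \<nu>" using \<mu>\<nu> par by simp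
  ultimately have cY: "\<rho> + c * \<mu>\<^sup>2 + c * \<nu> + c * (\<mu> * \<nu>) \<le> 1 - \<mu> * lam / 4"
    using small'(2) cm by linarith
  have "X' + Y' \<le> (1 - \<mu> * lam / 2) * X + c * (\<mu>\<^sup>2 * T) + c * (\<nu> * Y) + (\<rho> * Y + c * \<mu>\<^sup>2 + c * (\<mu> * \<nu> * (X + Y)))"
    by (rule order_trans[OF add_mono[OF Xc Yc]]) simp
  also have "\<dots> = (1 - \<mu> * lam / 2 + (c * \<mu>\<^sup>2 + c * (\<mu> * \<nu>))) * X
      + (\<rho> + c * \<mu>\<^sup>2 + c * \<nu> + c * (\<mu> * \<nu>)) * Y + 2 * c * \<mu>\<^sup>2"
    by (simp add: T_def algebra_simps)
  also have "\<dots> \<le> (1 - \<mu> * lam / 4) * X + (1 - \<mu> * lam / 4) * Y + 2 * c * \<mu>\<^sup>2"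
    using nn cX by (intro add_mono mult_right_mono cY order_refl) simp_all
  finally show ?thesis by (simp add: distrib_left)
qed

text \<open>The distance to the fixed point \<open>b / a\<close> of the affine map contracts by
  \<open>1 - a\<close>.\<close>

lemma linear_recursion_bound:
  fixes Z :: "nat \<Rightarrow> real"
  assumes "0 < a" "a \<le> 1" and Z: "\<And>i. Z (Suc i) \<le> (1 - a) * Z i + b"
  shows "Z i \<le> (1 - a) ^ i * (Z 0 - b / a) + b / a"
proof (induction i)
  case (Suc i)
  have "Z (Suc i) \<le> (1 - a) * Z i + b" by (rule Z)
  also have "\<dots> \<le> (1 - a) * ((1 - a) ^ i * (Z 0 - b / a) + b / a) + b"
    using assms by (intro add_right_mono mult_left_mono Suc.IH) simp
  also have "\<dots> = (1 - a) ^ Suc i * (Z 0 - b / a) + b / a"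
    using \<open>0 < a\<close> by (simp add: field_simps)
  finally show ?case .
qed simp

context diffusion_process
begin

definition avg :: "nat \<Rightarrow> 'w \<Rightarrow> 'a" where
  "avg i \<omega> = wavg p (\<lambda>k. w k i \<omega>)"

definition msd :: "nat \<Rightarrow> real" where
  "msd i = expectation (\<lambda>\<omega>. (norm (avg i \<omega> - z))\<^sup>2)"

definition disagreement :: "nat \<Rightarrow> real" where
  "disagreement i = expectation (\<lambda>\<omega>. wnorm2 p (\<lambda>k. w k i \<omega> - avg i \<omega>))"

definition lyap :: "nat \<Rightarrow> real" where
  "lyap i = expectation (\<lambda>\<omega>. lyapunov A p \<theta> n (\<lambda>k. w k i \<omega> - avg i \<omega>))"

definition noise_power :: "nat \<Rightarrow> real" where
  "noise_power i = expectation (\<lambda>\<omega>. wnorm2 p (\<lambda>k. s k i \<omega>))"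

lemma avg_square_integrable: "square_integrable M (avg i)"
  using square_integrable_wavg[OF w_square_integrable, where p = p] by (simp add: avg_def[abs_def])

lemma centered_square_integrable: "square_integrable M (\<lambda>\<omega>. w k i \<omega> - avg i \<omega>)"
  by (rule square_integrable_diff[OF w_square_integrable avg_square_integrable])

lemma integrable_terms:
  shows "integrable M (\<lambda>\<omega>. (norm (avg i \<omega> - z))\<^sup>2)"
    and "integrable M (\<lambda>\<omega>. wnorm2 p (\<lambda>k. w k i \<omega> - avg i \<omega>))"
    and "integrable M (\<lambda>\<omega>. lyapunov A p \<theta> n (\<lambda>k. w k i \<omega> - avg i \<omega>))"
    and "integrable M (\<lambda>\<omega>. wnorm2 p (\<lambda>k. s k i \<omega>))"
  by (rule square_integrableD(2)[OF square_integrable_diff[OF avg_square_integrable square_integrable_const]]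
      integrable_wnorm2 integrable_lyapunov centered_square_integrable s_square_integrable)+

lemma moments_nonneg: "0 \<le> msd i" "0 \<le> disagreement i" "disagreement i \<le> lyap i" "0 \<le> lyap i"
proof -
  show "0 \<le> msd i" unfolding msd_def by (rule integral_nonneg_AE) simp
  show 1: "0 \<le> disagreement i"
    unfolding disagreement_def by (rule integral_nonneg_AE) (simp add: wnorm2_nonneg)
  show 2: "disagreement i \<le> lyap i"
    unfolding disagreement_def lyap_def by (rule integral_mono[OF integrable_terms(2,3) lyapunov_lower])
  show "0 \<le> lyap i" using 1 2 by linarith
qed

lemma avg_step:
  assumes "\<omega> \<in> space M"
  shows "avg (Suc i) \<omega> = avg i \<omega> - \<mu> *\<^sub>R wavg p (\<lambda>k. dir k (w k i \<omega>) (s k i \<omega>))"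
proof -
  have "avg (Suc i) \<omega> = wavg p (mix A (\<lambda>l. w l i \<omega> - \<mu> *\<^sub>R dir l (w l i \<omega>) (s l i \<omega>)))"
    unfolding avg_def using step[OF assms] by simp
  also have "\<dots> = wavg p (\<lambda>l. w l i \<omega> - \<mu> *\<^sub>R dir l (w l i \<omega>) (s l i \<omega>))"
    unfolding wavg_def by (rule sum_perron_mix[OF A_p])
  finally show ?thesis by (simp add: wavg_diff wavg_scaleR avg_def)
qed

text \<open>The noise variance grows with the iterates themselves, so each iterate is split into its
  deviation from the average, the error of the average, and \<open>z\<close>. Two quadratic
  splittings give the factor \<open>4\<close>, and \<open>norm z \<le> K\<close> raises the power of
  \<open>K\<close> to three.\<close>

lemma noise_power_le: "noise_power i \<le> 4 * K ^ 3 * (1 + msd i + lyap i)"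
proof -
  have "noise_power i = (\<Sum>k\<in>UNIV. p $ k * expectation (\<lambda>\<omega>. (norm (s k i \<omega>))\<^sup>2))"
    unfolding noise_power_def wnorm2_def using square_integrableD(2)[OF s_square_integrable] by simp
  also have "\<dots> \<le> (\<Sum>k\<in>UNIV. p $ k * (K * expectation (\<lambda>\<omega>. (norm (w k i \<omega>))\<^sup>2) + K))"
    by (intro sum_mono mult_left_mono s_second_moment p_nonneg)
  also have "\<dots> = K * (\<Sum>k\<in>UNIV. p $ k * expectation (\<lambda>\<omega>. (norm (w k i \<omega>))\<^sup>2)) + K * (\<Sum>k\<in>UNIV. p $ k)"
    by (simp add: sum_distrib_left sum.distrib distrib_left mult_ac)
  also have "(\<Sum>k\<in>UNIV. p $ k * expectation (\<lambda>\<omega>. (norm (w k i \<omega>))\<^sup>2)) = expectation (\<lambda>\<omega>. wnorm2 p (\<lambda>k. w k i \<omega>))"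
    unfolding wnorm2_def using square_integrableD(2)[OF w_square_integrable] by simp
  finally have *: "noise_power i \<le> K * expectation (\<lambda>\<omega>. wnorm2 p (\<lambda>k. w k i \<omega>)) + K"
    by (simp add: p_sum)
  have "expectation (\<lambda>\<omega>. wnorm2 p (\<lambda>k. w k i \<omega>)) \<le> 4 * disagreement i + 4 * msd i + 0 * msd i + 0 * msd i + 2 * (norm z)\<^sup>2"
    unfolding disagreement_def msd_def
  proof (rule expectation_le_linear[OF integrable_wnorm2[OF w_square_integrable] integrable_terms(2,1,1,1)])
    fix \<omega>
    have "wnorm2 p (\<lambda>k. w k i \<omega> - 0) \<le> 2 * wnorm2 p (\<lambda>k. w k i \<omega> - z) + 2 * (norm (z - 0))\<^sup>2"
      by (rule wnorm2_shift_le)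
    moreover have "wnorm2 p (\<lambda>k. w k i \<omega> - z) \<le> 2 * wnorm2 p (\<lambda>k. w k i \<omega> - avg i \<omega>) + 2 * (norm (avg i \<omega> - z))\<^sup>2"
      by (rule wnorm2_shift_le)
    ultimately show "wnorm2 p (\<lambda>k. w k i \<omega>) \<le> 4 * wnorm2 p (\<lambda>k. w k i \<omega> - avg i \<omega>)
        + 4 * (norm (avg i \<omega> - z))\<^sup>2 + 0 * (norm (avg i \<omega> - z))\<^sup>2 + 0 * (norm (avg i \<omega> - z))\<^sup>2 + 2 * (norm z)\<^sup>2"
      by simp
  qed
  also have "\<dots> \<le> 4 * (msd i + lyap i) + 2 * K\<^sup>2"
    using moments_nonneg(3)[of i] power_mono[OF z_bound norm_ge_zero, of 2] by simp
  finally have "K * expectation (\<lambda>\<omega>. wnorm2 p (\<lambda>k. w k i \<omega>)) \<le> K * (4 * (msd i + lyap i) + 2 * K\<^sup>2)"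
    using K by (intro mult_left_mono) simp_all
  with * have "noise_power i \<le> 4 * (K * (msd i + lyap i)) + 2 * K ^ 3 + K"
    by (simp add: algebra_simps power2_eq_square eval_nat_numeral)
  moreover have "K \<le> K ^ 3" using K power_increasing[of 1 3 K] by simp
  moreover have "K * (msd i + lyap i) \<le> K ^ 3 * (msd i + lyap i)"
    using moments_nonneg(1,4)[of i] \<open>K \<le> K ^ 3\<close> by (intro mult_right_mono) simp_all
  moreover have "0 \<le> K ^ 3" using K by simp
  ultimately have "noise_power i \<le> 4 * K ^ 3 + 4 * (K ^ 3 * (msd i + lyap i))" by linarith
  then show ?thesis by (simp add: algebra_simps)
qed

lemma mean_step_lipschitz: "norm (mean_step x - mean_step y) \<le> (1 + \<mu> * (K + \<eta>)) * norm (x - y)"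
proof -
  let ?g = "wavg p (\<lambda>k. gJ k x + u k x) - wavg p (\<lambda>k. gJ k y + u k y)"
  have "mean_step x - mean_step y = (x - y) - \<mu> *\<^sub>R ?g"
    by (simp add: mean_step_def scaleR_diff_right)
  then have "norm (mean_step x - mean_step y) \<le> norm (x - y) + norm (\<mu> *\<^sub>R ?g)"
    using norm_triangle_ineq4[of "x - y" "\<mu> *\<^sub>R ?g"] by simp
  also have "norm (\<mu> *\<^sub>R ?g) \<le> \<mu> * ((K + \<eta>) * norm (x - y))"
    using mu mean_gradient_lipschitz by simp
  finally show ?thesis by (simp add: distrib_right mult.assoc)
qed

lemma mean_step_square_integrable: "square_integrable M (\<lambda>\<omega>. mean_step (avg i \<omega>) - z)"
proof (rule square_integrable_bound[OF _ integrable_terms(1)[of i]])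
  have "mean_step \<in> borel_measurable borel" by (rule lipschitz_borel_measurable[OF mean_step_lipschitz])
  then show "(\<lambda>\<omega>. mean_step (avg i \<omega>) - z) \<in> borel_measurable M"
    by (rule borel_measurable_diff[OF
          measurable_compose[OF square_integrableD(1)[OF avg_square_integrable]] borel_measurable_const])
  fix \<omega>
  have "(norm (mean_step (avg i \<omega>) - z))\<^sup>2 \<le> (1 - \<mu> * lam) * (norm (avg i \<omega> - z))\<^sup>2"
    by (rule mean_step_contraction)
  also have "\<dots> \<le> 1 * (norm (avg i \<omega> - z))\<^sup>2"
    using mu lam by (intro mult_right_mono) simp_all
  finally show "(norm (mean_step (avg i \<omega>) - z))\<^sup>2 \<le> (norm (avg i \<omega> - z))\<^sup>2" by simp
qed

text \<open>The averaged iterate after a noise-free step depends only on the past, so the outer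
  noise is orthogonal to it.\<close>

lemma mean_noise_orthogonal:
  "expectation (\<lambda>\<omega>. (mean_step (avg i \<omega>) - z) \<bullet> wavg p (\<lambda>k. s k i \<omega>)) = 0"
proof -
  have m: "mean_step \<in> borel_measurable borel" by (rule lipschitz_borel_measurable[OF mean_step_lipschitz])
  have "avg i \<in> borel_measurable (history M w i)"
    unfolding avg_def[abs_def] wavg_def
    by (intro borel_measurable_sum borel_measurable_scaleR borel_measurable_const history_measurable order_refl)
  from measurable_compose[OF this m]
  have meas: "(\<lambda>\<omega>. mean_step (avg i \<omega>) - z) \<in> borel_measurable (history M w i)"
    by (rule borel_measurable_diff[OF _ borel_measurable_const])
  have "expectation (\<lambda>\<omega>. (mean_step (avg i \<omega>) - z) \<bullet> wavg p (\<lambda>k. s k i \<omega>))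
      = expectation (\<lambda>\<omega>. \<Sum>k\<in>UNIV. p $ k * ((mean_step (avg i \<omega>) - z) \<bullet> s k i \<omega>))"
    by (simp add: wavg_def inner_sum_right)
  also have "\<dots> = (\<Sum>k\<in>UNIV. expectation (\<lambda>\<omega>. p $ k * ((mean_step (avg i \<omega>) - z) \<bullet> s k i \<omega>)))"
    by (intro Bochner_Integration.integral_sum integrable_mult_right square_integrable_inner
        mean_step_square_integrable s_square_integrable)
  also have "\<dots> = 0"
    by (simp add: noise_orthogonal[OF meas mean_step_square_integrable])
  finally show ?thesis .
qed

lemma msd_drift:
  "msd (Suc i) \<le> (1 - \<mu> * lam / 2) * msd i + 2 * \<mu>\<^sup>2 * noise_power i
    + 4 * \<mu> / lam * (16 * K\<^sup>2 * \<eta>\<^sup>2 * disagreement i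
      + 4 * \<mu>\<^sup>2 * \<eta>\<^sup>2 * K\<^sup>2 * (1 + 2 * disagreement i + 2 * msd i + noise_power i))"
proof -
  let ?c = "4 * \<mu> / lam" and ?a = "16 * K\<^sup>2 * \<eta>\<^sup>2" and ?b = "4 * \<mu>\<^sup>2 * \<eta>\<^sup>2 * K\<^sup>2"
  let ?E = "\<lambda>\<omega>. (norm (avg i \<omega> - z))\<^sup>2" and ?S = "\<lambda>\<omega>. wnorm2 p (\<lambda>k. s k i \<omega>)"
    and ?D = "\<lambda>\<omega>. wnorm2 p (\<lambda>k. w k i \<omega> - avg i \<omega>)"
    and ?I = "\<lambda>\<omega>. (mean_step (avg i \<omega>) - z) \<bullet> wavg p (\<lambda>k. s k i \<omega>)"
  have int_I: "integrable M ?I"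
    by (intro square_integrable_inner mean_step_square_integrable square_integrable_wavg s_square_integrable)
  have "msd (Suc i) \<le> (1 - \<mu> * lam / 2 + ?c * ?b * 2) * expectation ?E
      + (- (2 * \<mu> * (1 + \<mu> * lam / 2))) * expectation ?I
      + (2 * \<mu>\<^sup>2 + ?c * ?b) * expectation ?S + (?c * ?a + ?c * ?b * 2) * expectation ?D + ?c * ?b"
    unfolding msd_def
  proof (rule expectation_le_linear[OF integrable_terms(1) integrable_terms(1) int_I integrable_terms(4,2)])
    fix \<omega> assume \<omega>: "\<omega> \<in> space M"
    have "(norm (avg (Suc i) \<omega> - z))\<^sup>2 \<le> (1 - \<mu> * lam / 2) * ?E \<omega> - 2 * \<mu> * (1 + \<mu> * lam / 2) * ?I \<omega>
        + 2 * \<mu>\<^sup>2 * ?S \<omega> + ?c * (?a * ?D \<omega> + ?b * (1 + 2 * ?D \<omega> + 2 * ?E \<omega> + ?S \<omega>))"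
      unfolding avg_step[OF \<omega>] unfolding avg_def by (rule centroid_drift)
    also have "\<dots> = (1 - \<mu> * lam / 2 + ?c * ?b * 2) * ?E \<omega>
        + (- (2 * \<mu> * (1 + \<mu> * lam / 2))) * ?I \<omega>
        + (2 * \<mu>\<^sup>2 + ?c * ?b) * ?S \<omega> + (?c * ?a + ?c * ?b * 2) * ?D \<omega> + ?c * ?b"
      by (simp only: distrib_left distrib_right mult_minus_left mult.assoc diff_conv_add_uminus mult_1_right mult_1_left mult.left_commute add_ac)
    finally show "(norm (avg (Suc i) \<omega> - z))\<^sup>2 \<le> (1 - \<mu> * lam / 2 + ?c * ?b * 2) * ?E \<omega>
        + (- (2 * \<mu> * (1 + \<mu> * lam / 2))) * ?I \<omega>
        + (2 * \<mu>\<^sup>2 + ?c * ?b) * ?S \<omega> + (?c * ?a + ?c * ?b * 2) * ?D \<omega> + ?c * ?b" .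
  qed
  also have "\<dots> = (1 - \<mu> * lam / 2) * msd i + 2 * \<mu>\<^sup>2 * noise_power i
    + ?c * (?a * disagreement i + ?b * (1 + 2 * disagreement i + 2 * msd i + noise_power i))"
    unfolding mean_noise_orthogonal msd_def[symmetric] noise_power_def[symmetric] disagreement_def[symmetric]
    by (simp only: distrib_left distrib_right mult_zero_right add_0_right mult.assoc mult_1_right mult_1_left mult.left_commute add_ac)
  finally show ?thesis .
qed

text \<open>The new deviations are the mixture of the old ones and of the centered increments
  \<open>h\<close>; both have average zero, as \<open>lyapunov_mix\<close> requires. A second-moment
  bound on the increments suffices, since they already carry \<open>\<mu>\<^sup>2\<close>.\<close>

lemma lyap_drift:
  "lyap (Suc i) \<le> \<rho> * lyap i
    + C * (\<mu>\<^sup>2 * (27 * K\<^sup>2 * (1 + \<eta>\<^sup>2 * (2 * disagreement i + 2 * msd i) + noise_power i)))"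
proof -
  let ?c = "C * (\<mu>\<^sup>2 * (27 * K\<^sup>2))"
  let ?E = "\<lambda>\<omega>. (norm (avg i \<omega> - z))\<^sup>2" and ?S = "\<lambda>\<omega>. wnorm2 p (\<lambda>k. s k i \<omega>)"
    and ?D = "\<lambda>\<omega>. wnorm2 p (\<lambda>k. w k i \<omega> - avg i \<omega>)"
    and ?V = "\<lambda>\<omega>. lyapunov A p \<theta> n (\<lambda>k. w k i \<omega> - avg i \<omega>)"
  have "lyap (Suc i) \<le> \<rho> * expectation ?V + (?c * \<eta>\<^sup>2 * 2) * expectation ?D
      + (?c * \<eta>\<^sup>2 * 2) * expectation ?E + ?c * expectation ?S + ?c"
    unfolding lyap_def
  proof (rule expectation_le_linear[OF integrable_terms(3) integrable_terms(3,2,1,4)])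
    fix \<omega> assume \<omega>: "\<omega> \<in> space M"
    define v where "v = (\<lambda>k. w k i \<omega>)"
    define b where "b = (\<lambda>k. dir k (w k i \<omega>) (s k i \<omega>))"
    define h where "h = (\<lambda>k. (- \<mu>) *\<^sub>R (b k - wavg p b))"
    have av: "avg i \<omega> = wavg p v" by (simp add: avg_def v_def)
    have h0: "wavg p h = 0" unfolding h_def wavg_scaleR wavg_centered by simp
    have w': "(\<lambda>k. w k (Suc i) \<omega>) = mix A (\<lambda>l. v l - \<mu> *\<^sub>R b l)"
      using step[OF \<omega>] by (simp add: fun_eq_iff v_def b_def)
    have split: "(\<lambda>l. v l - \<mu> *\<^sub>R b l - wavg p (\<lambda>l. v l - \<mu> *\<^sub>R b l)) = (\<lambda>l. (v l - wavg p v) + h l)"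
      by (simp add: fun_eq_iff h_def wavg_diff wavg_scaleR algebra_simps)
    have "(\<lambda>k. w k (Suc i) \<omega> - avg (Suc i) \<omega>) = mix A (\<lambda>l. (v l - wavg p v) + h l)"
    proof
      fix k
      have "w k (Suc i) \<omega> - avg (Suc i) \<omega>
          = mix A (\<lambda>l. v l - \<mu> *\<^sub>R b l) k - wavg p (mix A (\<lambda>l. v l - \<mu> *\<^sub>R b l))"
        unfolding avg_def w' using fun_cong[OF w', of k] by simp
      also have "\<dots> = mix A (\<lambda>l. v l - \<mu> *\<^sub>R b l - wavg p (\<lambda>l. v l - \<mu> *\<^sub>R b l)) k"
        by (rule center_mix[OF stochastic A_p])
      finally show "w k (Suc i) \<omega> - avg (Suc i) \<omega> = mix A (\<lambda>l. (v l - wavg p v) + h l) k"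
        unfolding split .
    qed
    then have "lyapunov A p \<theta> n (\<lambda>k. w k (Suc i) \<omega> - avg (Suc i) \<omega>) \<le> \<rho> * ?V \<omega> + C * wnorm2 p h"
      using lyapunov_mix[OF wavg_centered h0, of v] by (simp add: av) (simp add: v_def)
    also have "\<dots> \<le> \<rho> * ?V \<omega> + C * (\<mu>\<^sup>2 * (27 * K\<^sup>2 * (1 + \<eta>\<^sup>2 * (2 * ?D \<omega> + 2 * ?E \<omega>) + ?S \<omega>)))"
    proof (intro add_left_mono mult_left_mono)
      have "wnorm2 p h = \<mu>\<^sup>2 * wnorm2 p (\<lambda>k. b k - wavg p b)"
        by (simp add: h_def wnorm2_def power_mult_distrib sum_distrib_left mult_ac)
      also have "\<dots> \<le> \<mu>\<^sup>2 * wnorm2 p b"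
        by (intro mult_left_mono wnorm2_centered_le) simp
      also have "\<dots> \<le> \<mu>\<^sup>2 * (27 * K\<^sup>2 * (1 + \<eta>\<^sup>2 * (2 * ?D \<omega> + 2 * ?E \<omega>) + ?S \<omega>))"
        unfolding b_def avg_def by (intro mult_left_mono wnorm2_dir_le) simp
      finally show "wnorm2 p h \<le> \<mu>\<^sup>2 * (27 * K\<^sup>2 * (1 + \<eta>\<^sup>2 * (2 * ?D \<omega> + 2 * ?E \<omega>) + ?S \<omega>))" .
    qed (use C in simp)
    also have "\<dots> = \<rho> * ?V \<omega> + (?c * \<eta>\<^sup>2 * 2) * ?D \<omega> + (?c * \<eta>\<^sup>2 * 2) * ?E \<omega> + ?c * ?S \<omega> + ?c"
      by (simp only: distrib_left distrib_right mult.assoc mult_1_right mult.left_commute add_ac)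
    finally show "lyapunov A p \<theta> n (\<lambda>k. w k (Suc i) \<omega> - avg (Suc i) \<omega>)
        \<le> \<rho> * ?V \<omega> + (?c * \<eta>\<^sup>2 * 2) * ?D \<omega> + (?c * \<eta>\<^sup>2 * 2) * ?E \<omega> + ?c * ?S \<omega> + ?c" .
  qed
  also have "\<dots> = \<rho> * lyap i
    + C * (\<mu>\<^sup>2 * (27 * K\<^sup>2 * (1 + \<eta>\<^sup>2 * (2 * disagreement i + 2 * msd i) + noise_power i)))"
    unfolding msd_def[symmetric] noise_power_def[symmetric] disagreement_def[symmetric] lyap_def[symmetric]
    by (simp only: distrib_left distrib_right mult.assoc mult_1_right mult.left_commute add_ac)
  finally show ?thesis .
qed

lemma limsup_error_le:
  defines "c \<equiv> 8 * K ^ 3 + 160 * K ^ 5 / lam + 162 * C * K ^ 5"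
  assumes small: "8 * c * (\<mu> * \<eta>\<^sup>2) \<le> lam" "3 * c * (\<mu> * \<eta>\<^sup>2) + lam / 4 * (\<mu> * \<eta>\<^sup>2) \<le> 1 - \<rho>"
  shows "limsup (\<lambda>i. \<integral>\<^sup>+\<omega>. ennreal ((norm (z - w k i \<omega>))\<^sup>2) \<partial>M)
    \<le> ennreal ((2 + 2 * (\<Sum>j\<in>UNIV. 1 / p $ j)) * (8 * c / lam) * \<mu>)"
proof -
  \<comment> \<open>Recovering one agent from the weighted norm costs \<open>1 / p $ k\<close>;
    summing over all agents makes the constant independent of \<open>k\<close>. The factors
    \<open>2\<close> come from splitting the error through the average.\<close>
  define P where "P = 2 + 2 * (\<Sum>j\<in>UNIV. 1 / p $ j)"
  define a where "a = \<mu> * lam / 4"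
  define b where "b = 2 * c * \<mu>\<^sup>2"
  have a: "0 < a" "a \<le> 1" using mu lam mu_lam by (auto simp: a_def)
  have P1: "1 / p $ k \<le> (\<Sum>j\<in>UNIV. 1 / p $ j)" for k
    by (rule member_le_sum) (auto simp: p_nonneg)
  have P: "2 \<le> P" "2 * (1 / p $ k) \<le> P" for k
    using P1[of k] p_pos[of k] p_nonneg by (auto simp: P_def intro!: sum_nonneg)
  have "msd (Suc i) + lyap (Suc i) \<le> (1 - a) * (msd i + lyap i) + b" for i
    unfolding a_def b_def c_def
    by (rule drift_combine[OF moments_nonneg(1,4,3) noise_power_le K C lam mu eta nu_le_1 _ _ msd_drift lyap_drift])
      (use small in \<open>simp_all only: c_def\<close>)
  note Z = linear_recursion_bound[of a "\<lambda>i. msd i + lyap i", OF a this]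
  have err: "(\<integral>\<^sup>+\<omega>. ennreal ((norm (z - w k i \<omega>))\<^sup>2) \<partial>M)
      \<le> ennreal (P * ((1 - a) ^ i * (msd 0 + lyap 0 - b / a) + b / a))" for i
  proof -
    have int: "integrable M (\<lambda>\<omega>. (norm (z - w k i \<omega>))\<^sup>2)"
      by (rule square_integrableD(2)[OF square_integrable_diff[OF square_integrable_const w_square_integrable]])
    have "expectation (\<lambda>\<omega>. (norm (z - w k i \<omega>))\<^sup>2) \<le> P * msd i + P * lyap i + 0 * msd i + 0 * msd i + 0"
      unfolding msd_def lyap_def
    proof (rule expectation_le_linear[OF int integrable_terms(1,3,1,1)])
      fix \<omega>
      let ?V = "lyapunov A p \<theta> n (\<lambda>k. w k i \<omega> - avg i \<omega>)"
      have "p $ k * (norm (w k i \<omega> - avg i \<omega>))\<^sup>2 \<le> wnorm2 p (\<lambda>k. w k i \<omega> - avg i \<omega>)"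
        unfolding wnorm2_def by (rule member_le_sum) (auto simp: p_nonneg)
      also have "\<dots> \<le> ?V" by (rule lyapunov_lower)
      finally have "p $ k * (norm (w k i \<omega> - avg i \<omega>))\<^sup>2 \<le> ?V" .
      then have d: "(norm (w k i \<omega> - avg i \<omega>))\<^sup>2 \<le> 1 / p $ k * ?V"
        using p_pos[of k] by (simp add: field_simps)
      have V0: "0 \<le> ?V" by (rule order_trans[OF wnorm2_nonneg lyapunov_lower])
      have "z - w k i \<omega> = - ((w k i \<omega> - avg i \<omega>) + (avg i \<omega> - z))" by simp
      then have "(norm (z - w k i \<omega>))\<^sup>2 = (norm ((w k i \<omega> - avg i \<omega>) + (avg i \<omega> - z)))\<^sup>2"
        by (simp only: norm_minus_cancel)
      also have "\<dots> \<le> 2 * (norm (w k i \<omega> - avg i \<omega>))\<^sup>2 + 2 * (norm (avg i \<omega> - z))\<^sup>2"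
        using norm_add_sq_le[of 1 "w k i \<omega> - avg i \<omega>" "avg i \<omega> - z"] by simp
      also have "\<dots> \<le> 2 * (1 / p $ k) * ?V + 2 * (norm (avg i \<omega> - z))\<^sup>2"
        using d by simp
      also have "\<dots> \<le> P * ?V + P * (norm (avg i \<omega> - z))\<^sup>2"
        by (intro add_mono mult_right_mono P V0) simp
      finally show "(norm (z - w k i \<omega>))\<^sup>2 \<le> P * (norm (avg i \<omega> - z))\<^sup>2 + P * ?V
          + 0 * (norm (avg i \<omega> - z))\<^sup>2 + 0 * (norm (avg i \<omega> - z))\<^sup>2 + 0" by simp
    qed
    also have "\<dots> = P * (msd i + lyap i)" by (simp add: distrib_left)
    also have "\<dots> \<le> P * ((1 - a) ^ i * (msd 0 + lyap 0 - b / a) + b / a)"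
      using P(1) by (intro mult_left_mono Z) simp
    finally have "expectation (\<lambda>\<omega>. (norm (z - w k i \<omega>))\<^sup>2) \<le> P * ((1 - a) ^ i * (msd 0 + lyap 0 - b / a) + b / a)" .
    then show ?thesis
      using nn_integral_eq_integral[OF int] by (simp add: ennreal_leI)
  qed
  have pow: "(\<lambda>i. (1 - a) ^ i) \<longlonglongrightarrow> 0" using a by (intro LIMSEQ_realpow_zero; simp)
  have "(\<lambda>i. P * ((1 - a) ^ i * (msd 0 + lyap 0 - b / a) + b / a))
      \<longlonglongrightarrow> P * (0 * (msd 0 + lyap 0 - b / a) + b / a)"
    by (intro tendsto_mult tendsto_add tendsto_const pow)
  then have lim: "(\<lambda>i. ennreal (P * ((1 - a) ^ i * (msd 0 + lyap 0 - b / a) + b / a)))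
      \<longlonglongrightarrow> ennreal (P * (0 * (msd 0 + lyap 0 - b / a) + b / a))"
    by (rule tendsto_ennrealI)
  have "limsup (\<lambda>i. \<integral>\<^sup>+\<omega>. ennreal ((norm (z - w k i \<omega>))\<^sup>2) \<partial>M)
      \<le> limsup (\<lambda>i. ennreal (P * ((1 - a) ^ i * (msd 0 + lyap 0 - b / a) + b / a)))"
    by (intro Limsup_mono always_eventually allI err)
  also have "\<dots> = ennreal (P * (0 * (msd 0 + lyap 0 - b / a) + b / a))"
    by (rule lim_imp_Limsup[OF _ lim]) simp
  \<comment> \<open>The limiting level is \<open>b / a\<close>: a source of order
    \<open>\<mu>\<^sup>2\<close> over a rate of order \<open>\<mu>\<close> leaves order
    \<open>\<mu>\<close>.\<close>
  also have "P * (0 * (msd 0 + lyap 0 - b / a) + b / a) = P * (8 * c / lam) * \<mu>"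
    using mu lam by (simp add: a_def b_def power2_eq_square)
  finally show ?thesis unfolding P_def .
qed

end

section \<open>Constants uniform in the step-size, and the conclusion\<close>

theorem theorem3:
  fixes M :: "'w measure"
    and A :: "real^'n^'n"
    and p :: "real^'n"
    and J R :: "'n \<Rightarrow> real^'m \<Rightarrow> real"
    and d :: "real^'m \<Rightarrow> ereal"
    and lamU lamL \<beta> \<sigma> \<kappa> :: real
    and gh :: "real \<Rightarrow> 'n \<Rightarrow> nat \<Rightarrow> 'w \<Rightarrow> real^'m \<Rightarrow> real^'m"
    and w :: "real \<Rightarrow> 'n \<Rightarrow> nat \<Rightarrow> 'w \<Rightarrow> real^'m"
  assumes "prob_space M"
    and "left_stochastic A"
    and "strongly_connected A"
    and "\<exists>k. A $ k $ k > 0"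
    and "perron_vector A p"
    and "\<And>k x. J k differentiable (at x)"
    and "\<And>k x y. norm (grad (J k) x - grad (J k) y) \<le> lamU * norm (x - y)"
    and "lamL > 0"
    and "\<And>x y. (x - y) \<bullet> (\<Sum>k\<in>UNIV. p $ k *\<^sub>R (grad (J k) x - grad (J k) y)) \<ge> lamL * (norm (x - y))\<^sup>2"
    and "\<And>k. closed_convex_fun (R k)"
    and "\<And>k. proximity_function (eff_dom (conjugate (R k))) d"
    and "1 / 4 < \<kappa>" and "\<kappa> < 1 / 2"
    and "\<And>\<mu>. \<mu> > 0 \<Longrightarrow> regularized_diffusion M A R d \<mu> (\<mu> powr (1 / 2 - \<kappa>)) (gh \<mu>) (w \<mu>)"
    and "\<And>\<mu>. \<mu> > 0 \<Longrightarrow> gradient_noise_condition M J \<beta> \<sigma> (gh \<mu>) (w \<mu>)"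
  shows "\<exists>\<mu>\<^sub>0>0. \<exists>c>0. \<forall>\<mu>. 0 < \<mu> \<and> \<mu> \<le> \<mu>\<^sub>0 \<longrightarrow> (\<forall>k.
           limsup (\<lambda>i. \<integral>\<^sup>+\<omega>. ennreal ((norm
               (the_minimizer (aggregate_cost p J R d (\<mu> powr (1 / 2 - \<kappa>))) - w \<mu> k i \<omega>))\<^sup>2) \<partial>M)
             \<le> ennreal (c * \<mu>))"
proof -
  interpret prob_space M by fact
  define gJ where "gJ k = grad (J k)" for k
  define u where "u \<delta> k = grad (smoothed d \<delta> (R k))" for \<delta> k
  define z where "z \<delta> = the_minimizer (aggregate_cost p J R d \<delta>)" for \<delta>
  have Ap: "A *v p = p" and p1: "(\<Sum>k\<in>UNIV. p $ k) = 1" and p0: "\<And>k. p $ k > 0"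
    using assms(5) by (auto simp: perron_vector_def)
  interpret weights p by unfold_locales (rule p0 p1)+
  obtain \<theta> \<rho> n C where \<rho>: "0 < \<rho>" "\<rho> < 1" and C: "C \<ge> 1"
    and lower: "\<And>f :: 'n \<Rightarrow> real^'m. wnorm2 p f \<le> lyapunov A p \<theta> n f"
    and drift: "\<And>f g :: 'n \<Rightarrow> real^'m. \<lbrakk>(\<Sum>k\<in>UNIV. p $ k *\<^sub>R f k) = 0; (\<Sum>k\<in>UNIV. p $ k *\<^sub>R g k) = 0\<rbrakk> \<Longrightarrow>
      lyapunov A p \<theta> n (mix A (\<lambda>k. f k + g k)) \<le> \<rho> * lyapunov A p \<theta> n f + C * wnorm2 p g"
  proof (rule lyapunov_drift[OF assms(2,3,4,5), where 'a = "real^'m"])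
    fix \<theta> \<rho> n C
    assume 1: "0 < \<rho>" "\<rho> < 1" "C \<ge> 1" "\<And>f :: 'n \<Rightarrow> real^'m. wnorm2 p f \<le> lyapunov A p \<theta> n f"
      and 2: "\<And>f g :: 'n \<Rightarrow> real^'m. \<lbrakk>(\<Sum>k\<in>UNIV. p $ k *\<^sub>R f k) = 0; (\<Sum>k\<in>UNIV. p $ k *\<^sub>R g k) = 0\<rbrakk> \<Longrightarrow>
        lyapunov A p \<theta> n (mix A (\<lambda>k. f k + g k)) \<le> \<rho> * lyapunov A p \<theta> n f + C * wnorm2 p g"
    show thesis by (rule that[OF 1 2])
  qed
  note min = aggregate_minimizer[where p = p and J = J and R = R and d = d and lamU = lamU,
      OF p0 assms(6) assms(7) assms(9) assms(8) assms(11), folded gJ_def u_def z_def]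
  have convR: "convex_on UNIV (R k)" for k
    using assms(10)[of k] by (simp add: closed_convex_fun_def)
  \<comment> \<open>The order of quantifiers matters: \<open>B\<close> is fixed before
    \<open>\<delta>\<close>, and a maximum over the finitely many agents makes it common to
    all.\<close>
  have u_bound: "\<exists>B. \<forall>k (\<delta>::real) (x::real^'m). \<delta> > 0 \<longrightarrow> norm x \<le> r \<longrightarrow> norm (u \<delta> k x) \<le> B" for r
  proof -
    have "\<exists>B. \<forall>(\<delta>::real) (x::real^'m). \<delta> > 0 \<longrightarrow> norm x \<le> r \<longrightarrow> norm (u \<delta> k x) \<le> B" for k
    proof (rule smoothed_gradient_bounded[OF convR[of k] assms(11)[of k], where r = r])
      fix B assume B: "\<And>\<delta> x. \<lbrakk>\<delta> > 0; norm x \<le> r\<rbrakk> \<Longrightarrow> norm (grad (smoothed d \<delta> (R k)) x) \<le> B"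
      show ?thesis unfolding u_def by (intro exI[of _ B] allI impI B)
    qed
    then have "\<forall>k. \<exists>B. \<forall>(\<delta>::real) (x::real^'m). \<delta> > 0 \<longrightarrow> norm x \<le> r \<longrightarrow> norm (u \<delta> k x) \<le> B" ..
    from choice[OF this] obtain B
      where B: "\<forall>k (\<delta>::real) (x::real^'m). \<delta> > 0 \<longrightarrow> norm x \<le> r \<longrightarrow> norm (u \<delta> k x) \<le> B k" ..
    show ?thesis
    proof (intro exI[of _ "Max (range B)"] allI impI)
      fix k and \<delta> :: real and x :: "real^'m"
      assume "\<delta> > 0" "norm x \<le> r"
      then have "norm (u \<delta> k x) \<le> B k" using B by simp
      also have "\<dots> \<le> Max (range B)" by (rule Max_ge) auto
      finally show "norm (u \<delta> k x) \<le> Max (range B)" .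
    qed
  qed
  \<comment> \<open>The bound is used at two radii: radius \<open>0\<close> controls the aggregate
    gradient at the origin and hence the size \<open>r\<close> of the minimizers, and only then does
    radius \<open>r\<close> control the individual gradients at them.\<close>
  obtain B0 where B0: "\<And>k \<delta>. \<delta> > 0 \<Longrightarrow> norm (u (\<delta>::real) k 0) \<le> B0"
    using u_bound[of 0] by auto
  define g0 where "g0 = Max (range (\<lambda>k. norm (gJ k 0)))"
  have g0: "norm (gJ k 0) \<le> g0" for k unfolding g0_def by (rule Max_ge) auto
  define r where "r = (g0 + B0) / lamL"
  have z_le: "norm (z \<delta>) \<le> r" if "\<delta> > 0" for \<delta>
  proof -
    have "norm (\<Sum>k\<in>UNIV. p $ k *\<^sub>R (gJ k 0 + u \<delta> k 0)) \<le> (\<Sum>k\<in>UNIV. p $ k * (g0 + B0))"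
    proof (rule order_trans[OF norm_sum sum_mono])
      fix k
      have "norm (gJ k 0 + u \<delta> k 0) \<le> g0 + B0" by (rule norm_triangle_mono[OF g0 B0[OF that]])
      then show "norm (p $ k *\<^sub>R (gJ k 0 + u \<delta> k 0)) \<le> p $ k * (g0 + B0)"
        using p_nonneg[of k] by (simp add: mult_left_mono)
    qed
    also have "\<dots> = g0 + B0" by (simp add: sum_distrib_right[symmetric] p1)
    finally have "norm (\<Sum>k\<in>UNIV. p $ k *\<^sub>R (gJ k 0 + u \<delta> k 0)) / lamL \<le> r"
      unfolding r_def using assms(8) by (intro divide_right_mono) simp_all
    with min(3)[OF that] show ?thesis by (rule order_trans)
  qed
  have "0 \<le> r" using z_le[of 1] norm_ge_zero[of "z 1"] by linarith
  have "0 \<le> g0" using g0 norm_ge_zero by (rule order_trans[rotated])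
  obtain B1 where B1: "\<And>k (\<delta>::real) (x::real^'m). \<lbrakk>\<delta> > 0; norm x \<le> r\<rbrakk> \<Longrightarrow> norm (u \<delta> k x) \<le> B1"
    using u_bound[of r] by auto
  define K where "K = 1 + \<bar>lamU\<bar> + r + (g0 + \<bar>lamU\<bar> * r) + \<bar>B1\<bar> + \<beta>\<^sup>2 + \<sigma>\<^sup>2"
  have "0 \<le> \<bar>lamU\<bar> * r" using \<open>0 \<le> r\<close> by simp
  then have K: "1 \<le> K" "\<bar>lamU\<bar> \<le> K" "r \<le> K" "g0 + \<bar>lamU\<bar> * r \<le> K" "\<bar>B1\<bar> \<le> K" "\<beta>\<^sup>2 \<le> K" "\<sigma>\<^sup>2 \<le> K"
    unfolding K_def using \<open>0 \<le> r\<close> \<open>0 \<le> g0\<close> zero_le_power2[of \<beta>] zero_le_power2[of \<sigma>] abs_ge_zero[of lamU] abs_ge_zero[of B1]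
    by - linarith+
  define c where "c = 8 * K ^ 3 + 160 * K ^ 5 / lamL + 162 * C * K ^ 5"
  have "0 < K ^ 3" "0 < K ^ 5" using K(1) by simp_all
  then have c: "c > 0" using assms(8) C unfolding c_def by (intro add_pos_pos) simp_all
  \<comment> \<open>Each summand of \<open>Q\<close> encodes one smallness condition on \<open>\<nu> = \<mu> * \<eta>\<^sup>2\<close>; all follow from \<open>\<nu> \<le> 1 / Q\<close>.\<close>
  define Q where "Q = 1 + lamL / 2 + 4 * K\<^sup>2 / lamL + 8 * c / lamL + (3 * c + lamL / 4) / (1 - \<rho>)"
  have Q_parts: "0 \<le> lamL / 2" "0 \<le> 4 * K\<^sup>2 / lamL" "0 \<le> 8 * c / lamL" "0 \<le> (3 * c + lamL / 4) / (1 - \<rho>)"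
    using assms(8) c \<rho> by simp_all
  then have Q_ge: "1 \<le> Q" "lamL / 2 \<le> Q" "4 * K\<^sup>2 / lamL \<le> Q" "8 * c / lamL \<le> Q"
    "(3 * c + lamL / 4) / (1 - \<rho>) \<le> Q"
    unfolding Q_def by - linarith+
  \<comment> \<open>The power makes \<open>\<mu> powr (2 * \<kappa>) \<le> 1 / Q\<close> for all
    admissible \<open>\<mu>\<close>; the cap at \<open>1\<close> gives
    \<open>\<delta> \<le> 1\<close>, that is \<open>1 \<le> \<eta>\<close>.\<close>
  define \<mu>\<^sub>0 where "\<mu>\<^sub>0 = min 1 ((1 / Q) powr (1 / (2 * \<kappa>)))"
  have "\<mu>\<^sub>0 > 0" using Q_ge(1) by (simp add: \<mu>\<^sub>0_def)
  define c' where "c' = (2 + 2 * (\<Sum>j\<in>UNIV. 1 / p $ j)) * (8 * c / lamL)"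
  have "0 \<le> (\<Sum>j\<in>UNIV. 1 / p $ j)" by (intro sum_nonneg) (simp add: p_nonneg)
  then have "c' > 0" unfolding c'_def using c assms(8) by (intro mult_pos_pos divide_pos_pos add_pos_nonneg) simp_all
  have main: "limsup (\<lambda>i. \<integral>\<^sup>+\<omega>. ennreal ((norm (z (\<mu> powr (1 / 2 - \<kappa>)) - w \<mu> k i \<omega>))\<^sup>2) \<partial>M) \<le> ennreal (c' * \<mu>)"
    if \<mu>: "0 < \<mu>" "\<mu> \<le> \<mu>\<^sub>0" for \<mu> k
  proof -
    define \<delta> where "\<delta> = \<mu> powr (1 / 2 - \<kappa>)"
    define \<eta> where "\<eta> = 1 / \<delta>"
    define s where "s k i = gradient_noise J (gh \<mu>) (w \<mu>) k (Suc i)" for k i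
    have \<delta>: "0 < \<delta>" using \<mu> by (simp add: \<delta>_def)
    have "\<delta> \<le> 1 powr (1 / 2 - \<kappa>)"
      unfolding \<delta>_def using \<mu> assms(13) by (intro powr_mono2) (simp_all add: \<mu>\<^sub>0_def)
    then have \<eta>: "1 \<le> \<eta>" using \<delta> by (simp add: \<eta>_def)
    \<comment> \<open>The square of \<open>\<delta>\<close> is
      \<open>\<mu> powr (1 - 2 * \<kappa>)\<close>, so the positive exponent
      \<open>2 * \<kappa>\<close> remains.\<close>
    have "\<mu> * \<eta>\<^sup>2 = \<mu> powr 1 / \<mu> powr (1 - 2 * \<kappa>)"
      using \<mu> by (simp add: \<eta>_def \<delta>_def power2_eq_square powr_add[symmetric])
    also have "\<dots> = \<mu> powr (2 * \<kappa>)" 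
      using powr_diff[of \<mu> 1 "1 - 2 * \<kappa>"] by (simp only: diff_diff_eq2) simp
    also have "\<dots> \<le> ((1 / Q) powr (1 / (2 * \<kappa>))) powr (2 * \<kappa>)"
      using \<mu> assms(12) by (intro powr_mono2) (simp_all add: \<mu>\<^sub>0_def)
    also have "\<dots> = 1 / Q" using Q_ge(1) assms(12) by (simp add: powr_powr)
    finally have \<nu>Q: "\<mu> * \<eta>\<^sup>2 \<le> 1 / Q" .
    have \<nu>0: "0 \<le> \<mu> * \<eta>\<^sup>2" using \<mu> by simp
    have \<nu>: "\<mu> * \<eta>\<^sup>2 * q \<le> 1" if "q \<le> Q" for q
    proof -
      have "\<mu> * \<eta>\<^sup>2 * q \<le> \<mu> * \<eta>\<^sup>2 * Q" using that \<nu>0 by (rule mult_left_mono)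
      also have "\<dots> \<le> 1 / Q * Q" using Q_ge(1) by (intro mult_right_mono \<nu>Q) simp
      also have "\<dots> = 1" using Q_ge(1) by simp
      finally show ?thesis .
    qed
    have "\<mu> * 1 \<le> \<mu> * \<eta>\<^sup>2" using \<mu> \<eta> by (intro mult_left_mono) simp_all
    then have \<mu>\<nu>: "\<mu> \<le> \<mu> * \<eta>\<^sup>2" by simp
    have small: "\<mu> * \<eta>\<^sup>2 \<le> 1" "4 * K\<^sup>2 * (\<mu> * \<eta>\<^sup>2) \<le> lamL" "8 * c * (\<mu> * \<eta>\<^sup>2) \<le> lamL"
      using \<nu>[OF Q_ge(1)] \<nu>[OF Q_ge(3)] \<nu>[OF Q_ge(4)] assms(8) by (simp_all add: field_simps)
    have "(\<mu> * \<eta>\<^sup>2 * (3 * c + lamL / 4)) / (1 - \<rho>) \<le> 1" using \<nu>[OF Q_ge(5)] by simp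
    then have "\<mu> * \<eta>\<^sup>2 * (3 * c + lamL / 4) \<le> 1 - \<rho>" using \<rho> by (simp only: divide_le_eq_1_pos)
    then have small': "3 * c * (\<mu> * \<eta>\<^sup>2) + lamL / 4 * (\<mu> * \<eta>\<^sup>2) \<le> 1 - \<rho>"
      by (simp only: distrib_right[symmetric] mult.commute)
    have "\<mu> * (lamL / 2) \<le> \<mu> * \<eta>\<^sup>2 * (lamL / 2)" using assms(8) by (intro mult_right_mono \<mu>\<nu>) simp
    then have \<mu>_lam: "\<mu> * lamL \<le> 2" using \<nu>[OF Q_ge(2)] by linarith
    have lipJ: "norm (gJ k x - gJ k y) \<le> \<bar>lamU\<bar> * norm (x - y)" for k x y
      unfolding gJ_def by (rule order_trans[OF assms(7)]) (simp add: mult_right_mono)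
    note run = assms(14)[OF \<mu>(1), folded \<delta>_def, unfolded regularized_diffusion_def]
    from run[THEN conjunct2, folded u_def] obtain \<phi> \<psi> where "\<forall>i\<ge>1. \<forall>k. \<forall>\<omega>\<in>space M.
        \<phi> k i \<omega> = w \<mu> k (i - 1) \<omega> - \<mu> *\<^sub>R gh \<mu> k i \<omega> (w \<mu> k (i - 1) \<omega>) \<and>
        \<psi> k i \<omega> = \<phi> k i \<omega> - \<mu> *\<^sub>R u \<delta> k (\<phi> k i \<omega>) \<and>
        w \<mu> k i \<omega> = (\<Sum>l\<in>UNIV. A $ l $ k *\<^sub>R \<psi> l i \<omega>)"
      by (elim exE) (rule that)
    note rec = this[rule_format]
    have noise: "gradient_noise J (gh \<mu>) (w \<mu>) k i \<in> borel_measurable M \<and>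
        (\<forall>b\<in>Basis. AE \<omega> in M.
           real_cond_exp M (history M (w \<mu>) (i - 1)) (\<lambda>\<omega>'. gradient_noise J (gh \<mu>) (w \<mu>) k i \<omega>' \<bullet> b) \<omega> = 0) \<and>
        (AE \<omega> in M.
           nn_cond_exp M (history M (w \<mu>) (i - 1)) (\<lambda>\<omega>'. ennreal ((norm (gradient_noise J (gh \<mu>) (w \<mu>) k i \<omega>'))\<^sup>2)) \<omega>
             \<le> ennreal (\<beta>\<^sup>2 * (norm (w \<mu> k (i - 1) \<omega>))\<^sup>2 + \<sigma>\<^sup>2))" if "1 \<le> i" for k i
      using assms(15)[OF \<mu>(1), unfolded gradient_noise_condition_def, rule_format, OF that, of k] .
    interpret step: diffusion_step p gJ "u \<delta>" "z \<delta>" \<mu> \<eta> K lamL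
    proof unfold_locales
      show "norm (gJ k x - gJ k y) \<le> K * norm (x - y)" for k x y
        by (rule order_trans[OF lipJ]) (simp add: mult_right_mono K)
      show "norm (u \<delta> k x - u \<delta> k y) \<le> \<eta> * norm (x - y)" for k x y
        unfolding u_def \<eta>_def by (rule smoothed_gradient_lipschitz[OF assms(11) \<delta>])
      show "lamL * (norm (x - y))\<^sup>2
          \<le> (x - y) \<bullet> (wavg p (\<lambda>k. gJ k x + u \<delta> k x) - wavg p (\<lambda>k. gJ k y + u \<delta> k y))" for x y
        unfolding wavg_def by (rule min(1)[OF \<delta>])
      show "wavg p (\<lambda>k. gJ k (z \<delta>) + u \<delta> k (z \<delta>)) = 0"
        unfolding wavg_def by (rule min(2)[OF \<delta>])
      show "norm (z \<delta>) \<le> K" using z_le[OF \<delta>] K(3) by (rule order_trans)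
      show "norm (u \<delta> k (z \<delta>)) \<le> K" for k
        using B1[OF \<delta> z_le[OF \<delta>], of k] K(5) by linarith
      show "norm (gJ k (z \<delta>)) \<le> K" for k
      proof -
        have "norm (gJ k 0 + (gJ k (z \<delta>) - gJ k 0)) \<le> g0 + \<bar>lamU\<bar> * norm (z \<delta> - 0)"
          by (rule norm_triangle_mono[OF g0 lipJ])
        also have "\<dots> \<le> g0 + \<bar>lamU\<bar> * r"
          using z_le[OF \<delta>] by (intro add_left_mono mult_left_mono) simp_all
        finally show ?thesis using K(4) by simp
      qed
    qed (use K \<mu> \<eta> small \<mu>_lam assms(8) in \<open>simp_all only:\<close>)
    interpret run: diffusion_process p gJ "u \<delta>" "z \<delta>" \<mu> \<eta> K lamL M A \<theta> \<rho> C n s "w \<mu>"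
    proof unfold_locales
      show "wnorm2 p f \<le> lyapunov A p \<theta> n f" for f :: "'n \<Rightarrow> real^'m" by (rule lower)
      show "lyapunov A p \<theta> n (mix A (\<lambda>k. f k + g k)) \<le> \<rho> * lyapunov A p \<theta> n f + C * wnorm2 p g"
        if "wavg p f = 0" "wavg p g = 0" for f g :: "'n \<Rightarrow> real^'m"
        using that unfolding wavg_def by (rule drift)
      show "w \<mu> k (Suc i) \<omega> = mix A (\<lambda>l. w \<mu> l i \<omega> - \<mu> *\<^sub>R step.dir l (w \<mu> l i \<omega>) (s l i \<omega>)) k"
        if "\<omega> \<in> space M" for k i \<omega>
      proof -
        \<comment> \<open>Eliminates the existentially given intermediate iterates: the stochastic
          gradient is the true gradient plus \<open>s l i\<close>, and substituting
          \<open>\<phi>\<close> into the regularization substep gives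
          \<open>step.dir\<close>.\<close>
        have "\<psi> l (Suc i) \<omega> = w \<mu> l i \<omega> - \<mu> *\<^sub>R step.dir l (w \<mu> l i \<omega>) (s l i \<omega>)" for l
        proof -
          have \<phi>: "\<phi> l (Suc i) \<omega> = w \<mu> l i \<omega> - \<mu> *\<^sub>R (gJ l (w \<mu> l i \<omega>) + s l i \<omega>)"
            using rec[OF _ that, of "Suc i" l] by (simp add: s_def gradient_noise_def gJ_def)
          have \<psi>: "\<psi> l (Suc i) \<omega> = \<phi> l (Suc i) \<omega> - \<mu> *\<^sub>R u \<delta> l (\<phi> l (Suc i) \<omega>)"
            using rec[OF _ that, of "Suc i" l] by simp
          show ?thesis
            unfolding \<psi> \<phi> step.dir_def by (simp only: scaleR_add_right diff_diff_eq)
        qed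
        then show ?thesis
          using rec[OF _ that, of "Suc i" k] by (simp add: mix_def)
      qed
      show "square_integrable M (w \<mu> k 0)" for k
        using run[THEN conjunct1] by (simp add: square_integrable_def)
      show "s k i \<in> borel_measurable M" for k i
        unfolding s_def using noise[of "Suc i" k] by simp
      show "AE \<omega> in M. real_cond_exp M (history M (w \<mu>) i) (\<lambda>\<omega>. s k i \<omega> \<bullet> b) \<omega> = 0"
        if "b \<in> Basis" for k i b
        unfolding s_def using noise[of "Suc i" k] that by simp
      show "AE \<omega> in M. nn_cond_exp M (history M (w \<mu>) i) (\<lambda>\<omega>. ennreal ((norm (s k i \<omega>))\<^sup>2)) \<omega>
          \<le> ennreal (K * (norm (w \<mu> k i \<omega>))\<^sup>2 + K)" for k i
      proof -
        have ae: "AE \<omega> in M. nn_cond_exp M (history M (w \<mu>) i) (\<lambda>\<omega>. ennreal ((norm (s k i \<omega>))\<^sup>2)) \<omega>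
            \<le> ennreal (\<beta>\<^sup>2 * (norm (w \<mu> k i \<omega>))\<^sup>2 + \<sigma>\<^sup>2)"
          unfolding s_def using noise[of "Suc i" k] by simp
        have le: "ennreal (\<beta>\<^sup>2 * (norm (w \<mu> k i \<omega>))\<^sup>2 + \<sigma>\<^sup>2) \<le> ennreal (K * (norm (w \<mu> k i \<omega>))\<^sup>2 + K)" for \<omega>
          by (intro ennreal_leI add_mono mult_right_mono K) simp
        show ?thesis using ae by eventually_elim (rule order_trans[OF _ le])
      qed
    qed (use assms(2) Ap C in \<open>simp_all only:\<close>)
    show ?thesis
      using run.limsup_error_le[folded c_def, OF small(3) small', of k] by (simp only: \<delta>_def c'_def)
  qed
  then have "\<exists>c>0. \<forall>\<mu>. 0 < \<mu> \<and> \<mu> \<le> \<mu>\<^sub>0 \<longrightarrow> (\<forall>k.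
      limsup (\<lambda>i. \<integral>\<^sup>+\<omega>. ennreal ((norm (z (\<mu> powr (1 / 2 - \<kappa>)) - w \<mu> k i \<omega>))\<^sup>2) \<partial>M) \<le> ennreal (c * \<mu>))"
    using \<open>c' > 0\<close> by (intro exI[of _ c']) simp
  then show ?thesis
    unfolding z_def
    by - (rule exI[of _ \<mu>\<^sub>0], rule conjI, rule \<open>\<mu>\<^sub>0 > 0\<close>, assumption)
qed

end
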